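(* Let $\mathcal S=S_1\oplus\cdots\oplus S_n$ be the minimal operator on the star graph described in the context, with adjoint $\mathcal S^*$. (i) The self-adjoint extensions of $\mathcal S$ in $\mathbf L^2(\mathcal G)$ are exactly the operators $\mathcal T_{\mathcal A,\mathcal B}$, i.e. the restrictions of $\mathcal S^*$ to $$\{\boldsymbol f\in\operatorname{dom}\mathcal S^*:\ \mathcal A\,\boldsymbol f_1^\sharp(v)+\mathcal B\,\boldsymbol f_2^\sharp(v)=0\},$$ where $\mathcal A,\mathcal B\in M_n(\mathbb C)$ satisfy $\operatorname{rank}(\mathcal A\ \ \mathcal B)=n$ and $\mathcal A\mathcal B^*=\mathcal B\mathcal A^*$. (ii) For such $\mathcal A,\mathcal B$ and every $z\in\rho(\mathcal T_0)\cap\rho(\mathcal T_{\mathcal A,\mathcal B})$, $$(\mathcal T_{\mathcal A,\mathcal B}-z)^{-1}=(\mathcal T_0-z)^{-1}-\Gamma_z\,(\mathcal B\mathcal M(z)-\mathcal A)^{-1}\mathcal B\,\Gamma_{\bar z}^*.$$ Here $\mathcal T_0=\mathcal T_{I_n,0_n}$ and $\Gamma_z:\mathbb C^n\to\mathbf L^2(\mathcal G)$ is given by $$\Gamma_z c=\boldsymbol Y(\cdot,z)\,\mathbf P^{\rm t}\begin{pmatrix}-c\\ \mathcal M(z)c\end{pmatrix},\qquad c\in\mathbb C^n.$$ Equivalently, $\Gamma_z(c_j)_1^n=\Big(c_j\,Y_j(\cdot,z)\binom{-1}{m_j(z)}\Big)_{j=1}^n$. (iii) Let $\mathcal C,\mathcal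 D\in M_n(\mathbb C)$ satisfy $$\operatorname{rank}(\mathcal C\ \ \mathcal D)=n,\qquad \mathcal C\mathcal D^*-\mathcal D\mathcal C^*=0_n,\qquad \mathcal B\mathcal C^*-\mathcal A\mathcal D^*=I_n.$$ Define $$\mathcal W_{\mathcal A,\mathcal B}(z)=(\mathcal D\mathcal M(z)-\mathcal C)(\mathcal B\mathcal M(z)-\mathcal A)^{-1},\qquad z\in\mathbb C\setminus\mathbb R.$$ Then $\mathcal W_{\mathcal A,\mathcal B}$ is a meromorphic matrix Nevanlinna function. Moreover, for $z\in\mathbb C\setminus\mathbb R$ and $\boldsymbol g\in\mathbf L^2(\mathcal G)$, $$(\mathcal T_{\mathcal A,\mathcal B}-z)^{-1}\boldsymbol g=\boldsymbol Y(\cdot,z)\,\mathbf P^{\rm t}\begin{pmatrix}\mathcal B^*\\-\mathcal A^*\end{pmatrix}\mathcal W_{\mathcal A,\mathcal B}(z)\,\big(\mathcal B\ \ -\mathcal A\big)\,\mathbf P\, I(\boldsymbol g,z)+\mathcal F(z)\boldsymbol g,$$ where $\mathcal F$ is an entire function whose values are bounded linear operators in $\mathbf L^2(\mathcal G)$.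
   Context: Edge data. Let $n\ge1$. For $j=1,\dots,n$ let $v<v_j$ be real numbers and set $e_j=[v,v_j]$. Let $p_j,q_j\in L^1(e_j;\mathbb R)$ and put $$J=\begin{pmatrix}0&-1\\1&0\end{pmatrix},\qquad V_j(x)=\begin{pmatrix}p_j(x)&q_j(x)\\ q_j(x)&-p_j(x)\end{pmatrix}.$$ Let $\mathbf L^2(e_j)=L^2(e_j,\mathbb C)\oplus L^2(e_j,\mathbb C)$ be the space of $\boldsymbol f_j=(f_j\ \widehat f_j)^{\rm t}$, and let $H_j\boldsymbol f_j=-J\boldsymbol f_j'+V_j\boldsymbol f_j$. Fix $\alpha_j\in[0,\pi)$ and define $$\mathcal D_j=\{\boldsymbol f_j\in\mathbf L^2(e_j):\ \boldsymbol f_j \text{ absolutely continuous},\ H_j\boldsymbol f_j\in\mathbf L^2(e_j),\ \cos\alpha_j f_j(v_j)+\sin\alpha_j\widehat f_j(v_j)=0\}.$$ Define $S_j$ by $\operatorname{dom}S_j=\{\boldsymbol f_j\in\mathcal D_j: f_j(v)=\widehat f_j(v)=0\}$ and $T_j$ by $\operatorname{dom}T_j=\{\boldsymbol f_j\in\mathcal D_j: f_j(v)=0\}$; both act by $H_j$. Let $Y_j(x,z)$ be the $2\times2$ matrix solution of $-JY_j'+V_jY_j=zY_j$ on $e_j$ with $Y_j(v,z)=I_2$, with entries $y_{j,kl}$. Set $$b_j(z)=y_{j,11}(v_j,z)\cos\alpha_j+y_{j,21}(v_j,z)\sin\alpha_j,\qquad c_j(z)=y_{j,12}(v_j,z)\cos\alpha_j+y_{j,22}(v_j,z)\sin\alpha_j,$$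 and define the Weyl–Titchmarsh function $m_j=b_j/c_j$. Graph data. The star graph $\mathcal G$ has central vertex $v$ and edges $e_1,\dots,e_n$. Let $\mathbf L^2(\mathcal G)=\bigoplus_{j=1}^n\mathbf L^2(e_j)$ with elements $\boldsymbol f=(\boldsymbol f_j)_1^n$. Write $$\boldsymbol f_1^\sharp(v)=(f_1(v),\dots,f_n(v))^{\rm t},\qquad \boldsymbol f_2^\sharp(v)=(\widehat f_1(v),\dots,\widehat f_n(v))^{\rm t}.$$ Then $\mathcal S=\bigoplus S_j$ and $\mathcal S^*=\bigoplus S_j^*$, where $\operatorname{dom}S_j^*=\mathcal D_j$ and $S_j^*$ acts by $H_j$. Let $\mathcal M(z)=\operatorname{diag}(m_1(z),\dots,m_n(z))$. For $\boldsymbol x=(x_j)_1^n$ with $x_j\in e_j$, let $\boldsymbol Y(\boldsymbol x,z)=\operatorname{diag}(Y_1(x_1,z),\dots,Y_n(x_n,z))\in M_{2n}(\mathbb C)$. A $\mathbb C^{2n}$-valued function of $\boldsymbol x$ of this form is identified with the element of $\mathbf L^2(\mathcal G)$ whose $j$-th component is the $j$-th pair of entries. Let $\mathbf P\in M_{2n}(\mathbb C)$ be the permutation matrix with $$\mathbf P(u_1,\widehat u_1,u_2,\widehat u_2,\dots,u_n,\widehat u_n)^{\rm t}=(u_1,\dots,u_n,\widehat u_1,\dots,\widehat u_n)^{\rm t}.$$ Define $I(\boldsymbol g,z)=\big(\int_v^{v_j}Y_j(\xi,\bar z)^*\boldsymbol g_j(\xi)\,d\xi\big)_{j=1}^n\in\mathbb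 C^{2n}$, stacked edge by edge. A matrix function $\mathcal N$ is a matrix Nevanlinna function if it is holomorphic at least on $\mathbb C\setminus\mathbb R$ and satisfies $$\mathcal N(\bar z)=\mathcal N(z)^*,\qquad \frac{\mathcal N(z)-\mathcal N(z)^*}{2i\,\operatorname{Im}z}\ge0\quad\text{for } z\in\mathbb C\setminus\mathbb R.$$ *)

theory Defs
  imports "HOL-Analysis.Analysis" "HOL-Complex_Analysis.Complex_Analysis"
begin

no_notation fps_nth (infixl \<open>$\<close> 75)

text \<open>Conventions. The edges are indexed by a finite type 'n (so n = CARD('n)).
 An element of L2(G) is represented by a function f :: 'n => real => complex * complex,
 f j x = (f_j(x), hat f_j(x)); only the values on [v, v_j] matter and elements are
 identified up to equality almost everywhere (eqG). Operators are linear relations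
 (sets of pairs (f, Tf)) closed under this identification.\<close>

type_synonym 'n gfun = "'n \<Rightarrow> real \<Rightarrow> complex \<times> complex"

definition cs :: "complex \<Rightarrow> complex \<times> complex \<Rightarrow> complex \<times> complex" where
  "cs z u = (z * fst u, z * snd u)"

definition addp :: "complex \<times> complex \<Rightarrow> complex \<times> complex \<Rightarrow> complex \<times> complex" where
  "addp u w = (fst u + fst w, snd u + snd w)"

definition subp :: "complex \<times> complex \<Rightarrow> complex \<times> complex \<Rightarrow> complex \<times> complex" where
  "subp u w = (fst u - fst w, snd u - snd w)"

definition sqint :: "real \<Rightarrow> real \<Rightarrow> (real \<Rightarrow> complex) \<Rightarrow> bool" where
  "sqint a b g \<longleftrightarrow> (\<lambda>x. indicator {a..b} x *\<^sub>R g x) \<in> borel_measurable lborel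
      \<and> set_integrable lborel {a..b} (\<lambda>x. (cmod (g x))\<^sup>2)"

definition L2G :: "real \<Rightarrow> ('n::finite \<Rightarrow> real) \<Rightarrow> 'n gfun \<Rightarrow> bool" where
  "L2G v vj f \<longleftrightarrow> (\<forall>j. sqint v (vj j) (\<lambda>x. fst (f j x)) \<and> sqint v (vj j) (\<lambda>x. snd (f j x)))"

definition innerG :: "real \<Rightarrow> ('n::finite \<Rightarrow> real) \<Rightarrow> 'n gfun \<Rightarrow> 'n gfun \<Rightarrow> complex" where
  "innerG v vj f g = (\<Sum>j\<in>UNIV. set_lebesgue_integral lborel {v..vj j}
      (\<lambda>x. fst (f j x) * cnj (fst (g j x)) + snd (f j x) * cnj (snd (g j x))))"

definition normG :: "real \<Rightarrow> ('n::finite \<Rightarrow> real) \<Rightarrow> 'n gfun \<Rightarrow> real" where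
  "normG v vj f = sqrt (Re (innerG v vj f f))"

definition eqG :: "real \<Rightarrow> ('n::finite \<Rightarrow> real) \<Rightarrow> 'n gfun \<Rightarrow> 'n gfun \<Rightarrow> bool" where
  "eqG v vj f g \<longleftrightarrow> (\<forall>j. AE x in lborel. x \<in> {v..vj j} \<longrightarrow> f j x = g j x)"

definition abs_cont :: "real \<Rightarrow> real \<Rightarrow> (real \<Rightarrow> complex) \<Rightarrow> bool" where
  "abs_cont a b g \<longleftrightarrow> (\<forall>\<epsilon>>0. \<exists>\<delta>>0. \<forall>I :: (real \<times> real) list.
      (\<forall>(s,t)\<in>set I. a \<le> s \<and> s \<le> t \<and> t \<le> b) \<and> sorted_wrt (\<lambda>I1 I2. snd I1 \<le> fst I2) I
      \<and> (\<Sum>(s,t)\<leftarrow>I. t - s) < \<delta> \<longrightarrow> (\<Sum>(s,t)\<leftarrow>I. cmod (g t - g s)) < \<epsilon>)"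

text \<open>The differential expression H f = -J f' + V f on every edge.\<close>
definition Hop :: "('n \<Rightarrow> real \<Rightarrow> real) \<Rightarrow> ('n \<Rightarrow> real \<Rightarrow> real) \<Rightarrow> 'n gfun \<Rightarrow> 'n gfun" where
  "Hop p q f = (\<lambda>j x.
     (vector_derivative (\<lambda>t. snd (f j t)) (at x)
        + of_real (p j x) * fst (f j x) + of_real (q j x) * snd (f j x),
      - vector_derivative (\<lambda>t. fst (f j t)) (at x)
        + of_real (q j x) * fst (f j x) - of_real (p j x) * snd (f j x)))"

definition Dmax :: "real \<Rightarrow> ('n::finite \<Rightarrow> real) \<Rightarrow> ('n \<Rightarrow> real \<Rightarrow> real) \<Rightarrow> ('n \<Rightarrow> real \<Rightarrow> real)
    \<Rightarrow> ('n \<Rightarrow> real) \<Rightarrow> 'n gfun set" where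
  "Dmax v vj p q \<alpha> = {f. L2G v vj f
      \<and> (\<forall>j. abs_cont v (vj j) (\<lambda>x. fst (f j x)) \<and> abs_cont v (vj j) (\<lambda>x. snd (f j x)))
      \<and> L2G v vj (Hop p q f)
      \<and> (\<forall>j. of_real (cos (\<alpha> j)) * fst (f j (vj j)) + of_real (sin (\<alpha> j)) * snd (f j (vj j)) = 0)}"

definition opRel :: "real \<Rightarrow> ('n::finite \<Rightarrow> real) \<Rightarrow> ('n \<Rightarrow> real \<Rightarrow> real) \<Rightarrow> ('n \<Rightarrow> real \<Rightarrow> real)
    \<Rightarrow> 'n gfun set \<Rightarrow> ('n gfun \<times> 'n gfun) set" where
  "opRel v vj p q D = {(f, g). L2G v vj f \<and> L2G v vj g
      \<and> (\<exists>f0\<in>D. eqG v vj f f0 \<and> eqG v vj g (Hop p q f0))}"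

definition Smin :: "real \<Rightarrow> ('n::finite \<Rightarrow> real) \<Rightarrow> ('n \<Rightarrow> real \<Rightarrow> real) \<Rightarrow> ('n \<Rightarrow> real \<Rightarrow> real)
    \<Rightarrow> ('n \<Rightarrow> real) \<Rightarrow> ('n gfun \<times> 'n gfun) set" where
  "Smin v vj p q \<alpha> = opRel v vj p q
      {f \<in> Dmax v vj p q \<alpha>. \<forall>j. fst (f j v) = 0 \<and> snd (f j v) = 0}"

definition sharp1 :: "real \<Rightarrow> 'n gfun \<Rightarrow> complex ^ 'n" where
  "sharp1 v f = (\<chi> j. fst (f j v))"
definition sharp2 :: "real \<Rightarrow> 'n gfun \<Rightarrow> complex ^ 'n" where
  "sharp2 v f = (\<chi> j. snd (f j v))"

definition TAB :: "real \<Rightarrow> ('n::finite \<Rightarrow> real) \<Rightarrow> ('n \<Rightarrow> real \<Rightarrow> real) \<Rightarrow> ('n \<Rightarrow> real \<Rightarrow> real)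
    \<Rightarrow> ('n \<Rightarrow> real) \<Rightarrow> complex^'n^'n \<Rightarrow> complex^'n^'n \<Rightarrow> ('n gfun \<times> 'n gfun) set" where
  "TAB v vj p q \<alpha> A B = opRel v vj p q
      {f \<in> Dmax v vj p q \<alpha>. A *v sharp1 v f + B *v sharp2 v f = 0}"

definition adjG :: "real \<Rightarrow> ('n::finite \<Rightarrow> real) \<Rightarrow> ('n gfun \<times> 'n gfun) set \<Rightarrow> ('n gfun \<times> 'n gfun) set" where
  "adjG v vj T = {(g, h). L2G v vj g \<and> L2G v vj h
      \<and> (\<forall>(f, k)\<in>T. innerG v vj k g = innerG v vj f h)}"

definition self_adjoint_ext :: "real \<Rightarrow> ('n::finite \<Rightarrow> real) \<Rightarrow> ('n gfun \<times> 'n gfun) set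
    \<Rightarrow> ('n gfun \<times> 'n gfun) set \<Rightarrow> bool" where
  "self_adjoint_ext v vj S T \<longleftrightarrow> S \<subseteq> T \<and> adjG v vj T = T"

definition hcat :: "complex^'n^'m \<Rightarrow> complex^'n^'m \<Rightarrow> complex^('n + 'n)^'m" where
  "hcat A B = (\<chi> i k. case k of Inl a \<Rightarrow> A $ i $ a | Inr b \<Rightarrow> B $ i $ b)"

definition adjm :: "complex^'n^'m \<Rightarrow> complex^'m^'n" where
  "adjm A = (\<chi> i k. cnj (A $ k $ i))"

text \<open>Fundamental matrix Y_j(x,z) on e_j (set to 0 outside e_j so that it is unique).\<close>
definition Yfun :: "real \<Rightarrow> ('n \<Rightarrow> real) \<Rightarrow> ('n \<Rightarrow> real \<Rightarrow> real) \<Rightarrow> ('n \<Rightarrow> real \<Rightarrow> real)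
    \<Rightarrow> 'n \<Rightarrow> complex \<Rightarrow> real \<Rightarrow> complex^2^2" where
  "Yfun v vj p q j z = (THE Y. Y v = mat 1
      \<and> (\<forall>x. x \<notin> {v..vj j} \<longrightarrow> Y x = 0)
      \<and> (\<forall>a b. abs_cont v (vj j) (\<lambda>x. Y x $ a $ b))
      \<and> (AE x in lborel. x \<in> {v..vj j} \<longrightarrow>
           (\<forall>a b. (\<lambda>t. Y t $ a $ b) differentiable (at x))
         \<and> (\<forall>b. vector_derivative (\<lambda>t. Y t $ 2 $ b) (at x)
                  + of_real (p j x) * Y x $ 1 $ b + of_real (q j x) * Y x $ 2 $ b = z * Y x $ 1 $ b
              \<and> - vector_derivative (\<lambda>t. Y t $ 1 $ b) (at x)
                  + of_real (q j x) * Y x $ 1 $ b - of_real (p j x) * Y x $ 2 $ b = z * Y x $ 2 $ b)))"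

definition bfun where
  "bfun v vj p q \<alpha> j z = Yfun v vj p q j z (vj j) $ 1 $ 1 * of_real (cos (\<alpha> j))
      + Yfun v vj p q j z (vj j) $ 2 $ 1 * of_real (sin (\<alpha> j))"

definition cfun where
  "cfun v vj p q \<alpha> j z = Yfun v vj p q j z (vj j) $ 1 $ 2 * of_real (cos (\<alpha> j))
      + Yfun v vj p q j z (vj j) $ 2 $ 2 * of_real (sin (\<alpha> j))"

definition mfun where
  "mfun v vj p q \<alpha> j z = bfun v vj p q \<alpha> j z / cfun v vj p q \<alpha> j z"

definition Mmat :: "real \<Rightarrow> ('n::finite \<Rightarrow> real) \<Rightarrow> ('n \<Rightarrow> real \<Rightarrow> real) \<Rightarrow> ('n \<Rightarrow> real \<Rightarrow> real)
    \<Rightarrow> ('n \<Rightarrow> real) \<Rightarrow> complex \<Rightarrow> complex^'n^'n" where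
  "Mmat v vj p q \<alpha> z = (\<chi> i k. if i = k then mfun v vj p q \<alpha> i z else 0)"

definition GammaZ :: "real \<Rightarrow> ('n::finite \<Rightarrow> real) \<Rightarrow> ('n \<Rightarrow> real \<Rightarrow> real) \<Rightarrow> ('n \<Rightarrow> real \<Rightarrow> real)
    \<Rightarrow> ('n \<Rightarrow> real) \<Rightarrow> complex \<Rightarrow> complex^'n \<Rightarrow> 'n gfun" where
  "GammaZ v vj p q \<alpha> z c = (\<lambda>j x.
     (c $ j * (- Yfun v vj p q j z x $ 1 $ 1 + Yfun v vj p q j z x $ 1 $ 2 * mfun v vj p q \<alpha> j z),
      c $ j * (- Yfun v vj p q j z x $ 2 $ 1 + Yfun v vj p q j z x $ 2 $ 2 * mfun v vj p q \<alpha> j z)))"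

definition Gamma_adj :: "real \<Rightarrow> ('n::finite \<Rightarrow> real) \<Rightarrow> ('n \<Rightarrow> real \<Rightarrow> real) \<Rightarrow> ('n \<Rightarrow> real \<Rightarrow> real)
    \<Rightarrow> ('n \<Rightarrow> real) \<Rightarrow> complex \<Rightarrow> 'n gfun \<Rightarrow> complex^'n" where
  "Gamma_adj v vj p q \<alpha> w g = (THE c. \<forall>d. innerG v vj (GammaZ v vj p q \<alpha> w d) g
      = (\<Sum>j\<in>UNIV. d $ j * cnj (c $ j)))"

text \<open>Resolvent set and resolvent of a relation T: (T - z) f = g iff (f, g + z f) in T.\<close>
definition in_resolvent :: "real \<Rightarrow> ('n::finite \<Rightarrow> real) \<Rightarrow> ('n gfun \<times> 'n gfun) set \<Rightarrow> complex \<Rightarrow> bool" where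
  "in_resolvent v vj T z \<longleftrightarrow>
     (\<forall>g. L2G v vj g \<longrightarrow> (\<exists>f. (f, \<lambda>j x. addp (g j x) (cs z (f j x))) \<in> T))
   \<and> (\<exists>C. \<forall>f g. (f, \<lambda>j x. addp (g j x) (cs z (f j x))) \<in> T \<longrightarrow> normG v vj f \<le> C * normG v vj g)"

definition resolv :: "('n gfun \<times> 'n gfun) set \<Rightarrow> complex \<Rightarrow> 'n gfun \<Rightarrow> 'n gfun" where
  "resolv T z g = (SOME f. (f, \<lambda>j x. addp (g j x) (cs z (f j x))) \<in> T)"

definition mero_nevanlinna :: "(complex \<Rightarrow> complex^'n^'n) \<Rightarrow> bool" where
  "mero_nevanlinna W \<longleftrightarrow>
     (\<forall>i k. (\<lambda>z. W z $ i $ k) meromorphic_on UNIV)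
   \<and> (\<forall>i k. (\<lambda>z. W z $ i $ k) holomorphic_on {z. Im z \<noteq> 0})
   \<and> (\<forall>z. Im z \<noteq> 0 \<longrightarrow> W (cnj z) = adjm (W z))
   \<and> (\<forall>z x. Im z \<noteq> 0 \<longrightarrow>
        (let r = (\<Sum>i\<in>UNIV. \<Sum>k\<in>UNIV. cnj (x $ i) * (W z $ i $ k - cnj (W z $ k $ i)) * x $ k)
                 / (2 * \<i> * of_real (Im z))
         in Im r = 0 \<and> 0 \<le> Re r))"

definition bdd_lin_op :: "real \<Rightarrow> ('n::finite \<Rightarrow> real) \<Rightarrow> ('n gfun \<Rightarrow> 'n gfun) \<Rightarrow> bool" where
  "bdd_lin_op v vj T \<longleftrightarrow>
     (\<forall>f. L2G v vj f \<longrightarrow> L2G v vj (T f))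
   \<and> (\<forall>f g. L2G v vj f \<longrightarrow> L2G v vj g \<longrightarrow> eqG v vj f g \<longrightarrow> eqG v vj (T f) (T g))
   \<and> (\<forall>f g a b. L2G v vj f \<longrightarrow> L2G v vj g \<longrightarrow>
        eqG v vj (T (\<lambda>j x. addp (cs a (f j x)) (cs b (g j x))))
                 (\<lambda>j x. addp (cs a (T f j x)) (cs b (T g j x))))
   \<and> (\<exists>C. \<forall>f. L2G v vj f \<longrightarrow> normG v vj (T f) \<le> C * normG v vj f)"

definition entire_bdd_opfun :: "real \<Rightarrow> ('n::finite \<Rightarrow> real) \<Rightarrow> (complex \<Rightarrow> 'n gfun \<Rightarrow> 'n gfun) \<Rightarrow> bool" where
  "entire_bdd_opfun v vj F \<longleftrightarrow>
     (\<forall>z. bdd_lin_op v vj (F z))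
   \<and> (\<forall>z0. \<exists>F'. bdd_lin_op v vj F' \<and>
        (\<forall>\<epsilon>>0. \<exists>\<delta>>0. \<forall>z. z \<noteq> z0 \<and> cmod (z - z0) < \<delta> \<longrightarrow>
           (\<forall>f. L2G v vj f \<longrightarrow>
              normG v vj (\<lambda>j x. subp (cs (1 / (z - z0)) (subp (F z f j x) (F z0 f j x))) (F' f j x))
                \<le> \<epsilon> * normG v vj f)))"

definition Ivec :: "real \<Rightarrow> ('n::finite \<Rightarrow> real) \<Rightarrow> ('n \<Rightarrow> real \<Rightarrow> real) \<Rightarrow> ('n \<Rightarrow> real \<Rightarrow> real)
    \<Rightarrow> complex \<Rightarrow> 'n gfun \<Rightarrow> 'n \<Rightarrow> complex \<times> complex" where
  "Ivec v vj p q z g j =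
     (set_lebesgue_integral lborel {v..vj j} (\<lambda>\<xi>.
         cnj (Yfun v vj p q j (cnj z) \<xi> $ 1 $ 1) * fst (g j \<xi>)
       + cnj (Yfun v vj p q j (cnj z) \<xi> $ 2 $ 1) * snd (g j \<xi>)),
      set_lebesgue_integral lborel {v..vj j} (\<lambda>\<xi>.
         cnj (Yfun v vj p q j (cnj z) \<xi> $ 1 $ 2) * fst (g j \<xi>)
       + cnj (Yfun v vj p q j (cnj z) \<xi> $ 2 $ 2) * snd (g j \<xi>)))"

text \<open>The term Y(.,z) P^t (B^*; -A^*) W(z) (B  -A) P I(g,z), with the permutation P
 written out: (B -A) P I = B u - A uh where (u_j, uh_j) = I(g,z)_j, and
 P^t (s; sh) places (s_j, sh_j) on edge j.\<close>
definition Wterm :: "real \<Rightarrow> ('n::finite \<Rightarrow> real) \<Rightarrow> ('n \<Rightarrow> real \<Rightarrow> real) \<Rightarrow> ('n \<Rightarrow> real \<Rightarrow> real)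
    \<Rightarrow> complex^'n^'n \<Rightarrow> complex^'n^'n \<Rightarrow> complex^'n^'n \<Rightarrow> complex \<Rightarrow> 'n gfun \<Rightarrow> 'n gfun" where
  "Wterm v vj p q A B W z g =
    (let u = (\<chi> j. fst (Ivec v vj p q z g j));
         uh = (\<chi> j. snd (Ivec v vj p q z g j));
         r = W *v (B *v u - A *v uh);
         s = adjm B *v r;
         sh = - (adjm A *v r)
     in (\<lambda>j x. (Yfun v vj p q j z x $ 1 $ 1 * s $ j + Yfun v vj p q j z x $ 1 $ 2 * sh $ j,
                Yfun v vj p q j z x $ 2 $ 1 * s $ j + Yfun v vj p q j z x $ 2 $ 2 * sh $ j)))"

end

theory Submission
  imports Defs
begin

text \<open>
  Absolutely continuous functions are indefinite integrals: the variation function splits a real one into two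
  monotone ones, whose Stieltjes measures are absolutely continuous, so that Radon-Nikodym applies; the a.e.
  derivative is then Lebesgue's differentiation theorem. Hence solutions of \<open>H f = z f + k\<close> are given on each edge
  by variation of constants from the fundamental matrix, and Green's formula holds on the maximal domain with
  the symplectic form of the boundary values \<open>(f\<^sub>1\<^sup>\<sharp>(v), f\<^sub>2\<^sup>\<sharp>(v))\<close> as boundary term.

  (i) The adjoint of the minimal relation is the maximal one, and all boundary values occur. Therefore the
  self-adjoint extensions correspond to the subspaces that equal their own symplectic complement. By the Cayley
  transform these are the graphs of unitary maps, and hence exactly the kernels of \<open>(A B)\<close> with full rank and
  \<open>A B\<^sup>* = B A\<^sup>*\<close>.

  (ii) By variation of constants the resolvent is determined by a linear system for the boundary values, and
  solving it with \<open>(B M - A)\<^sup>-\<^sup>1\<close> gives Krein's formula.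

  (iii) The solutions of \<open>H f = z f\<close> that satisfy the outer boundary conditions have the boundary values
  \<open>\<xi> = (-c, M(z) c)\<close>, and \<open>W(z)\<close> is the map \<open>(A B) \<xi> \<mapsto> (C D) \<xi>\<close> on them. The matrix with rows \<open>(A B)\<close>, \<open>(C D)\<close> reverses
  the sign of the symplectic form, so that Green's formula expresses \<open>W - W\<^sup>*\<close> by norms of these solutions. Its
  inverse writes the boundary values of the resolvent as those of the W-term plus a constant matrix applied to
  integrals of \<open>g\<close> against the fundamental matrix; the remainder is therefore entire.
\<close>

section \<open>Absolute continuity and variation\<close>

fun chain :: "real \<Rightarrow> real \<Rightarrow> (real \<times> real) list \<Rightarrow> bool" where
  "chain a b [] \<longleftrightarrow> True"
| "chain a b ((s, t) # I) \<longleftrightarrow> a \<le> s \<and> s \<le> t \<and> t \<le> b \<and> chain t b I"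

lemmas chain_induct = chain.induct[case_names Nil Cons]

definition chain_length :: "(real \<times> real) list \<Rightarrow> real" where
  "chain_length I = (\<Sum>(s, t)\<leftarrow>I. t - s)"

definition chain_variation :: "(real \<Rightarrow> 'a::real_normed_vector) \<Rightarrow> (real \<times> real) list \<Rightarrow> real" where
  "chain_variation f I = (\<Sum>(s, t)\<leftarrow>I. norm (f t - f s))"

definition abs_continuous_on :: "real \<Rightarrow> real \<Rightarrow> (real \<Rightarrow> 'a::real_normed_vector) \<Rightarrow> bool" where
  "abs_continuous_on a b f \<longleftrightarrow>
     (\<forall>\<epsilon>>0. \<exists>\<delta>>0. \<forall>I. chain a b I \<and> chain_length I < \<delta> \<longrightarrow> chain_variation f I < \<epsilon>)"

lemma chain_length_simps [simp]:
  "chain_length [] = 0"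
  "chain_length ((s, t) # I) = t - s + chain_length I"
  "chain_length (I @ J) = chain_length I + chain_length J"
  by (simp_all add: chain_length_def)

lemma chain_variation_simps [simp]:
  "chain_variation f [] = 0"
  "chain_variation f ((s, t) # I) = norm (f t - f s) + chain_variation f I"
  "chain_variation f (I @ J) = chain_variation f I + chain_variation f J"
  by (simp_all add: chain_variation_def)

lemma chain_iff_sorted:
  "chain a b I \<longleftrightarrow> (\<forall>(s, t)\<in>set I. a \<le> s \<and> s \<le> t \<and> t \<le> b) \<and> sorted_wrt (\<lambda>J K. snd J \<le> fst K) I"
proof (induction a b I rule: chain_induct)
  case (Cons a b s t I)
  then show ?case by (force simp: case_prod_unfold)
qed simp

lemma chain_mono: "chain a b I \<Longrightarrow> c \<le> a \<Longrightarrow> b \<le> d \<Longrightarrow> chain c d I"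
  by (induction a b I arbitrary: c rule: chain_induct) auto

lemma chain_append:
  "chain a x I \<Longrightarrow> chain x b J \<Longrightarrow> a \<le> x \<Longrightarrow> x \<le> b \<Longrightarrow> chain a b (I @ J)"
  by (induction a x I rule: chain_induct) (auto intro: chain_mono)

lemma chain_length_le: "chain a b I \<Longrightarrow> a \<le> b \<Longrightarrow> chain_length I \<le> b - a"
  by (induction a b I rule: chain_induct) fastforce+

lemma chain_map:
  assumes "chain a b I"
    and "\<And>x y. a \<le> x \<Longrightarrow> x \<le> y \<Longrightarrow> y \<le> b \<Longrightarrow> \<phi> x \<le> \<phi> y"
    and "\<And>x. a \<le> x \<Longrightarrow> x \<le> b \<Longrightarrow> c \<le> \<phi> x \<and> \<phi> x \<le> d"
  shows "chain c d (map (map_prod \<phi> \<phi>) I)"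
  using assms
proof (induction a b I arbitrary: c rule: chain_induct)
  case (Cons a b s t I)
  have "chain (\<phi> t) d (map (map_prod \<phi> \<phi>) I)"
    using Cons.prems by (intro Cons.IH) auto
  then show ?case using Cons.prems by auto
qed simp

lemma chain_variation_clamp:
  "chain_variation f I \<le> chain_variation f (map (map_prod (min x) (min x)) I)
     + chain_variation f (map (map_prod (max x) (max x)) I)"
proof (induction I)
  case (Cons interval I)
  obtain s t where "interval = (s, t)" by force
  moreover have "f t - f s = (f (min x t) - f (min x s)) + (f (max x t) - f (max x s))"
    by (simp add: min_def max_def)
  then have "norm (f t - f s) \<le> norm (f (min x t) - f (min x s)) + norm (f (max x t) - f (max x s))"
    by (metis norm_triangle_ineq)
  ultimately show ?case using Cons.IH by simp
qed simp

lemma chain_variation_degenerate: "chain a a I \<Longrightarrow> chain_variation f I = 0"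
  by (induction I) (auto dest: antisym simp: chain_iff_sorted)

lemma abs_cont_iff_abs_continuous_on: "abs_cont a b f \<longleftrightarrow> abs_continuous_on a b f"
  unfolding abs_cont_def abs_continuous_on_def chain_iff_sorted chain_length_def chain_variation_def
  by (simp add: conj_assoc)

lemma abs_continuous_onE:
  assumes "abs_continuous_on a b f" "0 < \<epsilon>"
  obtains \<delta> where "0 < \<delta>" "\<And>I. chain a b I \<Longrightarrow> chain_length I < \<delta> \<Longrightarrow> chain_variation f I < \<epsilon>"
  using assms unfolding abs_continuous_on_def by blast

subsection \<open>Total variation\<close>

text \<open>Cutting \<open>[a, y]\<close> into \<open>n\<close> pieces shorter than the \<open>\<delta>\<close> that belongs to \<open>\<epsilon> = 1\<close>.\<close>
lemma chain_variation_le_of_nat: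
  assumes small: "\<And>I. chain a b I \<Longrightarrow> chain_length I < \<delta> \<Longrightarrow> chain_variation f I < 1" and "0 < \<delta>"
  shows "\<lbrakk>a \<le> y; y \<le> b; y - a \<le> real n * (\<delta>/2); chain a y I\<rbrakk> \<Longrightarrow> chain_variation f I \<le> real n"
proof (induction n arbitrary: y I)
  case 0
  then show ?case by (simp add: chain_variation_degenerate)
next
  case (Suc n)
  define x where "x = max a (y - \<delta>/2)"
  have x: "a \<le> x" "x \<le> y" "x - a \<le> real n * (\<delta>/2)" "y - x \<le> \<delta>/2"
    using Suc.prems \<open>0 < \<delta>\<close> by (auto simp: x_def max_def field_simps)
  have "chain_variation f (map (map_prod (min x) (min x)) I) \<le> n"
    using x Suc.prems by (intro Suc.IH[of x] chain_map[of a y]) auto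
  moreover
  have right: "chain x y (map (map_prod (max x) (max x)) I)"
    using x Suc.prems by (intro chain_map[of a y]) auto
  have "chain_variation f (map (map_prod (max x) (max x)) I) < 1"
    using chain_length_le[OF right] x \<open>0 < \<delta>\<close> Suc.prems
    by (intro small chain_mono[OF right]) auto
  ultimately show ?case using chain_variation_clamp[of f I x] by simp
qed

lemma abs_continuous_on_bounded_variation:
  assumes "abs_continuous_on a b f" "a \<le> b"
  obtains C where "\<And>I. chain a b I \<Longrightarrow> chain_variation f I \<le> C"
proof -
  obtain \<delta> where \<delta>: "0 < \<delta>" "\<And>I. chain a b I \<Longrightarrow> chain_length I < \<delta> \<Longrightarrow> chain_variation f I < 1"
    using abs_continuous_onE[OF assms(1) zero_less_one] by metis
  obtain n where "b - a \<le> real n * (\<delta>/2)"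
    using \<delta>(1) by (metis half_gt_zero_iff ex_less_of_nat_mult less_imp_le)
  then show thesis
    using chain_variation_le_of_nat[OF \<delta>(2,1) assms(2)] that by blast
qed

definition total_variation :: "(real \<Rightarrow> 'a::real_normed_vector) \<Rightarrow> real \<Rightarrow> real \<Rightarrow> real" where
  "total_variation f a b = (SUP I\<in>{I. chain a b I}. chain_variation f I)"

lemma total_variation_least:
  "(\<And>I. chain x y I \<Longrightarrow> chain_variation f I \<le> C) \<Longrightarrow> total_variation f x y \<le> C"
  unfolding total_variation_def by (rule cSUP_least) (auto intro: exI[of _ "[]"])

lemma total_variation_approx:
  fixes \<eta> :: real
  assumes "0 < \<eta>"
  obtains I where "chain x y I" "total_variation f x y \<le> chain_variation f I + \<eta>"
proof -
  have "\<not> (\<forall>I. chain x y I \<longrightarrow> chain_variation f I \<le> total_variation f x y - \<eta>)"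
    using total_variation_least[of x y f "total_variation f x y - \<eta>"] assms by force
  then show thesis using that by force
qed

context
  fixes a b :: real and f :: "real \<Rightarrow> 'a::real_normed_vector"
  assumes nonempty: "a \<le> b" and abs_continuous: "abs_continuous_on a b f"
begin

lemma chain_variation_le_total_variation:
  assumes "a \<le> x" "y \<le> b" "chain x y I"
  shows "chain_variation f I \<le> total_variation f x y"
proof -
  obtain C where "\<And>I. chain a b I \<Longrightarrow> chain_variation f I \<le> C"
    using abs_continuous_on_bounded_variation[OF abs_continuous nonempty] by blast
  then have "bdd_above (chain_variation f ` {I. chain x y I})"
    using chain_mono[of x y _ a b] assms(1,2) by (intro bdd_aboveI[of _ C]) auto
  then show ?thesis unfolding total_variation_def using assms(3) by (intro cSUP_upper) auto
qed

lemma total_variation_add_norm_diff_le: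
  assumes "a \<le> x" "x \<le> y" "y \<le> b"
  shows "total_variation f a x + norm (f y - f x) \<le> total_variation f a y"
proof -
  have "total_variation f a x \<le> total_variation f a y - norm (f y - f x)"
  proof (rule total_variation_least)
    fix I assume "chain a x I"
    then have "chain a y (I @ [(x, y)])"
      using assms by (intro chain_append[of a x]) auto
    from chain_variation_le_total_variation[OF _ _ this]
    show "chain_variation f I \<le> total_variation f a y - norm (f y - f x)" using assms by simp
  qed
  then show ?thesis by simp
qed

lemma total_variation_triangle:
  assumes "a \<le> x" "x \<le> y" "y \<le> b"
  shows "total_variation f a y \<le> total_variation f a x + total_variation f x y"
proof (rule total_variation_least)
  fix I assume "chain a y I"
  then have "chain_variation f (map (map_prod (min x) (min x)) I) \<le> total_variation f a x"
    "chain_variation f (map (map_prod (max x) (max x)) I) \<le> total_variation f x y"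
    using assms by (auto intro!: chain_variation_le_total_variation chain_map[of a y])
  then show "chain_variation f I \<le> total_variation f a x + total_variation f x y"
    using chain_variation_clamp[of f I x] by simp
qed

lemma refine_chain_total_variation:
  fixes \<eta> :: real
  assumes "chain c d I" "a \<le> c" "d \<le> b" "0 < \<eta>"
  shows "\<exists>J. chain c d J \<and> chain_length J \<le> chain_length I
    \<and> chain_variation (total_variation f a) I \<le> chain_variation f J + \<eta> * length I"
  using assms
proof (induction c d I rule: chain_induct)
  case (Cons c d s t I)
  then have st: "a \<le> s" "s \<le> t" "t \<le> b" by auto
  obtain J where J: "chain t d J" "chain_length J \<le> chain_length I"
      "chain_variation (total_variation f a) I \<le> chain_variation f J + \<eta> * length I"
    using Cons by auto
  obtain K where K: "chain s t K" "total_variation f s t \<le> chain_variation f K + \<eta>"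
    using total_variation_approx[OF \<open>0 < \<eta>\<close>] by metis
  have "\<bar>total_variation f a t - total_variation f a s\<bar> \<le> total_variation f s t"
    using total_variation_triangle[OF st] total_variation_add_norm_diff_le[OF st]
      norm_ge_zero[of "f t - f s"] by linarith
  then have "chain_variation (total_variation f a) ((s, t) # I)
      \<le> chain_variation f (K @ J) + \<eta> * length ((s, t) # I)"
    using J(3) K(2) by (simp add: algebra_simps)
  moreover have "chain c d (K @ J)"
    using J(1) K(1) Cons.prems by (intro chain_append[of c t]) (auto intro: chain_mono)
  moreover have "chain_length (K @ J) \<le> chain_length ((s, t) # I)"
    using J(2) chain_length_le[OF K(1)] Cons.prems by simp
  ultimately show ?case by blast
qed (auto intro: exI[of _ "[]"])

lemma abs_continuous_on_total_variation: "abs_continuous_on a b (total_variation f a)"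
  unfolding abs_continuous_on_def
proof (intro allI impI)
  fix \<epsilon> :: real assume "0 < \<epsilon>"
  then obtain \<delta> where \<delta>: "0 < \<delta>"
    "\<And>I. chain a b I \<Longrightarrow> chain_length I < \<delta> \<Longrightarrow> chain_variation f I < \<epsilon>/2"
    using abs_continuous_onE[OF abs_continuous, of "\<epsilon>/2"] by auto
  have "chain_variation (total_variation f a) I < \<epsilon>" if I: "chain a b I" "chain_length I < \<delta>" for I
  proof -
    define \<eta> where "\<eta> = \<epsilon> / (2 * (length I + 1))"
    have \<eta>: "\<eta> > 0" "\<eta> * length I \<le> \<epsilon>/2"
      using \<open>0 < \<epsilon>\<close> by (auto simp: \<eta>_def field_simps)
    obtain J where "chain a b J" "chain_length J \<le> chain_length I"
      "chain_variation (total_variation f a) I \<le> chain_variation f J + \<eta> * length I"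
      using refine_chain_total_variation[OF I(1) order_refl order_refl \<eta>(1)] by blast
    with \<delta>(2)[of J] I(2) \<eta>(2) show ?thesis by simp
  qed
  then show "\<exists>\<delta>>0. \<forall>I. chain a b I \<and> chain_length I < \<delta> \<longrightarrow> chain_variation (total_variation f a) I < \<epsilon>"
    using \<delta>(1) by blast
qed

end

subsection \<open>Closure properties\<close>

lemma abs_continuous_on_dominated:
  fixes f :: "real \<Rightarrow> 'a::real_normed_vector" and g :: "real \<Rightarrow> 'b::real_normed_vector"
    and h :: "real \<Rightarrow> 'c::real_normed_vector"
  assumes f: "abs_continuous_on a b f" and g: "abs_continuous_on a b g" and "0 \<le> C"
    and dominated: "\<And>s t. \<lbrakk>a \<le> s; s \<le> t; t \<le> b\<rbrakk> \<Longrightarrow> norm (h t - h s) \<le> C * (norm (f t - f s) + norm (g t - g s))"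
  shows "abs_continuous_on a b h"
  unfolding abs_continuous_on_def
proof (intro allI impI)
  fix \<epsilon> :: real assume "0 < \<epsilon>"
  define e where "e = \<epsilon> / (2 * (C + 1))"
  have e: "0 < e" "C * (2 * e) < \<epsilon>" using \<open>0 < \<epsilon>\<close> \<open>0 \<le> C\<close> by (auto simp: e_def field_simps)
  obtain \<delta>f where \<delta>f: "0 < \<delta>f" "\<And>I. chain a b I \<Longrightarrow> chain_length I < \<delta>f \<Longrightarrow> chain_variation f I < e"
    using abs_continuous_onE[OF f e(1)] by metis
  obtain \<delta>g where \<delta>g: "0 < \<delta>g" "\<And>I. chain a b I \<Longrightarrow> chain_length I < \<delta>g \<Longrightarrow> chain_variation g I < e"
    using abs_continuous_onE[OF g e(1)] by metis
  have variation_le: "chain_variation h I \<le> C * (chain_variation f I + chain_variation g I)"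
    if "chain c d I" "a \<le> c" "d \<le> b" for c d I
    using that
  proof (induction c d I rule: chain_induct)
    case (Cons c d s t I)
    then show ?case using dominated[of s t] by (force simp: algebra_simps)
  qed simp
  have "chain_variation h I < \<epsilon>" if I: "chain a b I" "chain_length I < min \<delta>f \<delta>g" for I
  proof -
    have "chain_variation h I \<le> C * (2 * e)"
      using variation_le[OF I(1)] \<delta>f(2)[OF I(1)] \<delta>g(2)[OF I(1)] I(2) \<open>0 \<le> C\<close>
      by (intro order_trans[OF variation_le[OF I(1)]] mult_left_mono) auto
    then show ?thesis using e(2) by simp
  qed
  then show "\<exists>\<delta>>0. \<forall>I. chain a b I \<and> chain_length I < \<delta> \<longrightarrow> chain_variation h I < \<epsilon>"
    using \<delta>f(1) \<delta>g(1) by (intro exI[of _ "min \<delta>f \<delta>g"]) auto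
qed

lemma abs_continuous_on_lipschitz_image:
  fixes f :: "real \<Rightarrow> 'a::real_normed_vector" and h :: "real \<Rightarrow> 'b::real_normed_vector"
  assumes "abs_continuous_on a b f" "0 \<le> C"
    and "\<And>s t. \<lbrakk>a \<le> s; s \<le> t; t \<le> b\<rbrakk> \<Longrightarrow> norm (h t - h s) \<le> C * norm (f t - f s)"
  shows "abs_continuous_on a b h"
  using assms by (intro abs_continuous_on_dominated[OF assms(1,1,2)]) (fastforce simp: distrib_left intro: order_trans)

lemma abs_continuous_on_imp_continuous_on:
  assumes "abs_continuous_on a b f"
  shows "continuous_on {a..b} f"
  unfolding continuous_on_iff
proof (intro ballI allI impI)
  fix x e assume "x \<in> {a..b}" "(0::real) < e"
  then obtain \<delta> where \<delta>: "0 < \<delta>" "\<And>I. chain a b I \<Longrightarrow> chain_length I < \<delta> \<Longrightarrow> chain_variation f I < e"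
    using abs_continuous_onE[OF assms] by metis
  have "dist (f y) (f x) < e" if "y \<in> {a..b}" "dist y x < \<delta>" for y
    using \<delta>(2)[of "[(min x y, max x y)]"] that \<open>x \<in> {a..b}\<close>
    by (cases "x \<le> y") (auto simp: dist_norm norm_minus_commute)
  then show "\<exists>\<delta>>0. \<forall>y\<in>{a..b}. dist y x < \<delta> \<longrightarrow> dist (f y) (f x) < e" using \<delta>(1) by blast
qed

lemma continuous_on_Icc_norm_bounded:
  fixes f :: "real \<Rightarrow> 'a::real_normed_vector"
  assumes "continuous_on {a..b} f"
  obtains C where "0 \<le> C" "\<And>x. x \<in> {a..b} \<Longrightarrow> norm (f x) \<le> C"
proof -
  have "bounded (f ` {a..b})"
    by (intro compact_imp_bounded compact_continuous_image assms) auto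
  then obtain C where "0 < C" "\<forall>x\<in>{a..b}. norm (f x) \<le> C" by (auto simp: bounded_pos)
  then show thesis using that[of C] by simp
qed

lemma abs_continuous_on_const: "abs_continuous_on a b (\<lambda>_. c)"
proof -
  have "chain_variation (\<lambda>_. c) I = 0" for I by (induction I) auto
  then show ?thesis unfolding abs_continuous_on_def by (auto intro: exI[of _ 1])
qed

lemma abs_continuous_on_add:
  assumes "abs_continuous_on a b f" "abs_continuous_on a b g"
  shows "abs_continuous_on a b (\<lambda>x. f x + g x)"
proof (rule abs_continuous_on_dominated[OF assms, of 1])
  fix s t
  have "f t + g t - (f s + g s) = (f t - f s) + (g t - g s)" by simp
  then show "norm (f t + g t - (f s + g s)) \<le> 1 * (norm (f t - f s) + norm (g t - g s))"
    by (metis norm_triangle_ineq mult_1)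
qed simp

lemma (in bounded_linear) abs_continuous_on:
  assumes "abs_continuous_on a b g"
  shows "abs_continuous_on a b (\<lambda>x. f (g x))"
proof -
  obtain K where "0 < K" "\<And>x. norm (f x) \<le> norm x * K" using pos_bounded by blast
  then show ?thesis
    by (intro abs_continuous_on_lipschitz_image[OF assms, of K]) (auto simp: mult.commute simp flip: diff)
qed

lemmas abs_continuous_on_minus = bounded_linear.abs_continuous_on[OF bounded_linear_minus[OF bounded_linear_ident]]

lemma abs_continuous_on_diff:
  assumes "abs_continuous_on a b f" "abs_continuous_on a b g"
  shows "abs_continuous_on a b (\<lambda>x. f x - g x)"
  using abs_continuous_on_add[OF assms(1) abs_continuous_on_minus[OF assms(2)]] by simp

lemma (in bounded_bilinear) abs_continuous_on:
  assumes "abs_continuous_on a b f" "abs_continuous_on a b g"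
  shows "abs_continuous_on a b (\<lambda>x. prod (f x) (g x))"
proof -
  obtain K where K: "0 < K" "\<And>u w. norm (prod u w) \<le> norm u * norm w * K" using pos_bounded by blast
  obtain Cf where Cf: "0 \<le> Cf" "\<And>x. x \<in> {a..b} \<Longrightarrow> norm (f x) \<le> Cf"
    using continuous_on_Icc_norm_bounded abs_continuous_on_imp_continuous_on[OF assms(1)] by metis
  obtain Cg where Cg: "0 \<le> Cg" "\<And>x. x \<in> {a..b} \<Longrightarrow> norm (g x) \<le> Cg"
    using continuous_on_Icc_norm_bounded abs_continuous_on_imp_continuous_on[OF assms(2)] by metis
  show ?thesis
  proof (rule abs_continuous_on_dominated[OF assms, of "(Cf + Cg) * K"])
    fix s t assume st: "a \<le> s" "s \<le> t" "t \<le> b"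
    have "prod (f t) (g t) - prod (f s) (g s) = prod (f t) (g t - g s) + prod (f t - f s) (g s)"
      by (simp add: diff_left diff_right)
    also have "norm \<dots> \<le> norm (f t) * norm (g t - g s) * K + norm (f t - f s) * norm (g s) * K"
      using K(2) by (intro norm_triangle_le add_mono)
    also have "\<dots> \<le> (Cf + Cg) * norm (g t - g s) * K + norm (f t - f s) * (Cf + Cg) * K"
      using Cf(1) Cg(1) Cf(2)[of t] Cg(2)[of s] st K(1)
      by (intro add_mono mult_right_mono mult_left_mono) (auto intro: add_increasing add_increasing2)
    finally show "norm (prod (f t) (g t) - prod (f s) (g s)) \<le> (Cf + Cg) * K * (norm (f t - f s) + norm (g t - g s))"
      by (simp add: algebra_simps)
  qed (use Cf Cg K in auto)
qed

lemma abs_continuous_on_Pair: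
  assumes "abs_continuous_on a b f" "abs_continuous_on a b g"
  shows "abs_continuous_on a b (\<lambda>x. (f x, g x))"
  by (rule abs_continuous_on_dominated[OF assms, of 1]) (auto intro: norm_Pair_le)

lemma abs_continuous_on_cong:
  assumes "abs_continuous_on a b f" "\<And>x. x \<in> {a..b} \<Longrightarrow> f x = g x"
  shows "abs_continuous_on a b g"
  using assms(2) by (intro abs_continuous_on_lipschitz_image[OF assms(1), of 1]) auto

section \<open>The fundamental theorem of calculus for absolutely continuous functions\<close>

subsection \<open>Set integrals over intervals\<close>

lemma set_integrable_imp_set_borel_measurable:
  "set_integrable M A f \<Longrightarrow> set_borel_measurable M A f"
  by (auto simp: set_integrable_def set_borel_measurable_def dest: borel_measurable_integrable)

lemma set_integrable_Icc_subset:
  fixes f :: "real \<Rightarrow> 'a::{banach, second_countable_topology}"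
  shows "set_integrable lborel {a..b} f \<Longrightarrow> a \<le> c \<Longrightarrow> d \<le> b \<Longrightarrow> set_integrable lborel {c..d} f"
  by (rule set_integrable_subset) auto

lemma set_integral_cong_AE_on:
  assumes "set_borel_measurable M A f" "set_borel_measurable M A g" "AE x\<in>A in M. f x = g x"
  shows "(LINT x:A|M. f x) = (LINT x:A|M. g x)"
  using assms unfolding set_borel_measurable_def set_lebesgue_integral_def
  by (intro integral_cong_AE) (auto elim!: eventually_mono simp: indicator_def)

lemma set_integrable_cong_AE_on:
  assumes "set_integrable M A f" "set_borel_measurable M A g" "AE x\<in>A in M. f x = g x"
  shows "set_integrable M A g"
  using assms unfolding set_borel_measurable_def set_integrable_def
  by (elim integrable_cong_AE_imp) (auto elim!: eventually_mono simp: indicator_def)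

lemma LINT_Icc_combine:
  fixes f :: "real \<Rightarrow> 'a::euclidean_space"
  assumes "set_integrable lborel {a..c} f" "a \<le> b" "b \<le> c"
  shows "(LINT x:{a..c}|lborel. f x) = (LINT x:{a..b}|lborel. f x) + (LINT x:{b..c}|lborel. f x)"
proof -
  have "set_integrable lborel {a..b} f" "set_integrable lborel {b..c} f"
    using assms by (auto intro: set_integrable_Icc_subset)
  with assms show ?thesis
    by (simp add: set_borel_integral_eq_integral Henstock_Kurzweil_Integration.integral_combine)
qed

lemma set_integrable_const_Icc [simp]:
  fixes c :: "'a::{banach, second_countable_topology}"
  shows "set_integrable lborel {a..b::real} (\<lambda>_. c)"
  by (intro borel_integrable_atLeastAtMost' continuous_intros)

lemma LINT_Icc_nonneg:
  fixes f :: "real \<Rightarrow> real"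
  shows "(\<And>x. x \<in> {a..b} \<Longrightarrow> 0 \<le> f x) \<Longrightarrow> 0 \<le> (LINT x:{a..b}|lborel. f x)"
  unfolding set_lebesgue_integral_def by (intro integral_nonneg_AE AE_I2) (auto simp: indicator_def)

lemma LINT_singleton [simp]: "(LINT x:{c::real}|lborel. f x) = (0::'a::{banach, second_countable_topology})"
proof -
  have "AE x in lborel. indicator {c} x *\<^sub>R f x = 0"
    using AE_lborel_singleton[of c] by eventually_elim simp
  then show ?thesis unfolding set_lebesgue_integral_def by (rule integral_eq_zero_AE)
qed

lemma AE_lborel_not_in_negligible:
  assumes "negligible N" shows "AE x in lborel. x \<notin> N"
proof -
  have "AE x in lebesgue. x \<notin> N"
    using assms by (simp add: negligible_iff_null_sets AE_not_in)
  then show ?thesis by (simp add: AE_completion_iff)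
qed

subsection \<open>Indefinite integrals\<close>

lemma has_vector_derivative_iff_quotient_tendsto:
  fixes f :: "real \<Rightarrow> 'a::real_normed_vector"
  shows "(f has_vector_derivative D) (at x) \<longleftrightarrow> ((\<lambda>h. (f (x + h) - f x) /\<^sub>R h) \<longlongrightarrow> D) (at 0)"
proof -
  have "norm (f (x + h) - f x - h *\<^sub>R D) / norm h = norm ((f (x + h) - f x) /\<^sub>R h - D)" if "h \<noteq> 0" for h
  proof -
    have "f (x + h) - f x - h *\<^sub>R D = h *\<^sub>R ((f (x + h) - f x) /\<^sub>R h - D)"
      using that by (simp add: scaleR_diff_right)
    then show ?thesis using that by simp
  qed
  then have "((\<lambda>h. norm (f (x + h) - f x - h *\<^sub>R D) / norm h) \<longlongrightarrow> 0) (at 0)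
      \<longleftrightarrow> ((\<lambda>h. norm ((f (x + h) - f x) /\<^sub>R h - D)) \<longlongrightarrow> 0) (at 0)"
    by (intro LIM_equal) auto
  then show ?thesis
    by (simp add: has_vector_derivative_def has_derivative_at bounded_linear_scaleR_left
        tendsto_norm_zero_iff LIM_zero_iff)
qed

lemma integral_average_at_right_tendsto_AE:
  fixes f :: "real \<Rightarrow> 'a::euclidean_space"
  assumes "\<And>c d. f integrable_on {c..d}"
  shows "AE x in lborel. ((\<lambda>h. integral {x..x + h} f /\<^sub>R h) \<longlongrightarrow> f x) (at_right 0)"
proof -
  obtain N where N: "negligible N" "\<And>x e. \<lbrakk>x \<notin> N; 0 < e\<rbrakk> \<Longrightarrow> \<exists>d>0. \<forall>h. 0 < h \<and> h < d \<longrightarrow>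
      norm (integral (cbox x (x + h *\<^sub>R One)) f /\<^sub>R h ^ DIM(real) - f x) < e"
    using integrable_ccontinuous_explicit[of f] assms by (metis cbox_interval)
  from AE_lborel_not_in_negligible[OF N(1)] show ?thesis
  proof eventually_elim
    case (elim x)
    then show ?case
      using N(2)[OF elim] by (simp add: tendsto_iff dist_norm eventually_at_right_field) blast
  qed
qed

lemma integral_average_at_left_tendsto_AE:
  fixes f :: "real \<Rightarrow> 'a::euclidean_space"
  assumes "\<And>c d. f integrable_on {c..d}"
  shows "AE x in lborel. ((\<lambda>h. integral {x - h..x} f /\<^sub>R h) \<longlongrightarrow> f x) (at_right 0)"
proof -
  have "(\<lambda>x. f (- x)) integrable_on {c..d}" for c d
    using assms[of "-d" "-c"]
      Henstock_Kurzweil_Integration.integrable_reflect_real[where f = f and a = "-d" and b = "-c"] by simp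
  from integral_average_at_right_tendsto_AE[OF this]
  have "AE x in distr lborel borel uminus. ((\<lambda>h. integral {x..x + h} (\<lambda>s. f (- s)) /\<^sub>R h) \<longlongrightarrow> f (- x)) (at_right 0)"
    unfolding lborel_distr_uminus .
  from AE_distrD[OF _ this]
  have "AE x in lborel. ((\<lambda>h. integral {- x..- x + h} (\<lambda>s. f (- s)) /\<^sub>R h) \<longlongrightarrow> f x) (at_right 0)" by simp
  moreover have "integral {- x..- x + h} (\<lambda>s. f (- s)) = integral {x - h..x} f" for x h
    using Henstock_Kurzweil_Integration.integral_reflect_real[where f = f and a = "x - h" and b = x]
    by (simp add: add.commute)
  ultimately show ?thesis by simp
qed

lemma LINT_upto_has_vector_derivative_AE:
  fixes f :: "real \<Rightarrow> 'a::euclidean_space"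
  assumes f: "integrable lborel f"
  shows "AE x in lborel. a < x \<longrightarrow> ((\<lambda>t. LINT s:{a..t}|lborel. f s) has_vector_derivative f x) (at x)"
proof -
  define F where "F t = (LINT s:{a..t}|lborel. f s)" for t
  have set_integrable: "set_integrable lborel {c..d} f" for c d
    using f unfolding set_integrable_def by (intro integrable_mult_indicator) auto
  note integrable_on = set_borel_integral_eq_integral(1)[OF set_integrable]
  have F_diff: "F y - F x = integral {x..y} f" if "a \<le> x" "x \<le> y" for x y
    using LINT_Icc_combine[OF set_integrable that] set_borel_integral_eq_integral(2)[OF set_integrable]
    by (simp add: F_def)
  from integral_average_at_left_tendsto_AE[OF integrable_on] integral_average_at_right_tendsto_AE[OF integrable_on]
  have "AE x in lborel. a < x \<longrightarrow> (F has_vector_derivative f x) (at x)"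
  proof eventually_elim
    case (elim x)
    show ?case
    proof
      assume "a < x"
      let ?quotient = "\<lambda>h. (F (x + h) - F x) /\<^sub>R h"
      have "\<forall>\<^sub>F h in at_right 0. integral {x - h..x} f /\<^sub>R h = ?quotient (- h)"
        using eventually_at_right_real[of 0 "x - a", simplified, OF \<open>a < x\<close>]
        by eventually_elim (auto simp flip: F_diff simp: algebra_simps)
      with elim(1) have "(?quotient \<longlongrightarrow> f x) (at_left 0)"
        unfolding filterlim_at_left_to_right[of _ _ "0::real"] by (auto elim: Lim_transform_eventually)
      moreover have "\<forall>\<^sub>F h in at_right 0. integral {x..x + h} f /\<^sub>R h = ?quotient h"
        using eventually_at_right_less[of "0::real"] by eventually_elim (use \<open>a < x\<close> in \<open>auto simp flip: F_diff\<close>)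
      with elim(2) have "(?quotient \<longlongrightarrow> f x) (at_right 0)"
        by (auto elim: Lim_transform_eventually)
      ultimately show "(F has_vector_derivative f x) (at x)"
        unfolding has_vector_derivative_iff_quotient_tendsto by (simp add: filterlim_at_split)
    qed
  qed
  then show ?thesis unfolding F_def .
qed

theorem indefinite_integral_has_vector_derivative_AE:
  fixes f h :: "real \<Rightarrow> 'a::euclidean_space"
  assumes h: "set_integrable lborel {a..b} h"
    and f: "\<And>x. x \<in> {a..b} \<Longrightarrow> f x = c + (LINT t:{a..x}|lborel. h t)"
  shows "AE x\<in>{a..b} in lborel. (f has_vector_derivative h x) (at x)"
proof -
  define k where "k t = indicator {a..b} t *\<^sub>R h t" for t
  have f_eq: "f x = c + (LINT t:{a..x}|lborel. k t)" if "x \<in> {a..b}" for x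
  proof -
    have "(LINT t:{a..x}|lborel. h t) = (LINT t:{a..x}|lborel. k t)"
      using that by (intro set_lebesgue_integral_cong) (auto simp: k_def)
    then show ?thesis using f[OF that] by simp
  qed
  have "integrable lborel k" using h unfolding k_def set_integrable_def .
  from LINT_upto_has_vector_derivative_AE[OF this, of a] AE_lborel_singleton[of a] AE_lborel_singleton[of b]
  show ?thesis
  proof eventually_elim
    case (elim x)
    show ?case
    proof
      assume "x \<in> {a..b}"
      with elim have x: "a < x" "x < b" by auto
      have "((\<lambda>t. c + (LINT s:{a..t}|lborel. k s)) has_vector_derivative k x) (at x)"
        using elim x by (auto intro!: derivative_eq_intros)
      then have "(f has_vector_derivative k x) (at x)"
        by (rule has_vector_derivative_transform_within_open[of _ _ _ "{a<..<b}"]) (use x f_eq in auto)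
      then show "(f has_vector_derivative h x) (at x)" using x by (simp add: k_def)
    qed
  qed
qed

lemma integrable_truncation_small:
  fixes h :: "'a \<Rightarrow> 'b::{banach, second_countable_topology}"
  assumes h: "integrable M h" and "0 < \<epsilon>"
  obtains n :: nat where "(LINT x|M. max 0 (norm (h x) - real n)) < \<epsilon>"
proof -
  have [measurable]: "h \<in> borel_measurable M" using h by simp
  have "(\<lambda>n. LINT x|M. max 0 (norm (h x) - real n)) \<longlonglongrightarrow> (LINT x|M. 0)"
  proof (rule Bochner_Integration.integral_dominated_convergence[where w = "\<lambda>x. norm (h x)"])
    show "AE x in M. (\<lambda>n. max 0 (norm (h x) - real n)) \<longlonglongrightarrow> 0"
    proof (rule AE_I2)
      fix x
      obtain m where "norm (h x) \<le> real m" using real_arch_simple by blast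
      then have "\<forall>n\<ge>m. max 0 (norm (h x) - real n) = 0" by (auto simp: max_def)
      then show "(\<lambda>n. max 0 (norm (h x) - real n)) \<longlonglongrightarrow> 0"
        by (intro tendsto_eventually) (auto simp: eventually_sequentially)
    qed
  qed (use h in auto)
  then have "\<forall>\<^sub>F n in sequentially. (LINT x|M. max 0 (norm (h x) - real n)) < \<epsilon>"
    using \<open>0 < \<epsilon>\<close> by (auto dest: order_tendstoD)
  then show thesis using that eventually_happens'[OF sequentially_bot] by blast
qed

lemma chain_variation_indefinite_integral_le:
  fixes f h :: "real \<Rightarrow> 'a::euclidean_space" and \<psi> :: "real \<Rightarrow> real"
  assumes h: "set_integrable lborel {a..b} h" and \<psi>: "set_integrable lborel {a..b} \<psi>"
    and bound: "\<And>x. x \<in> {a..b} \<Longrightarrow> norm (h x) \<le> C + \<psi> x" "\<And>x. x \<in> {a..b} \<Longrightarrow> 0 \<le> \<psi> x"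
    and f: "\<And>s t. \<lbrakk>a \<le> s; s \<le> t; t \<le> b\<rbrakk> \<Longrightarrow> f t - f s = (LINT x:{s..t}|lborel. h x)"
  shows "chain c d I \<Longrightarrow> a \<le> c \<Longrightarrow> d \<le> b \<Longrightarrow>
    chain_variation f I \<le> C * chain_length I + (LINT x:{c..d}|lborel. \<psi> x)"
proof (induction c d I rule: chain_induct)
  case (Nil c d)
  then show ?case using bound(2) by (auto intro: LINT_Icc_nonneg)
next
  case (Cons c d s t I)
  then have st: "a \<le> s" "s \<le> t" "t \<le> b" and order: "c \<le> s" "t \<le> d" by auto
  have integrable: "set_integrable lborel {s..t} h" "set_integrable lborel {s..t} \<psi>"
    using st h \<psi> by (auto intro: set_integrable_Icc_subset)
  have "norm (f t - f s) \<le> (LINT x:{s..t}|lborel. norm (h x))"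
    unfolding f[OF st] by (rule set_integral_norm_bound[OF integrable(1)])
  also have "\<dots> \<le> (LINT x:{s..t}|lborel. C + \<psi> x)"
    using st bound by (intro set_integral_mono set_integrable_norm integrable set_integral_add(1)) auto
  also have "\<dots> = C * (t - s) + (LINT x:{s..t}|lborel. \<psi> x)"
    using st by (subst set_integral_add(2)) (auto simp: integrable set_integral_const)
  finally have "norm (f t - f s) \<le> C * (t - s) + (LINT x:{s..t}|lborel. \<psi> x)" .
  moreover have "chain_variation f I \<le> C * chain_length I + (LINT x:{t..d}|lborel. \<psi> x)"
    using Cons by auto
  moreover have "(LINT x:{c..d}|lborel. \<psi> x)
      = (LINT x:{c..s}|lborel. \<psi> x) + ((LINT x:{s..t}|lborel. \<psi> x) + (LINT x:{t..d}|lborel. \<psi> x))"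
    using Cons.prems st order
    by (subst LINT_Icc_combine[of c d \<psi> s], auto intro: set_integrable_Icc_subset[OF \<psi>],
        subst LINT_Icc_combine[of s d \<psi> t], auto intro: set_integrable_Icc_subset[OF \<psi>])
  moreover have "0 \<le> (LINT x:{c..s}|lborel. \<psi> x)"
    using Cons.prems st bound(2) by (intro LINT_Icc_nonneg) auto
  ultimately show ?case by (simp add: algebra_simps)
qed

theorem indefinite_integral_abs_continuous_on:
  fixes f h :: "real \<Rightarrow> 'a::euclidean_space"
  assumes h: "set_integrable lborel {a..b} h"
    and f: "\<And>x. x \<in> {a..b} \<Longrightarrow> f x = c + (LINT t:{a..x}|lborel. h t)"
  shows "abs_continuous_on a b f"
  unfolding abs_continuous_on_def
proof (intro allI impI)
  fix \<epsilon> :: real assume "0 < \<epsilon>"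
  have "integrable lborel (\<lambda>x. indicator {a..b} x *\<^sub>R h x)" using h by (simp add: set_integrable_def)
  then obtain n :: nat where n: "(LINT x|lborel. max 0 (norm (indicator {a..b} x *\<^sub>R h x) - real n)) < \<epsilon>/2"
    using integrable_truncation_small half_gt_zero[OF \<open>0 < \<epsilon>\<close>] by metis
  define \<psi> where "\<psi> x = max 0 (norm (h x) - real n)" for x
  have \<psi>_eq: "max 0 (norm (indicator {a..b} x *\<^sub>R h x) - real n) = indicator {a..b} x *\<^sub>R \<psi> x" for x
    by (simp add: \<psi>_def indicator_def)
  have \<psi>: "set_integrable lborel {a..b} \<psi>"
  proof (rule set_integrable_bound[OF h])
    show "set_borel_measurable lborel {a..b} \<psi>"
      using set_integrable_imp_set_borel_measurable[OF h]
      unfolding set_borel_measurable_def \<psi>_eq[symmetric] by measurable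
  qed (simp add: \<psi>_def)
  have "f t - f s = (LINT x:{s..t}|lborel. h x)" if "a \<le> s" "s \<le> t" "t \<le> b" for s t
    using LINT_Icc_combine[of a t h s] that by (simp add: f set_integrable_Icc_subset[OF h])
  from chain_variation_indefinite_integral_le[OF h \<psi> _ _ this]
  have variation_le: "chain_variation f I \<le> real n * chain_length I + (LINT x:{a..b}|lborel. \<psi> x)"
    if "chain a b I" for I
    using that by (simp add: \<psi>_def)
  have "chain_variation f I < \<epsilon>" if I: "chain a b I" "chain_length I < \<epsilon> / (2 * (real n + 1))" for I
  proof -
    have "real n * chain_length I \<le> real n * (\<epsilon> / (2 * (real n + 1)))"
      using I(2) by (intro mult_left_mono) auto
    also have "\<dots> \<le> \<epsilon>/2" using \<open>0 < \<epsilon>\<close> by (simp add: field_simps)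
    finally show ?thesis
      using variation_le[OF I(1)] n unfolding \<psi>_eq set_lebesgue_integral_def by linarith
  qed
  then show "\<exists>\<delta>>0. \<forall>I. chain a b I \<and> chain_length I < \<delta> \<longrightarrow> chain_variation f I < \<epsilon>"
    using \<open>0 < \<epsilon>\<close> by (intro exI[of _ "\<epsilon> / (2 * (real n + 1))"]) auto
qed

subsection \<open>Densities of absolutely continuous functions\<close>

lemma sorted_list_of_nonoverlapping_intervals:
  fixes E :: "(real \<times> real) set"
  assumes "finite E" "\<And>s t. (s, t) \<in> E \<Longrightarrow> s < t" "disjoint_family_on (\<lambda>(s, t). {s<..<t}) E"
  obtains I where "distinct I" "set I = E" "sorted_wrt (\<lambda>J K. snd J \<le> fst K) I"
proof -
  obtain xs where xs: "set xs = E" "distinct xs" using finite_distinct_list[OF assms(1)] by blast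
  define I where "I = sort_key fst xs"
  have I: "distinct I" "set I = E" using xs by (simp_all add: I_def)
  have "sorted (map fst I)" by (simp add: I_def)
  have "sorted_wrt (\<lambda>J K. snd J \<le> fst K) I"
    unfolding sorted_wrt_iff_nth_less
  proof (intro allI impI)
    fix i j assume ij: "i < j" "j < length I"
    obtain s t s' t' where st: "I ! i = (s, t)" "I ! j = (s', t')" by force
    with ij I have in_E: "(s, t) \<in> E" "(s', t') \<in> E" by (metis nth_mem order_less_trans)+
    have "(s, t) \<noteq> (s', t')" using st ij I(1) by (metis nth_eq_iff_index_eq order_less_trans less_irrefl)
    then have disjoint: "{s<..<t} \<inter> {s'<..<t'} = {}"
      using disjoint_family_onD[OF assms(3) in_E] by simp
    have "fst (I ! i) \<le> fst (I ! j)"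
      using \<open>sorted (map fst I)\<close> ij by (simp add: sorted_wrt_iff_nth_less)
    then have "s \<le> s'" using st by simp
    show "snd (I ! i) \<le> fst (I ! j)"
    proof (rule ccontr)
      assume "\<not> snd (I ! i) \<le> fst (I ! j)"
      then have "(s' + min t t') / 2 \<in> {s<..<t} \<inter> {s'<..<t'}"
        using st \<open>s \<le> s'\<close> assms(2)[OF in_E(2)] by (auto simp: min_def field_simps)
      then show False using disjoint by blast
    qed
  qed
  with I that show thesis by blast
qed

lemma abs_continuous_on_nonoverlapping:
  assumes "abs_continuous_on a b f" "0 < \<epsilon>"
  obtains \<delta> where "0 < \<delta>"
    "\<And>E. \<lbrakk>finite E; \<And>s t. (s, t) \<in> E \<Longrightarrow> a \<le> s \<and> s < t \<and> t \<le> b;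
       disjoint_family_on (\<lambda>(s, t). {s<..<t}) E; (\<Sum>(s, t)\<in>E. t - s) < \<delta>\<rbrakk>
     \<Longrightarrow> (\<Sum>(s, t)\<in>E. norm (f t - f s)) < \<epsilon>"
proof -
  obtain \<delta> where \<delta>: "0 < \<delta>" "\<And>I. chain a b I \<Longrightarrow> chain_length I < \<delta> \<Longrightarrow> chain_variation f I < \<epsilon>"
    using abs_continuous_onE[OF assms] by metis
  show thesis
  proof (rule that[OF \<delta>(1)])
    fix E :: "(real \<times> real) set"
    assume E: "finite E" "\<And>s t. (s, t) \<in> E \<Longrightarrow> a \<le> s \<and> s < t \<and> t \<le> b"
      "disjoint_family_on (\<lambda>(s, t). {s<..<t}) E" and small: "(\<Sum>(s, t)\<in>E. t - s) < \<delta>"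
    obtain I where I: "distinct I" "set I = E" "sorted_wrt (\<lambda>J K. snd J \<le> fst K) I"
      using sorted_list_of_nonoverlapping_intervals[OF E(1) _ E(3)] E(2) by metis
    have "chain a b I" unfolding chain_iff_sorted using I E(2) by fastforce
    moreover have "chain_length I < \<delta>"
      using small I by (simp add: chain_length_def sum_list_distinct_conv_sum_set)
    ultimately have "chain_variation f I < \<epsilon>" by (rule \<delta>(2))
    then show "(\<Sum>(s, t)\<in>E. norm (f t - f s)) < \<epsilon>"
      using I by (simp add: chain_variation_def sum_list_distinct_conv_sum_set)
  qed
qed

lemma open_cover_nonoverlapping_intervals:
  fixes a b :: real
  assumes "open U" "a < b"
  obtains D :: "(real \<times> real) set" where "countable D"
    "\<And>s t. (s, t) \<in> D \<Longrightarrow> a \<le> s \<and> s < t \<and> t \<le> b \<and> {s..t} \<subseteq> U"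
    "disjoint_family_on (\<lambda>(s, t). {s<..<t}) D" "U \<inter> {a..b} \<subseteq> (\<Union>(s, t)\<in>D. {s..t})"
proof -
  define g where "g x = (if x \<in> U then U else UNIV)" for x
  have "gauge g" using \<open>open U\<close> by (auto simp: gauge_def g_def)
  moreover have "U \<inter> {a..b} \<subseteq> cbox a b" "box a b \<noteq> {}" using \<open>a < b\<close> by auto
  ultimately obtain \<D> where \<D>: "countable \<D>" "\<Union>\<D> \<subseteq> cbox a b"
    "\<And>K. K \<in> \<D> \<Longrightarrow> interior K \<noteq> {} \<and> (\<exists>c d. K = cbox c d)"
    "pairwise (\<lambda>A B. interior A \<inter> interior B = {}) \<D>"
    "\<And>K. K \<in> \<D> \<Longrightarrow> \<exists>x \<in> U \<inter> {a..b} \<inter> K. K \<subseteq> g x" "U \<inter> {a..b} \<subseteq> \<Union>\<D>"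
    using covering_lemma[of "U \<inter> {a..b}" a b g] by metis
  define D where "D = (\<lambda>K. (Inf K, Sup K)) ` \<D>"
  have Icc: "K = {Inf K..Sup K} \<and> Inf K < Sup K" if "K \<in> \<D>" for K
    using \<D>(3)[OF that] by (auto simp: cbox_interval interior_atLeastAtMost_real)
  have in_D: "{s..t} \<in> \<D> \<and> s < t" if "(s, t) \<in> D" for s t
    using that Icc by (auto simp: D_def)
  show thesis
  proof (rule that[of D])
    show "countable D" using \<D>(1) by (simp add: D_def)
    show "a \<le> s \<and> s < t \<and> t \<le> b \<and> {s..t} \<subseteq> U" if "(s, t) \<in> D" for s t
    proof -
      have "{s..t} \<subseteq> {a..b}" "{s..t} \<subseteq> U"
        using in_D[OF that] \<D>(2,5) by (fastforce simp: g_def)+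
      then show ?thesis using in_D[OF that] by auto
    qed
    show "disjoint_family_on (\<lambda>(s, t). {s<..<t}) D"
      unfolding disjoint_family_on_def
    proof (intro ballI impI)
      fix J K assume J: "J \<in> D" and K: "K \<in> D" and "J \<noteq> K"
      moreover obtain s t s' t' where "J = (s, t)" "K = (s', t')" by force
      ultimately show "(case J of (s, t) \<Rightarrow> {s<..<t}) \<inter> (case K of (s, t) \<Rightarrow> {s<..<t}) = {}"
        using pairwiseD[OF \<D>(4), of "{s..t}" "{s'..t'}"] in_D[of s t] in_D[of s' t']
        by (auto simp: interior_atLeastAtMost_real Icc_eq_Icc)
    qed
    show "U \<inter> {a..b} \<subseteq> (\<Union>(s, t)\<in>D. {s..t})"
    proof
      fix x assume "x \<in> U \<inter> {a..b}"
      then obtain K where "K \<in> \<D>" "x \<in> K" using \<D>(6) by blast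
      then have "(Inf K, Sup K) \<in> D" "x \<in> {Inf K..Sup K}" using Icc[of K] by (auto simp: D_def)
      then show "x \<in> (\<Union>(s, t)\<in>D. {s..t})" by blast
    qed
  qed
qed

lemma emeasure_countable_UN_le:
  assumes "countable D" "\<And>i. i \<in> D \<Longrightarrow> A i \<in> sets M"
    and finite_le: "\<And>E. finite E \<Longrightarrow> E \<subseteq> D \<Longrightarrow> emeasure M (\<Union>i\<in>E. A i) \<le> c"
  shows "emeasure M (\<Union>i\<in>D. A i) \<le> c"
proof (cases "D = {}")
  case False
  define B where "B n = (\<Union>i\<in>from_nat_into D ` {..n}. A i)" for n :: nat
  have sub: "from_nat_into D ` {..n} \<subseteq> D" for n using False by (auto intro: from_nat_into)
  have "emeasure M (\<Union>n. B n) = (SUP n. emeasure M (B n))"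
  proof (rule SUP_emeasure_incseq[symmetric])
    show "range B \<subseteq> sets M" unfolding B_def using sub assms(2) by (fastforce intro!: sets.finite_UN)
    show "incseq B" unfolding incseq_def B_def by (auto intro: order_trans)
  qed
  also have "\<dots> \<le> c" unfolding B_def by (intro SUP_least finite_le sub) auto
  also have "(\<Union>n. B n) = (\<Union>i\<in>D. A i)"
  proof
    show "(\<Union>n. B n) \<subseteq> (\<Union>i\<in>D. A i)" unfolding B_def using sub by blast
    show "(\<Union>i\<in>D. A i) \<subseteq> (\<Union>n. B n)"
    proof
      fix x assume "x \<in> (\<Union>i\<in>D. A i)"
      then obtain i where "i \<in> D" "x \<in> A i" by blast
      moreover obtain n where "from_nat_into D n = i" using from_nat_into_surj[OF assms(1) \<open>i \<in> D\<close>] by blast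
      ultimately have "x \<in> B n" unfolding B_def by blast
      then show "x \<in> (\<Union>n. B n)" by blast
    qed
  qed
  finally show ?thesis .
qed simp

lemma sum_lengths_eq_emeasure:
  fixes E :: "(real \<times> real) set"
  assumes "finite E" "\<And>s t. (s, t) \<in> E \<Longrightarrow> s < t" "disjoint_family_on (\<lambda>(s, t). {s<..<t}) E"
  shows "ennreal (\<Sum>(s, t)\<in>E. t - s) = emeasure lborel (\<Union>(s, t)\<in>E. {s<..<t})"
proof -
  have "ennreal (\<Sum>(s, t)\<in>E. t - s) = (\<Sum>(s, t)\<in>E. emeasure lborel {s<..<t})"
    using assms(2) by (subst sum_ennreal[symmetric]) (auto intro!: sum.cong simp: less_imp_le)
  also have "\<dots> = emeasure lborel (\<Union>(s, t)\<in>E. {s<..<t})"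
    using assms by (subst sum_emeasure[symmetric]) (auto simp: case_prod_unfold)
  finally show ?thesis .
qed

text \<open>The Stieltjes measure of a monotone absolutely continuous function is absolutely continuous on \<open>[a, b]\<close>; outside
  that interval nothing is known about \<open>G\<close>.\<close>
context
  fixes a b :: real and G :: "real \<Rightarrow> real"
  assumes nonempty: "a < b" and mono: "mono G" and continuous: "continuous_on UNIV G"
    and abs_continuous: "abs_continuous_on a b G"
begin

lemma emeasure_interval_measure_UN_Icc_le:
  assumes "finite E" "\<And>s t. (s, t) \<in> E \<Longrightarrow> s < t"
  shows "emeasure (interval_measure G) (\<Union>(s, t)\<in>E. {s..t}) \<le> ennreal (\<Sum>(s, t)\<in>E. norm (G t - G s))"
proof -
  let ?\<mu> = "interval_measure G"
  have Icc: "emeasure ?\<mu> {s..t} = ennreal (norm (G t - G s))" if "s < t" for s t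
    using emeasure_interval_measure_Icc[of s t, OF _ monoD[OF mono] continuous] monoD[OF mono, of s t] that by simp
  have "emeasure ?\<mu> (\<Union>(s, t)\<in>E. {s..t}) \<le> (\<Sum>(s, t)\<in>E. emeasure ?\<mu> {s..t})"
    using emeasure_subadditive_finite[OF assms(1), of "\<lambda>(s, t). {s..t}" ?\<mu>]
    by (simp add: case_prod_unfold image_subset_iff)
  also have "\<dots> = (\<Sum>(s, t)\<in>E. ennreal (norm (G t - G s)))"
    using assms(2) by (intro sum.cong refl) (auto simp: Icc)
  finally show ?thesis by (simp add: case_prod_unfold sum_ennreal)
qed

lemma emeasure_interval_measure_open_small:
  assumes "0 < \<epsilon>"
  obtains \<delta> where "0 < \<delta>" "\<And>U. open U \<Longrightarrow> emeasure lborel U < ennreal \<delta> \<Longrightarrow>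
    emeasure (interval_measure G) (U \<inter> {a..b}) \<le> ennreal \<epsilon>"
proof -
  let ?\<mu> = "interval_measure G"
  obtain \<delta> where \<delta>: "0 < \<delta>"
    "\<And>E. \<lbrakk>finite E; \<And>s t. (s, t) \<in> E \<Longrightarrow> a \<le> s \<and> s < t \<and> t \<le> b;
       disjoint_family_on (\<lambda>(s, t). {s<..<t}) E; (\<Sum>(s, t)\<in>E. t - s) < \<delta>\<rbrakk>
     \<Longrightarrow> (\<Sum>(s, t)\<in>E. norm (G t - G s)) < \<epsilon>"
    using abs_continuous_on_nonoverlapping[OF abs_continuous assms] by metis
  show thesis
  proof (rule that[OF \<delta>(1)])
    fix U :: "real set" assume U: "open U" "emeasure lborel U < ennreal \<delta>"
    obtain D where D: "countable D" "\<And>s t. (s, t) \<in> D \<Longrightarrow> a \<le> s \<and> s < t \<and> t \<le> b \<and> {s..t} \<subseteq> U"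
      "disjoint_family_on (\<lambda>(s, t). {s<..<t}) D" "U \<inter> {a..b} \<subseteq> (\<Union>(s, t)\<in>D. {s..t})"
      using open_cover_nonoverlapping_intervals[OF U(1) nonempty] by metis
    have "emeasure ?\<mu> (\<Union>(s, t)\<in>E. {s..t}) \<le> ennreal \<epsilon>" if E: "finite E" "E \<subseteq> D" for E
    proof -
      have disjoint: "disjoint_family_on (\<lambda>(s, t). {s<..<t}) E"
        using disjoint_family_on_mono[OF E(2) D(3)] .
      have ordered: "s < t" if "(s, t) \<in> E" for s t using D(2) E(2) that by blast
      then have "ennreal (\<Sum>(s, t)\<in>E. t - s) = emeasure lborel (\<Union>(s, t)\<in>E. {s<..<t})"
        by (rule sum_lengths_eq_emeasure[OF E(1) _ disjoint])
      also have "\<dots> \<le> emeasure lborel U"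
        using D(2) E(2) U(1) by (intro emeasure_mono) fastforce+
      finally have "(\<Sum>(s, t)\<in>E. t - s) < \<delta>"
        using U(2) \<delta>(1) by (meson ennreal_leI linorder_not_less order_le_less_trans)
      then have "(\<Sum>(s, t)\<in>E. norm (G t - G s)) < \<epsilon>"
        using D(2) E disjoint by (intro \<delta>(2)) blast+
      with emeasure_interval_measure_UN_Icc_le[OF E(1) ordered] show ?thesis
        by (meson ennreal_leI less_imp_le order_trans)
    qed
    then have "emeasure ?\<mu> (\<Union>(s, t)\<in>D. {s..t}) \<le> ennreal \<epsilon>"
      using emeasure_countable_UN_le[OF D(1), of "\<lambda>(s, t). {s..t}" ?\<mu>] by auto
    moreover have "emeasure ?\<mu> (U \<inter> {a..b}) \<le> emeasure ?\<mu> (\<Union>(s, t)\<in>D. {s..t})"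
      using D(1) by (intro emeasure_mono D(4)) (auto intro!: sets.countable_UN')
    ultimately show "emeasure ?\<mu> (U \<inter> {a..b}) \<le> ennreal \<epsilon>" by simp
  qed
qed

lemma emeasure_interval_measure_null:
  assumes N: "N \<in> null_sets lborel"
  shows "emeasure (interval_measure G) (N \<inter> {a..b}) = 0"
proof -
  have [measurable]: "N \<in> sets borel" using N by auto
  have "emeasure (interval_measure G) (N \<inter> {a..b}) \<le> 0 + ennreal \<epsilon>" if "0 < \<epsilon>" for \<epsilon> :: real
  proof -
    obtain \<delta> where \<delta>: "0 < \<delta>" "\<And>U. open U \<Longrightarrow> emeasure lborel U < ennreal \<delta> \<Longrightarrow>
        emeasure (interval_measure G) (U \<inter> {a..b}) \<le> ennreal \<epsilon>"
      using emeasure_interval_measure_open_small[OF \<open>0 < \<epsilon>\<close>] by metis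
    obtain U where U: "open U" "N \<subseteq> U" "emeasure lborel (U - N) < ennreal \<delta>"
      using outer_regular_lborel[OF _ \<delta>(1), of N] by (metis \<open>N \<in> sets borel\<close>)
    have "emeasure lborel U = emeasure lborel (U - N)"
      using emeasure_Diff_null_set[OF N, of U] U(1) by simp
    with U \<delta>(2)[OF U(1)] have "emeasure (interval_measure G) (U \<inter> {a..b}) \<le> ennreal \<epsilon>" by simp
    moreover have "emeasure (interval_measure G) (N \<inter> {a..b}) \<le> emeasure (interval_measure G) (U \<inter> {a..b})"
      using U by (intro emeasure_mono) auto
    ultimately show ?thesis by simp
  qed
  then show ?thesis using ennreal_le_epsilon[of 0] by force
qed

lemma interval_measure_has_density:
  obtains f :: "real \<Rightarrow> ennreal" where "f \<in> borel_measurable borel"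
    "\<And>A. A \<in> sets borel \<Longrightarrow> (\<integral>\<^sup>+t. f t * indicator A t \<partial>lborel) = emeasure (interval_measure G) (A \<inter> {a..b})"
proof -
  define \<nu> where "\<nu> = density (interval_measure G) (indicator {a..b})"
  have \<nu>: "emeasure \<nu> A = emeasure (interval_measure G) (A \<inter> {a..b})" if "A \<in> sets borel" for A
    using that by (simp add: \<nu>_def emeasure_density flip: indicator_inter_arith) (simp add: Int_commute)
  have "absolutely_continuous lborel \<nu>"
    unfolding absolutely_continuous_def
  proof
    fix N :: "real set" assume "N \<in> null_sets lborel"
    then show "N \<in> null_sets \<nu>"
      using emeasure_interval_measure_null \<nu>[of N] by (auto simp: null_sets_def \<nu>_def)
  qed
  then obtain f where "f \<in> borel_measurable lborel" "density lborel f = \<nu>"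
    using sigma_finite_measure.Radon_Nikodym[OF sigma_finite_lborel, of \<nu>] by (auto simp: \<nu>_def)
  then show thesis using that[of f] \<nu> by (simp flip: emeasure_density)
qed

lemma mono_abs_continuous_on_has_density:
  obtains h where "set_integrable lborel {a..b} h"
    "\<And>x. x \<in> {a..b} \<Longrightarrow> G x = G a + (LINT t:{a..x}|lborel. h t)"
proof -
  obtain f :: "real \<Rightarrow> ennreal" where f [measurable]: "f \<in> borel_measurable borel"
    and f_density: "\<And>A. A \<in> sets borel \<Longrightarrow>
      (\<integral>\<^sup>+t. f t * indicator A t \<partial>lborel) = emeasure (interval_measure G) (A \<inter> {a..b})"
    using interval_measure_has_density by blast
  have f_Icc: "(\<integral>\<^sup>+t. f t * indicator {a..x} t \<partial>lborel) = ennreal (G x - G a)" if "x \<in> {a..b}" for x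
  proof -
    have "{a..x} \<inter> {a..b} = {a..x}" using that by auto
    then show ?thesis
      using f_density[of "{a..x}"] emeasure_interval_measure_Icc[of a x, OF _ monoD[OF mono] continuous] that by simp
  qed
  have finite: "AE t in lborel. f t * indicator {a..b} t \<noteq> \<infinity>"
    using f_Icc[of b] nonempty by (intro nn_integral_PInf_AE) auto
  have integral: "has_bochner_integral lborel (\<lambda>t. indicator {a..x} t *\<^sub>R enn2real (f t)) (G x - G a)"
    if x: "x \<in> {a..b}" for x
  proof (rule has_bochner_integral_nn_integral)
    have "(\<integral>\<^sup>+t. ennreal (indicator {a..x} t *\<^sub>R enn2real (f t)) \<partial>lborel) = (\<integral>\<^sup>+t. f t * indicator {a..x} t \<partial>lborel)"
    proof (rule nn_integral_cong_AE)
      show "AE t in lborel. ennreal (indicator {a..x} t *\<^sub>R enn2real (f t)) = f t * indicator {a..x} t"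
        using finite by eventually_elim (use x in \<open>auto simp: indicator_def less_top split: if_splits\<close>)
    qed
    then show "(\<integral>\<^sup>+t. ennreal (indicator {a..x} t *\<^sub>R enn2real (f t)) \<partial>lborel) = ennreal (G x - G a)"
      using f_Icc[OF x] by simp
    show "0 \<le> G x - G a" using monoD[OF mono, of a x] x by auto
  qed auto
  show thesis
  proof (rule that)
    show "set_integrable lborel {a..b} (\<lambda>t. enn2real (f t))"
      using integral[of b] nonempty by (auto simp: set_integrable_def dest: integrable.intros)
    show "G x = G a + (LINT t:{a..x}|lborel. enn2real (f t))" if "x \<in> {a..b}" for x
      using integral[OF that] by (simp add: set_lebesgue_integral_def has_bochner_integral_iff)
  qed
qed

end

lemma abs_continuous_on_has_density_mono:
  fixes f :: "real \<Rightarrow> real"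
  assumes "a < b" and mono: "\<And>x y. a \<le> x \<Longrightarrow> x \<le> y \<Longrightarrow> y \<le> b \<Longrightarrow> f x \<le> f y"
    and f: "abs_continuous_on a b f"
  obtains h where "set_integrable lborel {a..b} h"
    "\<And>x. x \<in> {a..b} \<Longrightarrow> f x = f a + (LINT t:{a..x}|lborel. h t)"
proof -
  define G where "G x = f (max a (min b x))" for x
  have G_eq: "G x = f x" if "x \<in> {a..b}" for x using that by (simp add: G_def)
  have "mono G" unfolding G_def using \<open>a < b\<close> by (intro monoI mono) auto
  moreover have "continuous_on UNIV G"
    unfolding G_def using \<open>a < b\<close>
    by (intro continuous_on_compose2[OF abs_continuous_on_imp_continuous_on[OF f]] continuous_intros) auto
  moreover have "abs_continuous_on a b G" using abs_continuous_on_cong[OF f] G_eq by simp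
  ultimately obtain h where h: "set_integrable lborel {a..b} h"
    "\<And>x. x \<in> {a..b} \<Longrightarrow> G x = G a + (LINT t:{a..x}|lborel. h t)"
    using mono_abs_continuous_on_has_density[OF \<open>a < b\<close>] by metis
  show thesis
  proof (rule that[OF h(1)])
    fix x assume "x \<in> {a..b}"
    with h(2)[OF this] show "f x = f a + (LINT t:{a..x}|lborel. h t)"
      using \<open>a < b\<close> by (simp add: G_eq)
  qed
qed

lemma abs_continuous_on_has_density_real:
  fixes f :: "real \<Rightarrow> real"
  assumes "a < b" and f: "abs_continuous_on a b f"
  obtains h where "set_integrable lborel {a..b} h"
    "\<And>x. x \<in> {a..b} \<Longrightarrow> f x = f a + (LINT t:{a..x}|lborel. h t)"
proof -
  let ?V = "total_variation f a"
  have "?V x + \<bar>f y - f x\<bar> \<le> ?V y" if "a \<le> x" "x \<le> y" "y \<le> b" for x y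
    using total_variation_add_norm_diff_le[OF _ f that] \<open>a < b\<close> by simp
  then have mono: "?V x \<le> ?V y" "?V x - f x \<le> ?V y - f y" if "a \<le> x" "x \<le> y" "y \<le> b" for x y
    using that by (smt (verit))+
  have V: "abs_continuous_on a b ?V" using \<open>a < b\<close> by (intro abs_continuous_on_total_variation f) simp
  obtain h where h: "set_integrable lborel {a..b} h"
    "\<And>x. x \<in> {a..b} \<Longrightarrow> ?V x = ?V a + (LINT t:{a..x}|lborel. h t)"
    using abs_continuous_on_has_density_mono[OF \<open>a < b\<close> mono(1) V] by blast
  obtain k where k: "set_integrable lborel {a..b} k"
    "\<And>x. x \<in> {a..b} \<Longrightarrow> ?V x - f x = ?V a - f a + (LINT t:{a..x}|lborel. k t)"
    using abs_continuous_on_has_density_mono[OF \<open>a < b\<close> mono(2) abs_continuous_on_diff[OF V f]] by blast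
  show thesis
  proof (rule that)
    show "set_integrable lborel {a..b} (\<lambda>t. h t - k t)" by (intro set_integral_diff h k)
    fix x assume x: "x \<in> {a..b}"
    then have "(LINT t:{a..x}|lborel. h t - k t) = (LINT t:{a..x}|lborel. h t) - (LINT t:{a..x}|lborel. k t)"
      by (intro set_integral_diff set_integrable_Icc_subset[OF h(1)] set_integrable_Icc_subset[OF k(1)]) auto
    then show "f x = f a + (LINT t:{a..x}|lborel. h t - k t)" using h(2)[OF x] k(2)[OF x] by simp
  qed
qed

lemma set_integrable_sum_scaleR_Basis:
  fixes h :: "'a::euclidean_space \<Rightarrow> real \<Rightarrow> real"
  assumes "\<And>e. set_integrable M A (h e)"
  shows "set_integrable M A (\<lambda>t. \<Sum>e\<in>Basis. h e t *\<^sub>R e)"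
    and "(LINT t:A|M. \<Sum>e\<in>Basis. h e t *\<^sub>R e) = (\<Sum>e\<in>Basis. (LINT t:A|M. h e t) *\<^sub>R e)"
proof -
  have eq: "indicator A t *\<^sub>R (\<Sum>e\<in>Basis. h e t *\<^sub>R e) = (\<Sum>e\<in>Basis. (indicator A t *\<^sub>R h e t) *\<^sub>R e)" for t
    by (simp add: scaleR_sum_right)
  show "set_integrable M A (\<lambda>t. \<Sum>e\<in>Basis. h e t *\<^sub>R e)"
    using assms unfolding set_integrable_def eq by (intro Bochner_Integration.integrable_sum) auto
  show "(LINT t:A|M. \<Sum>e\<in>Basis. h e t *\<^sub>R e) = (\<Sum>e\<in>Basis. (LINT t:A|M. h e t) *\<^sub>R e)"
    using assms unfolding set_integrable_def set_lebesgue_integral_def eq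
    by (subst Bochner_Integration.integral_sum) auto
qed

theorem abs_continuous_on_has_density:
  fixes f :: "real \<Rightarrow> 'a::euclidean_space"
  assumes "a < b" and f: "abs_continuous_on a b f"
  obtains h where "set_integrable lborel {a..b} h"
    "\<And>x. x \<in> {a..b} \<Longrightarrow> f x = f a + (LINT t:{a..x}|lborel. h t)"
proof -
  have "\<exists>h. set_integrable lborel {a..b} h \<and> (\<forall>x\<in>{a..b}. f x \<bullet> e = f a \<bullet> e + (LINT t:{a..x}|lborel. h t))" for e
    using abs_continuous_on_has_density_real[OF \<open>a < b\<close> bounded_linear.abs_continuous_on[OF bounded_linear_inner_left f]]
    by metis
  then obtain h where h: "\<And>e. set_integrable lborel {a..b} (h e)"
    "\<And>e x. x \<in> {a..b} \<Longrightarrow> f x \<bullet> e = f a \<bullet> e + (LINT t:{a..x}|lborel. h e t)" by metis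
  show thesis
  proof (rule that)
    show "set_integrable lborel {a..b} (\<lambda>t. \<Sum>e\<in>Basis. h e t *\<^sub>R e)"
      by (rule set_integrable_sum_scaleR_Basis(1)[OF h(1)])
    fix x assume x: "x \<in> {a..b}"
    have "f x = (\<Sum>e\<in>Basis. (f a \<bullet> e + (LINT t:{a..x}|lborel. h e t)) *\<^sub>R e)"
      unfolding h(2)[OF x, symmetric] by (rule euclidean_representation[symmetric])
    also have "\<dots> = f a + (\<Sum>e\<in>Basis. (LINT t:{a..x}|lborel. h e t) *\<^sub>R e)"
      by (simp add: scaleR_add_left sum.distrib euclidean_representation)
    also have "(\<Sum>e\<in>Basis. (LINT t:{a..x}|lborel. h e t) *\<^sub>R e) = (LINT t:{a..x}|lborel. \<Sum>e\<in>Basis. h e t *\<^sub>R e)"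
      using x by (subst set_integrable_sum_scaleR_Basis(2)) (auto intro: set_integrable_Icc_subset[OF h(1)])
    finally show "f x = f a + (LINT t:{a..x}|lborel. \<Sum>e\<in>Basis. h e t *\<^sub>R e)" .
  qed
qed

subsection \<open>Measurability of the derivative\<close>

lemma ex_tendsto_iff_cauchy_filter:
  fixes f :: "'a \<Rightarrow> 'b::{complete_space}"
  assumes "F \<noteq> bot"
  shows "(\<exists>L. (f \<longlongrightarrow> L) F) \<longleftrightarrow> cauchy_filter (filtermap f F)"
proof
  assume "\<exists>L. (f \<longlongrightarrow> L) F"
  then show "cauchy_filter (filtermap f F)" by (auto simp: filterlim_def intro: nhds_imp_cauchy_filter)
next
  assume "cauchy_filter (filtermap f F)"
  then show "\<exists>L. (f \<longlongrightarrow> L) F"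
    using cauchy_filter_complete_converges[of "filtermap f F" UNIV] assms
    by (auto simp: filterlim_def complete_UNIV filtermap_bot_iff)
qed

lemma cauchy_filter_at_0_iff:
  fixes Q :: "real \<Rightarrow> 'a::metric_space"
  shows "cauchy_filter (filtermap Q (at 0)) \<longleftrightarrow>
    (\<forall>n. \<exists>m. \<forall>h k. 0 < \<bar>h\<bar> \<and> \<bar>h\<bar> < inverse (real (Suc m)) \<and> 0 < \<bar>k\<bar> \<and> \<bar>k\<bar> < inverse (real (Suc m)) \<longrightarrow>
       dist (Q h) (Q k) \<le> inverse (real (Suc n)))" (is "_ \<longleftrightarrow> (\<forall>n. \<exists>m. ?close n m)")
  unfolding cauchy_filter_metric_filtermap
proof
  assume cauchy: "\<forall>e>0. \<exists>P. eventually P (at 0) \<and> (\<forall>h k. P h \<and> P k \<longrightarrow> dist (Q h) (Q k) < e)"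
  show "\<forall>n. \<exists>m. ?close n m"
  proof
    fix n
    obtain P where "eventually P (at 0)" and P: "\<And>h k. P h \<Longrightarrow> P k \<Longrightarrow> dist (Q h) (Q k) < inverse (real (Suc n))"
      using cauchy[rule_format, of "inverse (real (Suc n))"] by auto
    then obtain d where d: "0 < d" "\<And>h. h \<noteq> 0 \<Longrightarrow> \<bar>h\<bar> < d \<Longrightarrow> P h" by (auto simp: eventually_at dist_real_def)
    obtain m where "inverse (real (Suc m)) < d" using reals_Archimedean[OF d(1)] by auto
    then have "?close n m" using P d(2) by (fastforce intro: less_imp_le)
    then show "\<exists>m. ?close n m" ..
  qed
next
  assume close: "\<forall>n. \<exists>m. ?close n m"
  show "\<forall>e>0. \<exists>P. eventually P (at 0) \<and> (\<forall>h k. P h \<and> P k \<longrightarrow> dist (Q h) (Q k) < e)"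
  proof (intro allI impI)
    fix e :: real assume "0 < e"
    then obtain n where "inverse (real (Suc n)) < e" using reals_Archimedean by auto
    moreover obtain m where "?close n m" using close by blast
    moreover have "eventually (\<lambda>h. 0 < \<bar>h\<bar> \<and> \<bar>h\<bar> < inverse (real (Suc m))) (at (0::real))"
      unfolding eventually_at by (intro exI[of _ "inverse (real (Suc m))"]) (simp add: dist_real_def)
    ultimately show "\<exists>P. eventually P (at 0) \<and> (\<forall>h k. P h \<and> P k \<longrightarrow> dist (Q h) (Q k) < e)"
      by (intro exI[of _ "\<lambda>h. 0 < \<bar>h\<bar> \<and> \<bar>h\<bar> < inverse (real (Suc m))"]) (auto intro: le_less_trans)
  qed
qed

text \<open>By the Cauchy criterion for difference quotients the points of differentiability form a countable
  intersection of countable unions of closed sets.\<close>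
lemma pred_borel_differentiable:
  fixes f :: "real \<Rightarrow> 'a::banach"
  assumes f: "continuous_on UNIV f"
  shows "Measurable.pred borel (\<lambda>x. f differentiable (at x))"
proof -
  define Q where "Q x h = (f (x + h) - f x) /\<^sub>R h" for x h
  define near_0 where "near_0 m h \<longleftrightarrow> 0 < \<bar>h\<bar> \<and> \<bar>h\<bar> < inverse (real (Suc m))" for m and h :: real
  have "f differentiable (at x) \<longleftrightarrow> cauchy_filter (filtermap (Q x) (at 0))" for x
    using ex_tendsto_iff_cauchy_filter[of "at 0" "Q x"] differentiableI_vector
      vector_derivative_works[of f "at x"]
    unfolding Q_def has_vector_derivative_iff_quotient_tendsto[symmetric] by auto
  then have differentiable_iff: "f differentiable (at x) \<longleftrightarrow>
      (\<forall>n. \<exists>m. \<forall>h k. near_0 m h \<and> near_0 m k \<longrightarrow> dist (Q x h) (Q x k) \<le> inverse (real (Suc n)))" for x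
    by (simp only: cauchy_filter_at_0_iff near_0_def conj_assoc)
  have "closed {x. \<forall>h k. near_0 m h \<and> near_0 m k \<longrightarrow> dist (Q x h) (Q x k) \<le> inverse (real (Suc n))}" for m n
    unfolding Q_def
    by (intro closed_Collect_all closed_Collect_imp open_Collect_const closed_Collect_le continuous_intros
        continuous_on_compose2[OF f]) auto
  then have [measurable]: "Measurable.pred borel (\<lambda>x. \<forall>h k. near_0 m h \<and> near_0 m k \<longrightarrow>
      dist (Q x h) (Q x k) \<le> inverse (real (Suc n)))" for m n
    by (simp add: pred_def borel_closed)
  show ?thesis unfolding differentiable_iff by measurable
qed

lemma borel_measurable_vector_derivative:
  fixes f :: "real \<Rightarrow> 'a::{banach, second_countable_topology}"
  assumes f: "continuous_on UNIV f"
  shows "(\<lambda>x. vector_derivative f (at x)) \<in> borel_measurable borel"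
proof -
  define Q where "Q n x = (f (x + inverse (real (Suc n))) - f x) /\<^sub>R inverse (real (Suc n))" for n x
  note [measurable] = pred_borel_differentiable[OF f]
  have [measurable]: "Q n \<in> borel_measurable borel" for n
    unfolding Q_def by (intro borel_measurable_continuous_onI continuous_intros continuous_on_compose2[OF f]) auto
  have "vector_derivative f (at x) = (if f differentiable (at x) then lim (\<lambda>n. Q n x) else (SOME d. False))" for x
  proof (cases "f differentiable (at x)")
    case True
    then have "((\<lambda>h. (f (x + h) - f x) /\<^sub>R h) \<longlongrightarrow> vector_derivative f (at x)) (at 0)"
      by (simp add: vector_derivative_works flip: has_vector_derivative_iff_quotient_tendsto)
    moreover have "filterlim (\<lambda>n. inverse (real (Suc n))) (at 0) sequentially"
      unfolding filterlim_at using LIMSEQ_inverse_real_of_nat by (simp del: of_nat_Suc)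
    ultimately have "(\<lambda>n. Q n x) \<longlonglongrightarrow> vector_derivative f (at x)"
      unfolding Q_def by (rule filterlim_compose)
    then show ?thesis using True limI by metis
  next
    case False
    then have "\<And>d. \<not> (f has_vector_derivative d) (at x)" using differentiableI_vector by blast
    then show ?thesis using False unfolding vector_derivative_def by simp
  qed
  then show ?thesis by simp
qed

lemma set_borel_measurable_vector_derivative_Icc:
  fixes f :: "real \<Rightarrow> 'a::{banach, second_countable_topology}"
  assumes f: "continuous_on {a..b} f"
  shows "set_borel_measurable lborel {a..b} (\<lambda>x. vector_derivative f (at x))"
proof (cases "a \<le> b")
  case True
  define g where "g x = f (max a (min b x))" for x
  have "continuous_on UNIV g"
    unfolding g_def using True by (intro continuous_on_compose2[OF f] continuous_intros) auto
  then have [measurable]: "(\<lambda>x. vector_derivative g (at x)) \<in> borel_measurable borel"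
    by (rule borel_measurable_vector_derivative)
  have "(f has_vector_derivative d) (at x) \<longleftrightarrow> (g has_vector_derivative d) (at x)" if "x \<in> {a<..<b}" for x d
    using has_vector_derivative_transform_within_open[of f d x "{a<..<b}" g]
      has_vector_derivative_transform_within_open[of g d x "{a<..<b}" f] that by (auto simp: g_def)
  then have "vector_derivative f (at x) = vector_derivative g (at x)" if "x \<in> {a<..<b}" for x
    using that by (simp add: vector_derivative_def)
  then have "(\<lambda>x. indicator {a..b} x *\<^sub>R vector_derivative f (at x)) =
     (\<lambda>x. if x = a then vector_derivative f (at a) else if x = b then vector_derivative f (at b)
        else indicator {a<..<b} x *\<^sub>R vector_derivative g (at x))"
    using True by (auto simp: fun_eq_iff indicator_def)
  then show ?thesis unfolding set_borel_measurable_def by simp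
qed (simp add: set_borel_measurable_def)

subsection \<open>The fundamental theorem\<close>

theorem abs_continuous_on_has_vector_derivative_AE:
  fixes f :: "real \<Rightarrow> 'a::euclidean_space"
  assumes "a < b" "abs_continuous_on a b f"
  shows "AE x\<in>{a..b} in lborel. (f has_vector_derivative vector_derivative f (at x)) (at x)"
proof -
  obtain h where "set_integrable lborel {a..b} h" "\<And>x. x \<in> {a..b} \<Longrightarrow> f x = f a + (LINT t:{a..x}|lborel. h t)"
    using abs_continuous_on_has_density[OF assms] by metis
  then have "AE x\<in>{a..b} in lborel. (f has_vector_derivative h x) (at x)"
    by (rule indefinite_integral_has_vector_derivative_AE)
  then show ?thesis
    by eventually_elim (auto simp: vector_derivative_at)
qed

theorem abs_continuous_on_FTC:
  fixes f :: "real \<Rightarrow> 'a::euclidean_space"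
  assumes "a < b" "abs_continuous_on a b f"
    and derivative: "AE x\<in>{a..b} in lborel. (f has_vector_derivative h x) (at x)"
    and h: "set_borel_measurable lborel {a..b} h"
  shows "set_integrable lborel {a..b} h"
    and "x \<in> {a..b} \<Longrightarrow> f x = f a + (LINT t:{a..x}|lborel. h t)"
proof -
  obtain k where k: "set_integrable lborel {a..b} k"
    "\<And>x. x \<in> {a..b} \<Longrightarrow> f x = f a + (LINT t:{a..x}|lborel. k t)"
    using abs_continuous_on_has_density[OF assms(1,2)] by metis
  then have "AE x\<in>{a..b} in lborel. (f has_vector_derivative k x) (at x)"
    by (rule indefinite_integral_has_vector_derivative_AE)
  with derivative have k_eq_h: "AE x\<in>{a..b} in lborel. k x = h x"
    by eventually_elim (auto dest: vector_derivative_unique_at)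
  show integrable: "set_integrable lborel {a..b} h"
    by (rule set_integrable_cong_AE_on[OF k(1) h k_eq_h])
  assume x: "x \<in> {a..b}"
  have "(LINT t:{a..x}|lborel. k t) = (LINT t:{a..x}|lborel. h t)"
  proof (rule set_integral_cong_AE_on)
    show "AE t\<in>{a..x} in lborel. k t = h t" using k_eq_h by eventually_elim (use x in auto)
  qed (use x in \<open>auto intro!: set_integrable_imp_set_borel_measurable
      set_integrable_Icc_subset[OF k(1)] set_integrable_Icc_subset[OF integrable]\<close>)
  with k(2)[OF x] show "f x = f a + (LINT t:{a..x}|lborel. h t)" by simp
qed

section \<open>Linear systems with integrable coefficients\<close>

lemma continuous_on_Icc_imp_set_borel_measurable:
  fixes f :: "real \<Rightarrow> 'a::{banach, second_countable_topology}"
  shows "continuous_on {a..b} f \<Longrightarrow> set_borel_measurable lborel {a..b} f"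
  by (intro set_integrable_imp_set_borel_measurable borel_integrable_atLeastAtMost')

lemma set_borel_measurable_bilinear:
  fixes prod :: "'a::{real_normed_vector, second_countable_topology} \<Rightarrow> 'b::{real_normed_vector, second_countable_topology}
    \<Rightarrow> 'c::real_normed_vector"
  assumes bilinear: "bounded_bilinear prod"
    and f: "set_borel_measurable M A f" and g: "set_borel_measurable M A g"
  shows "set_borel_measurable M A (\<lambda>x. prod (f x) (g x))"
proof -
  have "(\<lambda>x. prod (indicator A x *\<^sub>R f x) (indicator A x *\<^sub>R g x)) \<in> borel_measurable M"
    using f g unfolding set_borel_measurable_def
    by (intro borel_measurable_continuous_Pair[where H = prod] bounded_bilinear.continuous_on[OF bilinear]
        continuous_on_fst continuous_on_snd continuous_on_id)
  moreover have "prod (indicator A x *\<^sub>R f x) (indicator A x *\<^sub>R g x) = indicator A x *\<^sub>R prod (f x) (g x)" for x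
    by (simp add: bounded_bilinear.zero_left[OF bilinear] indicator_def)
  ultimately show ?thesis by (simp add: set_borel_measurable_def)
qed

lemma set_integrable_bilinear_continuous:
  fixes prod :: "'a::{banach, second_countable_topology} \<Rightarrow> 'b::{banach, second_countable_topology}
    \<Rightarrow> 'c::{banach, second_countable_topology}" and f :: "real \<Rightarrow> 'a"
  assumes bilinear: "bounded_bilinear prod" and f: "continuous_on {a..b} f" and k: "set_integrable lborel {a..b} k"
  shows "set_integrable lborel {a..b} (\<lambda>x. prod (f x) (k x))"
proof -
  obtain K where K: "0 < K" "\<And>u w. norm (prod u w) \<le> norm u * norm w * K"
    using bounded_bilinear.pos_bounded[OF bilinear] by blast
  obtain C where C: "0 \<le> C" "\<And>x. x \<in> {a..b} \<Longrightarrow> norm (f x) \<le> C"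
    using continuous_on_Icc_norm_bounded[OF f] by metis
  show ?thesis
  proof (rule set_integrable_bound)
    show "set_integrable lborel {a..b} (\<lambda>x. C * K * norm (k x))"
      by (intro set_integrable_mult_right set_integrable_norm k)
    show "set_borel_measurable lborel {a..b} (\<lambda>x. prod (f x) (k x))"
      by (intro set_borel_measurable_bilinear[OF bilinear] continuous_on_Icc_imp_set_borel_measurable f
          set_integrable_imp_set_borel_measurable k)
    have "norm (prod (f x) (k x)) \<le> norm (C * K * norm (k x))" if "x \<in> {a..b}" for x
    proof -
      have "norm (prod (f x) (k x)) \<le> norm (f x) * norm (k x) * K" by (rule K(2))
      also have "\<dots> \<le> C * norm (k x) * K" using C(2)[OF that] K(1) by (intro mult_right_mono) auto
      also have "\<dots> \<le> norm (C * K * norm (k x))" by (simp add: ac_simps)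
      finally show ?thesis .
    qed
    then show "AE x in lborel. x \<in> {a..b} \<longrightarrow> norm (prod (f x) (k x)) \<le> norm (C * K * norm (k x))" by simp
  qed
qed

subsection \<open>Existence of Caratheodory solutions\<close>

lemma exp_diff_le: "exp y - exp x \<le> exp y * (y - x)" for x y :: real
proof -
  have "exp y * (1 + (x - y)) \<le> exp y * exp (x - y)"
    by (intro mult_left_mono exp_ge_add_one_self) simp
  then show ?thesis by (simp add: algebra_simps flip: exp_add)
qed

lemma LINT_exp_indefinite_integral:
  fixes g G :: "real \<Rightarrow> real"
  assumes "a < b" and g: "set_integrable lborel {a..b} g" and nonneg: "\<And>t. t \<in> {a..b} \<Longrightarrow> 0 \<le> g t"
    and G: "\<And>x. x \<in> {a..b} \<Longrightarrow> G x = (LINT t:{a..x}|lborel. g t)"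
  shows "set_integrable lborel {a..b} (\<lambda>t. 2 * (g t * exp (2 * G t)))"
    and "x \<in> {a..b} \<Longrightarrow> exp (2 * G x) = 1 + (LINT t:{a..x}|lborel. 2 * (g t * exp (2 * G t)))"
proof -
  let ?E = "\<lambda>t. exp (2 * G t)"
  have mono: "G s \<le> G t" if "a \<le> s" "s \<le> t" "t \<le> b" for s t
    using LINT_Icc_combine[OF set_integrable_Icc_subset[OF g], of a t s] LINT_Icc_nonneg[of s t g] nonneg that
    by (simp add: G)
  have G_abs_continuous: "abs_continuous_on a b G"
    using g by (rule indefinite_integral_abs_continuous_on[of _ _ _ _ 0]) (simp add: G)
  have G_derivative: "AE t\<in>{a..b} in lborel. (G has_vector_derivative g t) (at t)"
    using g by (rule indefinite_integral_has_vector_derivative_AE[of _ _ _ _ 0]) (simp add: G)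
  have E_abs_continuous: "abs_continuous_on a b ?E"
  proof (rule abs_continuous_on_lipschitz_image[OF G_abs_continuous, of "2 * ?E b"])
    fix s t assume st: "a \<le> s" "s \<le> t" "t \<le> b"
    have "?E t - ?E s \<le> ?E t * (2 * G t - 2 * G s)" by (rule exp_diff_le)
    also have "\<dots> \<le> ?E b * (2 * G t - 2 * G s)"
      using mono[of s t] mono[of t b] st by (intro mult_right_mono) auto
    finally show "norm (?E t - ?E s) \<le> 2 * ?E b * norm (G t - G s)"
      using mono[OF st] by (simp add: algebra_simps)
  qed simp
  have E_derivative: "AE t\<in>{a..b} in lborel. (?E has_vector_derivative 2 * (g t * ?E t)) (at t)"
    using G_derivative
    by eventually_elim (auto intro!: derivative_eq_intros
        simp flip: has_real_derivative_iff_has_vector_derivative)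
  have E_measurable: "set_borel_measurable lborel {a..b} (\<lambda>t. 2 * (g t * ?E t))"
  proof -
    have "continuous_on {a..b} ?E"
      by (intro continuous_intros abs_continuous_on_imp_continuous_on G_abs_continuous)
    from set_integrable_bilinear_continuous[OF bounded_bilinear_mult this g]
    have "set_integrable lborel {a..b} (\<lambda>t. 2 * (?E t * g t))" by (rule set_integrable_mult_right)
    then show ?thesis by (simp add: set_integrable_imp_set_borel_measurable ac_simps)
  qed
  note FTC = abs_continuous_on_FTC[OF \<open>a < b\<close> E_abs_continuous E_derivative E_measurable]
  show "set_integrable lborel {a..b} (\<lambda>t. 2 * (g t * ?E t))" by (fact FTC(1))
  have "G a = 0" using \<open>a < b\<close> G[of a] LINT_singleton by simp
  then show "?E x = 1 + (LINT t:{a..x}|lborel. 2 * (g t * ?E t))" if "x \<in> {a..b}"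
    using FTC(2)[OF that] by (simp only: mult_zero_right exp_zero)
qed

context
  fixes a b :: real and F :: "real \<Rightarrow> 'a::euclidean_space \<Rightarrow> 'a" and g :: "real \<Rightarrow> real"
  assumes nonempty: "a < b"
    and g: "set_integrable lborel {a..b} g" "\<And>t. t \<in> {a..b} \<Longrightarrow> 0 \<le> g t"
    and integrable: "\<And>u. continuous_on {a..b} u \<Longrightarrow> set_integrable lborel {a..b} (\<lambda>t. F t (u t))"
    and lipschitz: "\<And>t u w. t \<in> {a..b} \<Longrightarrow> norm (F t u - F t w) \<le> g t * norm (u - w)"
begin

text \<open>Dividing by this weight turns the Picard operator into a contraction on the whole interval.\<close>
definition picard_weight :: "real \<Rightarrow> real" where
  "picard_weight x = exp (2 * (LINT t:{a..x}|lborel. g t))"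

definition weighted_picard :: "'a \<Rightarrow> (real \<Rightarrow> 'a) \<Rightarrow> real \<Rightarrow> 'a" where
  "weighted_picard c u x = (c + (LINT t:{a..x}|lborel. F t (picard_weight t *\<^sub>R u t))) /\<^sub>R picard_weight x"

lemma picard_weight_pos: "0 < picard_weight x"
  by (simp add: picard_weight_def)

lemma picard_weight_integral:
  shows "set_integrable lborel {a..b} (\<lambda>t. 2 * (g t * picard_weight t))"
    and "x \<in> {a..b} \<Longrightarrow> picard_weight x = 1 + (LINT t:{a..x}|lborel. 2 * (g t * picard_weight t))"
  using LINT_exp_indefinite_integral[OF nonempty g, of "\<lambda>x. LINT t:{a..x}|lborel. g t"]
  unfolding picard_weight_def by blast+

lemma continuous_on_picard_weight: "continuous_on {a..b} picard_weight"
proof -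
  have "abs_continuous_on a b (\<lambda>x. LINT t:{a..x}|lborel. g t)"
    by (rule indefinite_integral_abs_continuous_on[OF g(1), of _ 0]) simp
  then show ?thesis
    unfolding picard_weight_def by (intro continuous_intros abs_continuous_on_imp_continuous_on)
qed

lemma continuous_on_weighted_picard:
  assumes "continuous_on {a..b} u"
  shows "continuous_on {a..b} (weighted_picard c u)"
proof -
  have "set_integrable lborel {a..b} (\<lambda>t. F t (picard_weight t *\<^sub>R u t))"
    by (intro integrable continuous_intros continuous_on_picard_weight assms)
  then have "abs_continuous_on a b (\<lambda>x. LINT t:{a..x}|lborel. F t (picard_weight t *\<^sub>R u t))"
    by (rule indefinite_integral_abs_continuous_on[of _ _ _ _ 0]) simp
  then show ?thesis
    unfolding weighted_picard_def
    by (intro continuous_intros continuous_on_picard_weight abs_continuous_on_imp_continuous_on)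
       (use picard_weight_pos in \<open>auto simp: less_le\<close>)
qed

lemma weighted_picard_contraction:
  assumes u: "continuous_on {a..b} u" and w: "continuous_on {a..b} w"
    and dist: "\<And>t. t \<in> {a..b} \<Longrightarrow> dist (u t) (w t) \<le> d" and x: "x \<in> {a..b}"
  shows "dist (weighted_picard c u x) (weighted_picard c w x) \<le> d / 2"
proof -
  let ?E = picard_weight and ?f = "\<lambda>u t. F t (picard_weight t *\<^sub>R u t)"
  have f: "set_integrable lborel {a..x} (?f u)" if "continuous_on {a..b} u" for u
    using x by (intro set_integrable_Icc_subset[OF integrable] continuous_intros continuous_on_picard_weight that) auto
  have "0 \<le> d" using dist[OF x] zero_le_dist order_trans by blast
  have "norm ((LINT t:{a..x}|lborel. ?f u t) - (LINT t:{a..x}|lborel. ?f w t))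
      = norm (LINT t:{a..x}|lborel. ?f u t - ?f w t)"
    using set_integral_diff(2)[OF f[OF u] f[OF w]] by simp
  also have "\<dots> \<le> (LINT t:{a..x}|lborel. norm (?f u t - ?f w t))"
    by (intro set_integral_norm_bound set_integral_diff f u w)
  also have "\<dots> \<le> (LINT t:{a..x}|lborel. d / 2 * (2 * (g t * ?E t)))"
  proof (rule set_integral_mono)
    show "set_integrable lborel {a..x} (\<lambda>t. d / 2 * (2 * (g t * ?E t)))"
      using x by (intro set_integrable_mult_right set_integrable_Icc_subset[OF picard_weight_integral(1)]) auto
    fix t assume "t \<in> {a..x}"
    then have t: "t \<in> {a..b}" using x by auto
    have "norm (?f u t - ?f w t) \<le> g t * (?E t * dist (u t) (w t))"
      using lipschitz[OF t, of "?E t *\<^sub>R u t" "?E t *\<^sub>R w t"] picard_weight_pos[of t]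
      by (simp add: dist_norm flip: scaleR_diff_right)
    also have "\<dots> \<le> g t * (?E t * d)"
      using g(2)[OF t] picard_weight_pos[of t] dist[OF t] by (intro mult_left_mono) auto
    finally show "norm (?f u t - ?f w t) \<le> d / 2 * (2 * (g t * ?E t))" by (simp add: ac_simps)
  qed (intro set_integrable_norm set_integral_diff f u w)
  also have "\<dots> \<le> d / 2 * ?E x"
    using \<open>0 \<le> d\<close> picard_weight_integral(2)[OF x] unfolding set_integral_mult_right by (intro mult_left_mono) auto
  finally have "norm ((LINT t:{a..x}|lborel. ?f u t) - (LINT t:{a..x}|lborel. ?f w t)) \<le> d / 2 * ?E x" .
  moreover have "weighted_picard c u x - weighted_picard c w x
      = ((LINT t:{a..x}|lborel. ?f u t) - (LINT t:{a..x}|lborel. ?f w t)) /\<^sub>R ?E x"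
    by (simp add: weighted_picard_def flip: scaleR_diff_right)
  ultimately show ?thesis
    using picard_weight_pos[of x] by (simp add: dist_norm pos_divide_le_eq mult.commute flip: divide_inverse_commute)
qed

theorem caratheodory_solution_exists:
  obtains y where "continuous_on {a..b} y"
    "\<And>x. x \<in> {a..b} \<Longrightarrow> y x = c + (LINT t:{a..x}|lborel. F t (y t))"
proof -
  have clamp: "clamp a b x \<in> {a..b}" "x \<in> {a..b} \<Longrightarrow> clamp a b x = x" for x
    using clamp_in_interval[of a b x] clamp_cancel_cbox[of x a b] nonempty by (auto simp: cbox_interval)
  have cont: "continuous_on {a..b} (apply_bcontfun u)" for u :: "real \<Rightarrow>\<^sub>C 'a"
    using apply_bcontfun[of u] by (auto simp: bcontfun_def intro: continuous_on_subset)
  define T where "T u = Bcontfun (\<lambda>x. weighted_picard c (apply_bcontfun u) (clamp a b x))" for u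
  have apply_T: "apply_bcontfun (T u) x = weighted_picard c (apply_bcontfun u) (clamp a b x)" for u x
  proof -
    have "continuous_on (cbox a b) (weighted_picard c (apply_bcontfun u))"
      using continuous_on_weighted_picard[OF cont] by (simp add: cbox_interval)
    then have "(\<lambda>x. weighted_picard c (apply_bcontfun u) (clamp a b x)) \<in> bcontfun"
      unfolding bcontfun_def mem_Collect_eq
      by (intro conjI clamp_continuous_on clamp_bounded compact_imp_bounded compact_continuous_image compact_cbox)
    then show ?thesis unfolding T_def by (simp add: Bcontfun_inverse)
  qed
  have "dist (T u) (T w) \<le> 1/2 * dist u w" for u w
  proof (rule dist_bound)
    fix x show "dist (T u x) (T w x) \<le> 1/2 * dist u w"
      unfolding apply_T
      using weighted_picard_contraction[OF cont cont dist_bounded clamp(1)] by simp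
  qed
  then obtain u where u: "T u = u"
    using banach_fix_type[of "1/2" T] by auto
  define y where "y x = picard_weight x *\<^sub>R u x" for x
  show thesis
  proof (rule that)
    show "continuous_on {a..b} y"
      unfolding y_def by (intro continuous_intros continuous_on_picard_weight cont)
    fix x assume "x \<in> {a..b}"
    then have "u x = weighted_picard c u x" using apply_T[of u x] by (simp add: u clamp(2))
    then show "y x = c + (LINT t:{a..x}|lborel. F t (y t))"
      using picard_weight_pos[of x] by (simp add: y_def weighted_picard_def)
  qed
qed

end

section \<open>The Dirac system on an edge\<close>

definition dotp :: "complex \<times> complex \<Rightarrow> complex \<times> complex \<Rightarrow> complex" where
  "dotp u w = fst u * fst w + snd u * snd w"

definition Jmult :: "complex \<times> complex \<Rightarrow> complex \<times> complex" where
  "Jmult u = (- snd u, fst u)"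

definition cnj_pair :: "complex \<times> complex \<Rightarrow> complex \<times> complex" where
  "cnj_pair u = (cnj (fst u), cnj (snd u))"

definition wronskian :: "complex \<times> complex \<Rightarrow> complex \<times> complex \<Rightarrow> complex" where
  "wronskian u w = dotp (Jmult u) w"

lemma addp_eq_plus [simp]: "addp u w = u + w"
  by (simp add: addp_def prod_eq_iff)

lemma subp_eq_minus [simp]: "subp u w = u - w"
  by (simp add: subp_def prod_eq_iff)

lemma fst_cs [simp]: "fst (cs c u) = c * fst u" and snd_cs [simp]: "snd (cs c u) = c * snd u"
  by (simp_all add: cs_def)

lemma fst_Jmult [simp]: "fst (Jmult u) = - snd u" and snd_Jmult [simp]: "snd (Jmult u) = fst u"
  by (simp_all add: Jmult_def)

lemma fst_cnj_pair [simp]: "fst (cnj_pair u) = cnj (fst u)" and snd_cnj_pair [simp]: "snd (cnj_pair u) = cnj (snd u)"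
  by (simp_all add: cnj_pair_def)

lemma wronskian_eq: "wronskian u w = fst u * snd w - snd u * fst w"
  by (simp add: wronskian_def dotp_def)

lemma wronskian_antisymmetric: "wronskian u w = - wronskian w u"
  by (simp add: wronskian_eq)

lemma wronskian_expansion: "cs (wronskian u w) f = cs (wronskian f w) u + cs (wronskian u f) w"
  by (simp add: prod_eq_iff wronskian_eq algebra_simps)

lemma dotp_commute: "dotp u w = dotp w u"
  by (simp add: dotp_def mult.commute)

lemma norm_cs: "norm (cs c u) = cmod c * norm u"
  by (simp add: norm_prod_def norm_mult power_mult_distrib real_sqrt_mult flip: distrib_left)

lemma norm_cnj_pair [simp]: "norm (cnj_pair u) = norm u"
  by (simp add: norm_prod_def)

lemma dotp_cnj_pair_self: "dotp u (cnj_pair u) = of_real ((norm u)\<^sup>2)"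
  by (simp add: dotp_def norm_prod_def flip: complex_norm_square)

lemma norm_dotp_le: "cmod (dotp u w) \<le> norm u * norm w"
proof -
  have "cmod (dotp u w) \<le> (cmod (fst u), cmod (snd u)) \<bullet> (cmod (fst w), cmod (snd w))"
    unfolding dotp_def by (simp add: inner_prod_def norm_triangle_le norm_mult)
  also have "\<dots> \<le> norm (cmod (fst u), cmod (snd u)) * norm (cmod (fst w), cmod (snd w))"
    by (rule norm_cauchy_schwarz)
  finally show ?thesis by (simp add: norm_prod_def)
qed

lemma bounded_bilinear_dotp: "bounded_bilinear dotp"
  by standard (auto simp: dotp_def algebra_simps intro!: exI[of _ 1] norm_dotp_le[unfolded dotp_def, of "(_, _)" "(_, _)", simplified])

lemma bounded_bilinear_cs: "bounded_bilinear cs"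
  by standard (auto simp: prod_eq_iff algebra_simps norm_cs intro!: exI[of _ 1])

lemma bounded_linear_Jmult: "bounded_linear Jmult"
  by (rule bounded_linear_intro[of _ 1]) (auto simp: prod_eq_iff norm_prod_def)

lemma bounded_linear_cnj_pair: "bounded_linear cnj_pair"
  by (rule bounded_linear_intro[of _ 1]) (auto simp: prod_eq_iff)

interpretation dotp: bounded_bilinear dotp by (rule bounded_bilinear_dotp)
interpretation cs: bounded_bilinear cs by (rule bounded_bilinear_cs)

lemmas Jmult_linear = linear_simps[OF bounded_linear_Jmult]
lemmas cnj_pair_linear = linear_simps[OF bounded_linear_cnj_pair]

lemma cs_simps [simp]: "cs 0 u = 0" "cs 1 u = u" "cs c (cs d u) = cs (c * d) u" "cs (- c) u = - cs c u" "cs c (- u) = - cs c u"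
  by (simp_all add: prod_eq_iff)

lemma dotp_cs [simp]: "dotp (cs c u) w = c * dotp u w" "dotp u (cs c w) = c * dotp u w"
  by (simp_all add: dotp_def algebra_simps)

lemma Jmult_cs: "Jmult (cs c u) = cs c (Jmult u)"
  by (simp add: prod_eq_iff)

lemma cnj_pair_cs [simp]: "cnj_pair (cs c u) = cs (cnj c) (cnj_pair u)"
  by (simp add: prod_eq_iff)

lemma wronskian_cs [simp]: "wronskian (cs c u) w = c * wronskian u w" "wronskian u (cs c w) = c * wronskian u w"
  by (simp_all add: wronskian_def Jmult_cs)

lemma wronskian_Jmult: "wronskian u (Jmult w) = dotp u w" "wronskian (Jmult u) w = - dotp u w"
  by (simp_all add: wronskian_eq dotp_def)

lemma wronskian_self [simp]: "wronskian u u = 0"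
  by (simp add: wronskian_eq)

interpretation wronskian: bounded_bilinear wronskian
  unfolding wronskian_def by (rule bounded_bilinear.comp1[OF bounded_bilinear_dotp bounded_linear_Jmult])

lemma norm_Jmult [simp]: "norm (Jmult u) = norm u"
  by (simp add: norm_prod_def add.commute)

lemma set_integrable_bounded_linear:
  fixes T :: "'a::{banach, second_countable_topology} \<Rightarrow> 'b::{banach, second_countable_topology}"
  assumes "bounded_linear T" "set_integrable M A f"
  shows "set_integrable M A (\<lambda>x. T (f x))"
  using integrable_bounded_linear[OF assms(1) assms(2)[unfolded set_integrable_def]]
  by (simp add: set_integrable_def linear_simps assms(1))

lemma set_integrable_dotp:
  fixes f k :: "real \<Rightarrow> complex \<times> complex"
  assumes "continuous_on {a..b} f" "set_integrable lborel {a..b} k"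
  shows "set_integrable lborel {a..b} (\<lambda>x. dotp (f x) (k x))" "set_integrable lborel {a..b} (\<lambda>x. dotp (k x) (f x))"
  using set_integrable_bilinear_continuous[OF bounded_bilinear_dotp assms]
    set_integrable_bilinear_continuous[OF bounded_bilinear.flip[OF bounded_bilinear_dotp] assms] by simp_all

locale star =
  fixes v :: real and vj :: "'n::finite \<Rightarrow> real"
    and p q :: "'n \<Rightarrow> real \<Rightarrow> real" and \<alpha> :: "'n \<Rightarrow> real"
  assumes edges: "v < vj j"
    and p_L1: "set_integrable lborel {v..vj j} (p j)"
    and q_L1: "set_integrable lborel {v..vj j} (q j)"
begin

definition potential :: "'n \<Rightarrow> real \<Rightarrow> complex \<times> complex \<Rightarrow> complex \<times> complex" where
  "potential j x u = (of_real (p j x) * fst u + of_real (q j x) * snd u, of_real (q j x) * fst u - of_real (p j x) * snd u)"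

abbreviation dirac :: "'n \<Rightarrow> (real \<Rightarrow> complex \<times> complex) \<Rightarrow> real \<Rightarrow> complex \<times> complex" where
  "dirac j f \<equiv> Hop p q (\<lambda>_. f) j"

abbreviation edge_abs_continuous :: "'n \<Rightarrow> (real \<Rightarrow> complex \<times> complex) \<Rightarrow> bool" where
  "edge_abs_continuous j \<equiv> abs_continuous_on v (vj j)"

abbreviation edge_integrable :: "'n \<Rightarrow> (real \<Rightarrow> complex \<times> complex) \<Rightarrow> bool" where
  "edge_integrable j \<equiv> set_integrable lborel {v..vj j}"

definition solves :: "'n \<Rightarrow> complex \<Rightarrow> (real \<Rightarrow> complex \<times> complex) \<Rightarrow> (real \<Rightarrow> complex \<times> complex) \<Rightarrow> bool" where
  "solves j z k f \<longleftrightarrow> edge_abs_continuous j f \<and> (AE x\<in>{v..vj j} in lborel. dirac j f x = k x + cs z (f x))"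

lemma Hop_eq_dirac: "Hop p q f j = dirac j (f j)"
  by (simp add: Hop_def)

lemma dotp_potential: "dotp (potential j x u) w = dotp u (potential j x w)"
  by (simp add: dotp_def potential_def algebra_simps)

lemma cnj_pair_potential: "cnj_pair (potential j x u) = potential j x (cnj_pair u)"
  by (simp add: potential_def cnj_pair_def)

lemma linear_potential: "potential j x (u + w) = potential j x u + potential j x w"
    "potential j x (u - w) = potential j x u - potential j x w" "potential j x (cs c u) = cs c (potential j x u)"
  by (simp_all add: potential_def prod_eq_iff algebra_simps)

lemma norm_potential_le: "norm (potential j x u) \<le> (\<bar>p j x\<bar> + \<bar>q j x\<bar>) * norm u"
proof -
  have "potential j x u = cs (of_real (p j x)) (fst u, - snd u) + cs (of_real (q j x)) (snd u, fst u)"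
    by (simp add: potential_def prod_eq_iff)
  also have "norm \<dots> \<le> \<bar>p j x\<bar> * norm (fst u, - snd u) + \<bar>q j x\<bar> * norm (snd u, fst u)"
    by (rule order_trans[OF norm_triangle_ineq]) (simp add: norm_cs)
  finally show ?thesis by (simp add: norm_prod_def add.commute algebra_simps)
qed

lemma edge_integrable_potential:
  assumes "continuous_on {v..vj j} u"
  shows "edge_integrable j (\<lambda>x. potential j x (u x))"
proof -
  have scaleR: "set_integrable lborel {v..vj j} (\<lambda>x. r x *\<^sub>R w x)"
    if "set_integrable lborel {v..vj j} r" "continuous_on {v..vj j} w" for r :: "real \<Rightarrow> real" and w :: "real \<Rightarrow> complex \<times> complex"
    using set_integrable_bilinear_continuous[OF bounded_bilinear.flip[OF bounded_bilinear_scaleR] that(2,1)] .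
  have "edge_integrable j (\<lambda>x. p j x *\<^sub>R (fst (u x), - snd (u x)) + q j x *\<^sub>R (snd (u x), fst (u x)))"
    by (intro set_integral_add scaleR p_L1 q_L1 continuous_intros assms)
  then show ?thesis
    by (simp add: potential_def scaleR_conv_of_real)
qed

lemma dirac_eq_iff_derivative:
  assumes "(f has_vector_derivative vector_derivative f (at x)) (at x)"
  shows "dirac j f x = h \<longleftrightarrow> (f has_vector_derivative Jmult (h - potential j x (f x))) (at x)"
proof -
  let ?D = "vector_derivative f (at x)"
  have "vector_derivative (\<lambda>t. fst (f t)) (at x) = fst ?D" "vector_derivative (\<lambda>t. snd (f t)) (at x) = snd ?D"
    by (intro vector_derivative_at bounded_linear.has_vector_derivative[OF bounded_linear_fst assms]
        bounded_linear.has_vector_derivative[OF bounded_linear_snd assms])+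
  then have "?D = Jmult (dirac j f x - potential j x (f x))"
    by (simp add: Hop_def potential_def prod_eq_iff)
  then have "dirac j f x = h \<longleftrightarrow> ?D = Jmult (h - potential j x (f x))"
    by (simp add: prod_eq_iff conj_commute)
  then show ?thesis using assms vector_derivative_at by metis
qed

lemma dirac_has_vector_derivative_AE:
  assumes "edge_abs_continuous j f"
  shows "AE x\<in>{v..vj j} in lborel. (f has_vector_derivative Jmult (dirac j f x - potential j x (f x))) (at x)"
  using abs_continuous_on_has_vector_derivative_AE[OF edges assms]
  by eventually_elim (simp flip: dirac_eq_iff_derivative)

lemma solves_iff_derivative:
  "solves j z k f \<longleftrightarrow> edge_abs_continuous j f
    \<and> (AE x\<in>{v..vj j} in lborel. (f has_vector_derivative Jmult (k x + cs z (f x) - potential j x (f x))) (at x))"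
proof (cases "edge_abs_continuous j f")
  case True
  have "(AE x\<in>{v..vj j} in lborel. dirac j f x = k x + cs z (f x))
    \<longleftrightarrow> (AE x\<in>{v..vj j} in lborel. (f has_vector_derivative Jmult (k x + cs z (f x) - potential j x (f x))) (at x))"
    using abs_continuous_on_has_vector_derivative_AE[OF edges True]
    by (intro eventually_subst, eventually_elim) (auto simp: dirac_eq_iff_derivative)
  with True show ?thesis by (simp add: solves_def)
qed (simp add: solves_def)

lemma edge_integrable_dirac:
  assumes "edge_abs_continuous j f"
  shows "edge_integrable j (dirac j f)"
proof -
  have integrable: "set_integrable lborel {v..vj j} (\<lambda>x. vector_derivative g (at x))"
    if "abs_continuous_on v (vj j) g" for g :: "real \<Rightarrow> complex"
    by (rule abs_continuous_on_FTC(1)[OF edges that abs_continuous_on_has_vector_derivative_AE[OF edges that]])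
       (intro set_borel_measurable_vector_derivative_Icc abs_continuous_on_imp_continuous_on that)
  let ?a = "\<lambda>x. vector_derivative (\<lambda>t. fst (f t)) (at x)" and ?b = "\<lambda>x. vector_derivative (\<lambda>t. snd (f t)) (at x)"
  have "edge_integrable j (\<lambda>x. (?b x, 0) + (0, - ?a x) + potential j x (f x))"
    by (intro set_integral_add edge_integrable_potential abs_continuous_on_imp_continuous_on assms
        set_integrable_bounded_linear[OF _ integrable[OF bounded_linear.abs_continuous_on[OF bounded_linear_snd assms]]]
        set_integrable_bounded_linear[OF _ integrable[OF bounded_linear.abs_continuous_on[OF bounded_linear_fst assms]]]
        bounded_linear_Pair bounded_linear_ident bounded_linear_zero bounded_linear_minus)
  moreover have "dirac j f x = (?b x, 0) + (0, - ?a x) + potential j x (f x)" for x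
    by (simp add: Hop_def potential_def prod_eq_iff)
  ultimately show ?thesis by presburger
qed

theorem lagrange_identity:
  assumes f: "edge_abs_continuous j f" and g: "edge_abs_continuous j g" and x: "x \<in> {v..vj j}"
  shows "wronskian (f x) (g x) = wronskian (f v) (g v)
    + (LINT t:{v..x}|lborel. dotp (f t) (dirac j g t) - dotp (dirac j f t) (g t))"
proof (rule abs_continuous_on_FTC(2)[OF edges _ _ _ x])
  let ?h = "\<lambda>t. dotp (f t) (dirac j g t) - dotp (dirac j f t) (g t)"
  show "abs_continuous_on v (vj j) (\<lambda>t. wronskian (f t) (g t))"
    by (rule wronskian.abs_continuous_on[OF f g])
  show "AE t\<in>{v..vj j} in lborel. ((\<lambda>t. wronskian (f t) (g t)) has_vector_derivative ?h t) (at t)"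
    using dirac_has_vector_derivative_AE[OF f] dirac_has_vector_derivative_AE[OF g]
  proof eventually_elim
    case (elim t)
    show ?case
    proof
      assume "t \<in> {v..vj j}"
      with elim have "((\<lambda>t. wronskian (f t) (g t)) has_vector_derivative
        wronskian (f t) (Jmult (dirac j g t - potential j t (g t)))
          + wronskian (Jmult (dirac j f t - potential j t (f t))) (g t)) (at t)"
        by (intro wronskian.has_vector_derivative) simp_all
      then show "((\<lambda>t. wronskian (f t) (g t)) has_vector_derivative ?h t) (at t)"
        by (simp add: wronskian_Jmult dotp.diff_left dotp.diff_right dotp_potential)
    qed
  qed
  have "edge_integrable j (dirac j f)" "edge_integrable j (dirac j g)"
    "continuous_on {v..vj j} f" "continuous_on {v..vj j} g"
    using f g by (simp_all add: edge_integrable_dirac abs_continuous_on_imp_continuous_on)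
  then show "set_borel_measurable lborel {v..vj j} ?h"
    by (intro set_integrable_imp_set_borel_measurable set_integral_diff set_integrable_dotp)
qed

lemma solves_wronskian:
  assumes u: "solves j z (\<lambda>_. 0) u" and f: "solves j z k f" and k: "edge_integrable j k" and x: "x \<in> {v..vj j}"
  shows "wronskian (u x) (f x) = wronskian (u v) (f v) + (LINT t:{v..x}|lborel. dotp (u t) (k t))"
proof -
  let ?h = "\<lambda>t. dotp (u t) (dirac j f t) - dotp (dirac j u t) (f t)"
  have abs_continuous: "edge_abs_continuous j u" "edge_abs_continuous j f"
    using u f by (simp_all add: solves_def)
  note continuous = abs_continuous[THEN abs_continuous_on_imp_continuous_on]
  have "set_integrable lborel {v..vj j} ?h"
    by (rule set_integral_diff(1)[OF set_integrable_dotp(1)[OF continuous(1)] set_integrable_dotp(2)[OF continuous(2)]])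
       (intro edge_integrable_dirac abs_continuous)+
  moreover have "set_integrable lborel {v..vj j} (\<lambda>t. dotp (u t) (k t))"
    by (rule set_integrable_dotp(1)[OF continuous(1) k])
  moreover have "AE t\<in>{v..x} in lborel. ?h t = dotp (u t) (k t)"
    using u[unfolded solves_def, THEN conjunct2] f[unfolded solves_def, THEN conjunct2]
    by eventually_elim (use x in \<open>auto simp: dotp.add_right\<close>)
  ultimately have "(LINT t:{v..x}|lborel. ?h t) = (LINT t:{v..x}|lborel. dotp (u t) (k t))"
    using x by (intro set_integral_cong_AE_on set_integrable_imp_set_borel_measurable)
      (auto elim: set_integrable_Icc_subset)
  with lagrange_identity[OF abs_continuous x] show ?thesis by simp
qed

lemma solves_homogeneous_exists:
  obtains f where "solves j z (\<lambda>_. 0) f" "f v = \<xi>"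
proof -
  let ?F = "\<lambda>x u. Jmult (cs z u - potential j x u)" and ?g = "\<lambda>x. cmod z + (\<bar>p j x\<bar> + \<bar>q j x\<bar>)"
  have integrable: "edge_integrable j (\<lambda>x. ?F x (u x))" if "continuous_on {v..vj j} u" for u
    by (intro set_integrable_bounded_linear[OF bounded_linear_Jmult] set_integral_diff edge_integrable_potential
        borel_integrable_atLeastAtMost' continuous_intros cs.continuous_on that)
  obtain f where f: "continuous_on {v..vj j} f"
    "\<And>x. x \<in> {v..vj j} \<Longrightarrow> f x = \<xi> + (LINT t:{v..x}|lborel. ?F t (f t))"
  proof (rule caratheodory_solution_exists[where F = ?F and g = ?g and c = \<xi>, OF edges])
    show "set_integrable lborel {v..vj j} ?g"
      by (intro set_integral_add set_integrable_abs p_L1 q_L1 set_integrable_const_Icc)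
    show "norm (?F t u - ?F t w) \<le> ?g t * norm (u - w)" for t u w
    proof -
      have "norm (?F t u - ?F t w) = norm (cs z (u - w) - potential j t (u - w))"
        by (simp add: cs.diff_right linear_potential algebra_simps flip: Jmult_linear)
      also have "\<dots> \<le> cmod z * norm (u - w) + (\<bar>p j t\<bar> + \<bar>q j t\<bar>) * norm (u - w)"
        by (rule order_trans[OF norm_triangle_ineq4]) (intro add_mono norm_potential_le, simp add: norm_cs)
      finally show ?thesis by (simp add: algebra_simps)
    qed
  qed (auto intro: integrable)
  have "solves j z (\<lambda>_. 0) f"
    using indefinite_integral_abs_continuous_on[OF integrable[OF f(1)] f(2)]
      indefinite_integral_has_vector_derivative_AE[OF integrable[OF f(1)] f(2)]
    by (simp add: solves_iff_derivative)
  moreover have "f v = \<xi>" using f(2)[of v] edges[of j] by simp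
  ultimately show thesis by (rule that)
qed

lemma solves_0_wronskian:
  assumes "solves j z (\<lambda>_. 0) u" "solves j z (\<lambda>_. 0) w" "x \<in> {v..vj j}"
  shows "wronskian (u x) (w x) = wronskian (u v) (w v)"
  unfolding solves_wronskian[OF assms(1,2) set_integrable_const_Icc assms(3)]
  by (simp add: set_lebesgue_integral_def dotp.zero_right)

lemma solves_unique:
  assumes f: "solves j z k f" and g: "solves j z k g" and "f v = g v" and k: "edge_integrable j k" and x: "x \<in> {v..vj j}"
  shows "f x = g x"
proof -
  obtain u where u: "solves j z (\<lambda>_. 0) u" "u v = (1, 0)" by (rule solves_homogeneous_exists)
  obtain w where w: "solves j z (\<lambda>_. 0) w" "w v = (0, 1)" by (rule solves_homogeneous_exists)
  have "wronskian (u x) (w x) = 1"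
    unfolding solves_0_wronskian[OF u(1) w(1) x] by (simp add: u w wronskian_eq)
  then have expansion: "h = cs (- wronskian (w x) h) (u x) + cs (wronskian (u x) h) (w x)" for h
    using wronskian_expansion[of "u x" "w x" h] wronskian_antisymmetric[of h "w x"] by simp
  have "wronskian (u x) (f x) = wronskian (u x) (g x)" "wronskian (w x) (f x) = wronskian (w x) (g x)"
    unfolding solves_wronskian[OF u(1) f k x] solves_wronskian[OF u(1) g k x]
      solves_wronskian[OF w(1) f k x] solves_wronskian[OF w(1) g k x] \<open>f v = g v\<close> by simp_all
  with expansion[of "f x"] expansion[of "g x"] show ?thesis by metis
qed

lemma solves_cong:
  assumes f: "solves j z k f" and eq: "\<And>x. x \<in> {v..vj j} \<Longrightarrow> f x = g x"
  shows "solves j z k g"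
  unfolding solves_iff_derivative
proof
  show "edge_abs_continuous j g"
    using f eq by (auto simp: solves_def intro: abs_continuous_on_cong)
  show "AE x\<in>{v..vj j} in lborel. (g has_vector_derivative Jmult (k x + cs z (g x) - potential j x (g x))) (at x)"
    using f[unfolded solves_iff_derivative, THEN conjunct2] AE_lborel_singleton[of v] AE_lborel_singleton[of "vj j"]
  proof eventually_elim
    case (elim x)
    show ?case
    proof
      assume "x \<in> {v..vj j}"
      then have "x \<in> {v<..<vj j}" using elim(2,3) by auto
      then show "(g has_vector_derivative Jmult (k x + cs z (g x) - potential j x (g x))) (at x)"
        using elim(1) eq by (intro has_vector_derivative_transform_within_open[of f _ x "{v<..<vj j}" g]) auto
    qed
  qed
qed

lemma solves_cnj_pair:
  assumes "solves j z k f"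
  shows "solves j (cnj z) (\<lambda>x. cnj_pair (k x)) (\<lambda>x. cnj_pair (f x))"
  unfolding solves_iff_derivative
proof
  show "edge_abs_continuous j (\<lambda>x. cnj_pair (f x))"
    using assms by (intro bounded_linear.abs_continuous_on[OF bounded_linear_cnj_pair]) (simp add: solves_def)
  have Jmult_cnj_pair: "cnj_pair (Jmult u) = Jmult (cnj_pair u)" for u
    by (simp add: prod_eq_iff)
  show "AE x\<in>{v..vj j} in lborel. ((\<lambda>x. cnj_pair (f x)) has_vector_derivative
      Jmult (cnj_pair (k x) + cs (cnj z) (cnj_pair (f x)) - potential j x (cnj_pair (f x)))) (at x)"
    using assms[unfolded solves_iff_derivative, THEN conjunct2]
  proof eventually_elim
    case (elim x)
    then show ?case
      using bounded_linear.has_vector_derivative[OF bounded_linear_cnj_pair]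
      by (fastforce simp: Jmult_cnj_pair cnj_pair_linear cnj_pair_potential)
  qed
qed

subsection \<open>The fundamental matrix\<close>

definition is_fundamental :: "'n \<Rightarrow> complex \<Rightarrow> (real \<Rightarrow> complex^2^2) \<Rightarrow> bool" where
  "is_fundamental j z Y \<longleftrightarrow> Y v = mat 1 \<and> (\<forall>x. x \<notin> {v..vj j} \<longrightarrow> Y x = 0)
    \<and> (\<forall>b. solves j z (\<lambda>_. 0) (\<lambda>x. (Y x $ 1 $ b, Y x $ 2 $ b)))"

lemma columns_solve_iff:
  fixes Y :: "real \<Rightarrow> complex^2^2"
  shows "(\<forall>b. solves j z (\<lambda>_. 0) (\<lambda>x. (Y x $ 1 $ b, Y x $ 2 $ b))) \<longleftrightarrow>
     (\<forall>a b. abs_cont v (vj j) (\<lambda>x. Y x $ a $ b))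
      \<and> (AE x in lborel. x \<in> {v..vj j} \<longrightarrow>
           (\<forall>a b. (\<lambda>t. Y t $ a $ b) differentiable (at x))
         \<and> (\<forall>b. vector_derivative (\<lambda>t. Y t $ 2 $ b) (at x)
                  + of_real (p j x) * Y x $ 1 $ b + of_real (q j x) * Y x $ 2 $ b = z * Y x $ 1 $ b
              \<and> - vector_derivative (\<lambda>t. Y t $ 1 $ b) (at x)
                  + of_real (q j x) * Y x $ 1 $ b - of_real (p j x) * Y x $ 2 $ b = z * Y x $ 2 $ b))"
    (is "?columns \<longleftrightarrow> ?entries \<and> (AE x in lborel. x \<in> {v..vj j} \<longrightarrow> ?differentiable x \<and> (\<forall>b. ?system x b))")
proof -
  have "edge_abs_continuous j (\<lambda>x. (Y x $ 1 $ b, Y x $ 2 $ b)) \<longleftrightarrow> (\<forall>a. abs_cont v (vj j) (\<lambda>x. Y x $ a $ b))" for b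
    using bounded_linear.abs_continuous_on[OF bounded_linear_fst, of v "vj j" "\<lambda>x. (Y x $ 1 $ b, Y x $ 2 $ b)"]
      bounded_linear.abs_continuous_on[OF bounded_linear_snd, of v "vj j" "\<lambda>x. (Y x $ 1 $ b, Y x $ 2 $ b)"]
    by (auto simp: abs_cont_iff_abs_continuous_on forall_2 intro: abs_continuous_on_Pair)
  moreover have "dirac j (\<lambda>x. (Y x $ 1 $ b, Y x $ 2 $ b)) x = 0 + cs z (Y x $ 1 $ b, Y x $ 2 $ b) \<longleftrightarrow> ?system x b" for x b
    by (simp add: Hop_def prod_eq_iff)
  ultimately have "?columns \<longleftrightarrow> ?entries \<and> (\<forall>b. AE x\<in>{v..vj j} in lborel. ?system x b)"
    by (simp only: solves_def all_conj_distrib) auto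
  also have "(\<forall>b. AE x\<in>{v..vj j} in lborel. ?system x b) \<longleftrightarrow> (AE x\<in>{v..vj j} in lborel. \<forall>b. ?system x b)"
    unfolding AE_all_countable[symmetric] by (intro arg_cong[where f = "almost_everywhere lborel"]) auto
  also have "?entries \<and> (AE x\<in>{v..vj j} in lborel. \<forall>b. ?system x b)
      \<longleftrightarrow> ?entries \<and> (AE x\<in>{v..vj j} in lborel. ?differentiable x \<and> (\<forall>b. ?system x b))"
  proof (rule conj_cong[OF refl])
    assume entries: ?entries
    have "AE x\<in>{v..vj j} in lborel. (\<lambda>t. Y t $ a $ b) differentiable (at x)" for a b
    proof -
      have "abs_continuous_on v (vj j) (\<lambda>t. Y t $ a $ b)"
        using entries by (simp add: abs_cont_iff_abs_continuous_on)
      from abs_continuous_on_has_vector_derivative_AE[OF edges this] show ?thesis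
        by eventually_elim (blast intro: differentiableI_vector)
    qed
    then have "AE x in lborel. \<forall>a b. x \<in> {v..vj j} \<longrightarrow> (\<lambda>t. Y t $ a $ b) differentiable (at x)"
      unfolding AE_all_countable by blast
    then show "(AE x\<in>{v..vj j} in lborel. \<forall>b. ?system x b)
      \<longleftrightarrow> (AE x\<in>{v..vj j} in lborel. ?differentiable x \<and> (\<forall>b. ?system x b))"
      by (intro eventually_subst, eventually_elim) blast
  qed
  finally show ?thesis .
qed

lemma Yfun_eq_THE: "Yfun v vj p q j z = (THE Y. is_fundamental j z Y)"
  by (simp only: Yfun_def is_fundamental_def columns_solve_iff)

lemma is_fundamental_unique:
  assumes Y: "is_fundamental j z Y" and Z: "is_fundamental j z Z"
  shows "Y = Z"
proof
  fix x show "Y x = Z x"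
  proof (cases "x \<in> {v..vj j}")
    case True
    have "(Y x $ 1 $ b, Y x $ 2 $ b) = (Z x $ 1 $ b, Z x $ 2 $ b)" for b
      using Y Z by (intro solves_unique[OF _ _ _ _ True, of z "\<lambda>_. 0" "\<lambda>x. (Y x $ 1 $ b, Y x $ 2 $ b)"])
        (simp_all add: is_fundamental_def)
    then show ?thesis by (simp add: vec_eq_iff forall_2)
  qed (use Y Z in \<open>simp add: is_fundamental_def\<close>)
qed

lemma is_fundamental_exists: "\<exists>Y. is_fundamental j z Y"
proof -
  obtain u where u: "solves j z (\<lambda>_. 0) u" "u v = (1, 0)" by (rule solves_homogeneous_exists)
  obtain w where w: "solves j z (\<lambda>_. 0) w" "w v = (0, 1)" by (rule solves_homogeneous_exists)
  define Y :: "real \<Rightarrow> complex^2^2" where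
    "Y x = (if x \<in> {v..vj j} then vector [vector [fst (u x), fst (w x)], vector [snd (u x), snd (w x)]] else 0)" for x
  have "solves j z (\<lambda>_. 0) (\<lambda>x. (Y x $ 1 $ b, Y x $ 2 $ b))" for b
    using exhaust_2[of b] by (auto intro: solves_cong[OF u(1)] solves_cong[OF w(1)] simp: Y_def)
  moreover have "Y v = mat 1"
    using edges[of j] by (simp add: Y_def u w vec_eq_iff forall_2 mat_def)
  ultimately have "is_fundamental j z Y"
    by (simp add: is_fundamental_def Y_def)
  then show ?thesis by blast
qed

abbreviation Y :: "'n \<Rightarrow> complex \<Rightarrow> real \<Rightarrow> complex^2^2" where
  "Y \<equiv> Yfun v vj p q"

definition col :: "'n \<Rightarrow> complex \<Rightarrow> 2 \<Rightarrow> real \<Rightarrow> complex \<times> complex" where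
  "col j z b x = (Y j z x $ 1 $ b, Y j z x $ 2 $ b)"

lemma is_fundamental_Y: "is_fundamental j z (Y j z)"
  unfolding Yfun_eq_THE
proof (rule theI'[of "is_fundamental j z"])
  show "\<exists>!Y. is_fundamental j z Y"
    by (rule ex_ex1I) (fact is_fundamental_exists, fact is_fundamental_unique)
qed

lemma Y_at_v: "Y j z v = mat 1" and Y_outside: "x \<notin> {v..vj j} \<Longrightarrow> Y j z x = 0"
  and solves_col: "solves j z (\<lambda>_. 0) (col j z b)"
  using is_fundamental_Y[unfolded is_fundamental_def, of j z] unfolding col_def[abs_def] by iprover+

lemma col_at_v [simp]: "col j z 1 v = (1, 0)" "col j z 2 v = (0, 1)"
  by (simp_all add: col_def Y_at_v mat_def)

lemma edge_abs_continuous_col: "edge_abs_continuous j (col j z b)"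
  using solves_col by (simp add: solves_def)

lemma continuous_on_col: "continuous_on {v..vj j} (col j z b)"
  by (rule abs_continuous_on_imp_continuous_on[OF edge_abs_continuous_col])

lemma wronskian_col: "x \<in> {v..vj j} \<Longrightarrow> wronskian (col j z 1 x) (col j z 2 x) = 1"
  by (subst solves_0_wronskian[OF solves_col solves_col]) (simp_all add: wronskian_eq)

lemma col_cnj: "col j (cnj z) b x = cnj_pair (col j z b x)"
proof (cases "x \<in> {v..vj j}")
  case True
  have "solves j (cnj z) (\<lambda>_. 0) (\<lambda>x. cnj_pair (col j z b x))"
    using solves_cnj_pair[OF solves_col[of j z b]] by (simp add: cnj_pair_def flip: zero_prod_def)
  from solves_unique[OF solves_col this _ _ True] show ?thesis
    using exhaust_2[of b] by (auto simp: cnj_pair_def)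
next
  case False
  then show ?thesis by (simp add: col_def Y_outside cnj_pair_def)
qed

subsection \<open>Variation of constants\<close>

definition col_moment :: "'n \<Rightarrow> complex \<Rightarrow> 2 \<Rightarrow> (real \<Rightarrow> complex \<times> complex) \<Rightarrow> real \<Rightarrow> complex" where
  "col_moment j z b k x = (LINT t:{v..x}|lborel. dotp (col j z b t) (k t))"

definition edge_solution :: "'n \<Rightarrow> complex \<Rightarrow> complex \<times> complex \<Rightarrow> (real \<Rightarrow> complex \<times> complex) \<Rightarrow> real \<Rightarrow> complex \<times> complex" where
  "edge_solution j z \<xi> k x =
    cs (fst \<xi> - col_moment j z 2 k x) (col j z 1 x) + cs (snd \<xi> + col_moment j z 1 k x) (col j z 2 x)"

lemma col_moment_at_v [simp]: "col_moment j z b k v = 0"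
  by (simp add: col_moment_def)

lemma col_moment_zero [simp]: "col_moment j z b (\<lambda>_. 0) x = 0"
  by (simp add: col_moment_def dotp.zero_right set_lebesgue_integral_def)

lemma set_integrable_dotp_col:
  "edge_integrable j k \<Longrightarrow> set_integrable lborel {v..vj j} (\<lambda>t. dotp (col j z b t) (k t))"
  by (rule set_integrable_dotp(1)[OF continuous_on_col])

lemma abs_continuous_on_col_moment:
  assumes "edge_integrable j k"
  shows "abs_continuous_on v (vj j) (col_moment j z b k)"
  using set_integrable_dotp_col[OF assms]
  by (rule indefinite_integral_abs_continuous_on[of _ _ _ _ 0]) (simp add: col_moment_def)

lemma col_moment_has_vector_derivative_AE:
  assumes "edge_integrable j k"
  shows "AE x\<in>{v..vj j} in lborel. (col_moment j z b k has_vector_derivative dotp (col j z b x) (k x)) (at x)"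
  using set_integrable_dotp_col[OF assms]
  by (rule indefinite_integral_has_vector_derivative_AE[of _ _ _ _ 0]) (simp add: col_moment_def)

lemma variation_of_constants:
  assumes f: "solves j z k f" and k: "edge_integrable j k" and x: "x \<in> {v..vj j}"
  shows "f x = edge_solution j z (f v) k x"
proof -
  have "f x = cs (wronskian (f x) (col j z 2 x)) (col j z 1 x) + cs (wronskian (col j z 1 x) (f x)) (col j z 2 x)"
    using wronskian_expansion[of "col j z 1 x" "col j z 2 x" "f x"] by (simp add: wronskian_col[OF x])
  also have "\<dots> = edge_solution j z (f v) k x"
    unfolding edge_solution_def wronskian_antisymmetric[of "f x"] solves_wronskian[OF solves_col f k x]
    by (simp add: col_moment_def wronskian_eq algebra_simps)
  finally show ?thesis .
qed

lemma solves_edge_solution: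
  assumes k: "edge_integrable j k"
  shows "solves j z k (edge_solution j z \<xi> k)"
proof -
  let ?u = "col j z 1" and ?w = "col j z 2" and ?f = "edge_solution j z \<xi> k"
  let ?a = "\<lambda>x. fst \<xi> - col_moment j z 2 k x" and ?b = "\<lambda>x. snd \<xi> + col_moment j z 1 k x"
  have f: "?f = (\<lambda>x. cs (?a x) (?u x) + cs (?b x) (?w x))"
    by (simp add: edge_solution_def fun_eq_iff)
  have "edge_abs_continuous j ?f"
    unfolding f by (intro abs_continuous_on_add abs_continuous_on_diff abs_continuous_on_const cs.abs_continuous_on
        abs_continuous_on_col_moment edge_abs_continuous_col k)
  moreover have "AE x\<in>{v..vj j} in lborel. (?f has_vector_derivative Jmult (k x + cs z (?f x) - potential j x (?f x))) (at x)"
    using col_moment_has_vector_derivative_AE[OF k, of z 1] col_moment_has_vector_derivative_AE[OF k, of z 2]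
      solves_col[of j z 1, unfolded solves_iff_derivative, THEN conjunct2]
      solves_col[of j z 2, unfolded solves_iff_derivative, THEN conjunct2]
  proof eventually_elim
    case (elim x)
    let ?D = "\<lambda>f. Jmult (0 + cs z (f x) - potential j x (f x))"
    show ?case
    proof
      assume x: "x \<in> {v..vj j}"
      have "(?f has_vector_derivative (cs (?a x) (?D ?u) + cs (0 - dotp (?w x) (k x)) (?u x))
        + (cs (?b x) (?D ?w) + cs (0 + dotp (?u x) (k x)) (?w x))) (at x)"
        unfolding f using elim x
        by (intro has_vector_derivative_add cs.has_vector_derivative has_vector_derivative_diff has_vector_derivative_const) blast+
      moreover have "cs (0 - dotp (?w x) (k x)) (?u x) + cs (0 + dotp (?u x) (k x)) (?w x) = Jmult (k x)"
        using wronskian_expansion[of "?u x" "?w x" "Jmult (k x)"] dotp_commute[of "k x"]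
        by (simp add: wronskian_col[OF x] wronskian_Jmult)
      ultimately show "(?f has_vector_derivative Jmult (k x + cs z (?f x) - potential j x (?f x))) (at x)"
        by (simp add: f Jmult_linear Jmult_cs linear_potential cs.add_right cs.diff_right algebra_simps)
    qed
  qed
  ultimately show ?thesis by (simp add: solves_iff_derivative)
qed

end

section \<open>Lagrangian subspaces\<close>

definition cdot :: "complex^'n \<Rightarrow> complex^'n \<Rightarrow> complex" where
  "cdot x y = (\<Sum>i\<in>UNIV. x $ i * cnj (y $ i))"

definition symplectic_form :: "(complex^'n) \<times> (complex^'n) \<Rightarrow> (complex^'n) \<times> (complex^'n) \<Rightarrow> complex" where
  "symplectic_form x y = cdot (fst x) (snd y) - cdot (snd x) (fst y)"

definition symplectic_complement :: "((complex^'n) \<times> (complex^'n)) set \<Rightarrow> ((complex^'n) \<times> (complex^'n)) set" where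
  "symplectic_complement L = {y. \<forall>x\<in>L. symplectic_form x y = 0}"

definition boundary_kernel :: "complex^'n^'m \<Rightarrow> complex^'n^'m \<Rightarrow> ((complex^'n) \<times> (complex^'n)) set" where
  "boundary_kernel A B = {x. A *v fst x + B *v snd x = 0}"

lemma cdot_add_left: "cdot (x + y) w = cdot x w + cdot y w"
  and cdot_add_right: "cdot w (x + y) = cdot w x + cdot w y"
  and cdot_diff_left: "cdot (x - y) w = cdot x w - cdot y w"
  and cdot_diff_right: "cdot w (x - y) = cdot w x - cdot w y"
  and cdot_minus_left: "cdot (- x) w = - cdot x w"
  and cdot_minus_right: "cdot w (- x) = - cdot w x"
  and cdot_smult_left: "cdot (c *s x) w = c * cdot x w"
  and cdot_smult_right: "cdot w (c *s x) = cnj c * cdot w x"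
  and cdot_zero_left: "cdot 0 w = 0" and cdot_zero_right: "cdot w 0 = 0"
  by (simp_all add: cdot_def algebra_simps sum.distrib sum_subtractf sum_negf sum_distrib_left)

lemmas cdot_simps = cdot_add_left cdot_add_right cdot_diff_left cdot_diff_right cdot_minus_left cdot_minus_right
  cdot_smult_left cdot_smult_right cdot_zero_left cdot_zero_right

lemma cdot_self: "cdot x x = of_real ((norm x)\<^sup>2)"
  by (simp add: cdot_def norm_vec_def L2_set_def real_sqrt_pow2 sum_nonneg flip: complex_norm_square)

lemma cdot_self_add_eq_0:
  assumes "cdot x x + cdot y y = 0"
  shows "x = 0" "y = 0"
proof -
  have "(norm x)\<^sup>2 + (norm y)\<^sup>2 = 0"
    using assms unfolding cdot_self by (simp flip: of_real_add of_real_power)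
  then show "x = 0" "y = 0" by (simp_all add: sum_power2_eq_zero_iff)
qed

lemma cdot_nondegenerate: "(\<And>x. cdot x y = cdot x y') \<Longrightarrow> y = y'"
  using cdot_self[of "y - y'"] by (simp add: cdot_diff_right)

lemma inner_eq_Re_cdot: "x \<bullet> y = Re (cdot x y)" for x y :: "complex^'n"
  by (simp add: inner_vec_def cdot_def inner_complex_def)

lemma symplectic_form_nondegenerate:
  assumes "\<And>x. symplectic_form x y = symplectic_form x y'"
  shows "y = y'"
proof -
  have "cdot x (snd y) = cdot x (snd y')" "cdot x (fst y) = cdot x (fst y')" for x
    using assms[of "(x, 0)"] assms[of "(0, x)"] by (simp_all add: symplectic_form_def cdot_simps)
  then show ?thesis by (intro prod_eqI cdot_nondegenerate)
qed

lemma cdot_adjm: "cdot (adjm A *v x) y = cdot x (A *v y)"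
proof -
  have "cdot (adjm A *v x) y = (\<Sum>i\<in>UNIV. \<Sum>k\<in>UNIV. cnj (A $ k $ i) * x $ k * cnj (y $ i))"
    by (simp add: cdot_def adjm_def matrix_vector_mult_def sum_distrib_right)
  also have "\<dots> = (\<Sum>k\<in>UNIV. \<Sum>i\<in>UNIV. cnj (A $ k $ i) * x $ k * cnj (y $ i))"
    by (rule sum.swap)
  also have "\<dots> = cdot x (A *v y)"
    by (simp add: cdot_def matrix_vector_mult_def sum_distrib_left ac_simps)
  finally show ?thesis .
qed

lemma adjm_adjm [simp]: "adjm (adjm A) = A"
  by (simp add: adjm_def vec_eq_iff)

lemma adjm_minus: "adjm (- A) = - adjm A"
  by (simp add: adjm_def vec_eq_iff)

lemma matrix_vector_mult_minus_left: "(- A) *v x = - (A *v x)" for A :: "'a::comm_ring_1^'m^'n"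
  by (simp add: matrix_vector_mult_def vec_eq_iff sum_negf)

subsection \<open>Rank\<close>

lemma rank_eq_card_rows_iff:
  fixes H :: "'a::field^'m^'n"
  shows "rank H = CARD('n) \<longleftrightarrow> inj (\<lambda>i. row i H) \<and> vec.independent (rows H)"
proof -
  have rows: "rows H = range (\<lambda>i. row i H)" by (auto simp: rows_def)
  have finite: "finite (rows H)" by (simp add: rows)
  have card_le: "card (rows H) \<le> CARD('n)" unfolding rows by (rule card_image_le) simp
  have dim_le: "vec.dim (rows H) \<le> card (rows H)" by (rule vec.dim_le_card'[OF finite])
  show ?thesis
  proof (intro iffI conjI)
    assume "rank H = CARD('n)"
    then have dim: "vec.dim (rows H) = CARD('n)" by (simp add: row_rank_def_gen)
    then have "card (range (\<lambda>i. row i H)) = CARD('n)" using card_le dim_le by (simp add: rows)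
    then show "inj (\<lambda>i. row i H)" by (intro eq_card_imp_inj_on) simp_all
    show "vec.independent (rows H)"
      by (rule vec.card_le_dim_spanning[of _ "rows H"]) (use dim card_le finite vec.span_superset in auto)
  next
    assume "inj (\<lambda>i. row i H) \<and> vec.independent (rows H)"
    then show "rank H = CARD('n)"
      unfolding row_rank_def_gen by (simp add: vec.dim_eq_card_independent) (simp add: rows card_image)
  qed
qed

lemma inj_independent_rows_iff:
  fixes H :: "'a::field^'m^'n"
  shows "inj (\<lambda>i. row i H) \<and> vec.independent (rows H)
    \<longleftrightarrow> (\<forall>c. (\<Sum>i\<in>UNIV. c i *s row i H) = 0 \<longrightarrow> (\<forall>i. c i = 0))"
proof -
  have rows: "rows H = range (\<lambda>i. row i H)" by (auto simp: rows_def)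
  have finite: "finite (rows H)" by (simp add: rows)
  show ?thesis
  proof (intro iffI conjI allI impI)
    fix c :: "'n \<Rightarrow> 'a" and i
    assume independent: "inj (\<lambda>i. row i H) \<and> vec.independent (rows H)" and combination: "(\<Sum>i\<in>UNIV. c i *s row i H) = 0"
    then have inj: "inj (\<lambda>i. row i H)" by blast
    define u where "u r = c (inv (\<lambda>i. row i H) r)" for r
    have u_row: "u (row i H) = c i" for i by (simp add: u_def inv_f_f[OF inj])
    have "(\<Sum>r\<in>rows H. u r *s r) = (\<Sum>i\<in>UNIV. c i *s row i H)"
      unfolding rows by (simp add: sum.reindex[OF inj] u_row)
    with vec.independentD[OF _ finite order_refl, of u "row i H"] independent combination
    show "c i = 0" by (simp add: u_row rows)
  next
    assume trivial: "\<forall>c. (\<Sum>i\<in>UNIV. c i *s row i H) = 0 \<longrightarrow> (\<forall>i. c i = 0)"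
    show inj: "inj (\<lambda>i. row i H)"
    proof (rule injI, rule ccontr)
      fix i k assume "row i H = row k H" "i \<noteq> k"
      define c :: "'n \<Rightarrow> 'a" where "c m = (if m = i then 1 else 0) - (if m = k then 1 else 0)" for m
      have "(\<Sum>m\<in>UNIV. c m *s row m H) = (\<Sum>m\<in>UNIV. (if m = i then row m H else 0) - (if m = k then row m H else 0))"
        by (rule sum.cong) (auto simp: c_def)
      also have "\<dots> = 0" using \<open>row i H = row k H\<close> by (simp add: sum_subtractf)
      finally have "c i = 0" using trivial by auto
      then show False using \<open>i \<noteq> k\<close> by (simp add: c_def)
    qed
    show "vec.independent (rows H)"
    proof (rule vec.independent_if_scalars_zero[OF finite])
      fix f r assume "(\<Sum>x\<in>rows H. f x *s x) = 0" "r \<in> rows H"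
      moreover from this(1) have "(\<Sum>i\<in>UNIV. f (row i H) *s row i H) = 0"
        unfolding rows by (simp add: sum.reindex[OF inj])
      ultimately show "f r = 0" using trivial by (auto simp: rows)
    qed
  qed
qed

lemma rank_hcat_iff:
  fixes A B :: "complex^'n^'m"
  shows "rank (hcat A B) = CARD('m) \<longleftrightarrow> (\<forall>c. adjm A *v c = 0 \<and> adjm B *v c = 0 \<longrightarrow> c = 0)"
proof -
  have combination: "(\<Sum>i\<in>UNIV. c i *s row i (hcat A B)) = 0 \<longleftrightarrow>
      adjm A *v (\<chi> i. cnj (c i)) = 0 \<and> adjm B *v (\<chi> i. cnj (c i)) = 0" for c
  proof -
    have "(\<Sum>i\<in>UNIV. c i *s row i (hcat A B)) $ k = (case k of Inl a \<Rightarrow> cnj ((adjm A *v (\<chi> i. cnj (c i))) $ a)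
      | Inr a \<Rightarrow> cnj ((adjm B *v (\<chi> i. cnj (c i))) $ a))" for k
      by (cases k) (simp_all add: row_def hcat_def adjm_def matrix_vector_mult_def mult.commute)
    then show ?thesis
      unfolding vec_eq_iff by (auto split: sum.split_asm sum.splits)
  qed
  show ?thesis
    unfolding rank_eq_card_rows_iff inj_independent_rows_iff combination
  proof (intro iffI allI impI)
    fix c assume "\<forall>c. adjm A *v (\<chi> i. cnj (c i)) = 0 \<and> adjm B *v (\<chi> i. cnj (c i)) = 0 \<longrightarrow> (\<forall>i. c i = 0)"
      and "adjm A *v c = 0 \<and> adjm B *v c = 0"
    from this(1)[rule_format, of "\<lambda>i. cnj (c $ i)"] this(2) show "c = 0" by (simp add: vec_eq_iff)
  next
    fix c :: "'m \<Rightarrow> complex" and i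
    assume "\<forall>c. adjm A *v c = 0 \<and> adjm B *v c = 0 \<longrightarrow> c = 0"
      and "adjm A *v (\<chi> i. cnj (c i)) = 0 \<and> adjm B *v (\<chi> i. cnj (c i)) = 0"
    then have "(\<chi> i. cnj (c i)) = 0" by blast
    then show "c i = 0" by (simp add: vec_eq_iff)
  qed
qed

subsection \<open>Lagrangian subspaces as kernels\<close>

definition boundary_range :: "complex^'n^'m \<Rightarrow> complex^'n^'m \<Rightarrow> ((complex^'n) \<times> (complex^'n)) set" where
  "boundary_range A B = range (\<lambda>c. (- (adjm B *v c), adjm A *v c))"

lemma symplectic_complement_boundary_range:
  fixes A B :: "complex^'n^'m"
  shows "symplectic_complement (boundary_range A B) = boundary_kernel A B"
proof -
  have "symplectic_form (- (adjm B *v c), adjm A *v c) y = - cdot c (A *v fst y + B *v snd y)" for c y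
    by (simp add: symplectic_form_def cdot_simps cdot_adjm)
  then have "y \<in> symplectic_complement (boundary_range A B) \<longleftrightarrow> (\<forall>c. cdot c (A *v fst y + B *v snd y) = cdot c 0)" for y
    by (simp add: symplectic_complement_def boundary_range_def cdot_zero_right)
  moreover have "(\<forall>c. cdot c w = cdot c 0) \<longleftrightarrow> w = 0" for w :: "complex^'m"
    using cdot_nondegenerate[of w 0] by auto
  ultimately show ?thesis by (auto simp: boundary_kernel_def)
qed

text \<open>For \<^term>\<open>s = \<i>\<close> and \<^term>\<open>s = - \<i>\<close> this is the invertibility of the matrices
  A* + i B* and A* - i B*.\<close>
lemma adjoint_pencil_surj:
  fixes A B :: "complex^'n^'n"
  assumes rank: "rank (hcat A B) = CARD('n)" and commute: "A ** adjm B = B ** adjm A" and s: "cnj s = - s" "s * s = - 1"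
  obtains c where "adjm A *v c + s *s (adjm B *v c) = y"
proof -
  define f where "f c = adjm A *v c + s *s (adjm B *v c)" for c
  have linear: "Vector_Spaces.linear (*s) (*s) f"
    by unfold_locales (simp_all add: f_def vec.add vec.scale vec_eq_iff algebra_simps)
  have "cdot (f c) (f c) = cdot (adjm A *v c) (adjm A *v c) + cdot (adjm B *v c) (adjm B *v c)" for c
  proof -
    have "A *v (adjm B *v c) = B *v (adjm A *v c)" using commute by (simp add: matrix_vector_mul_assoc)
    then have "cdot (adjm A *v c) (adjm B *v c) = cdot (adjm B *v c) (adjm A *v c)" by (simp add: cdot_adjm)
    moreover have "cdot (f c) (f c) = cdot (adjm A *v c) (adjm A *v c)
        + s * (cdot (adjm B *v c) (adjm A *v c) - cdot (adjm A *v c) (adjm B *v c)) - s * s * cdot (adjm B *v c) (adjm B *v c)"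
      using s(1) by (simp add: f_def cdot_simps algebra_simps)
    ultimately show ?thesis using s(2) by simp
  qed
  then have "c = 0" if "f c = 0" for c
    using cdot_self_add_eq_0[of "adjm A *v c" "adjm B *v c"] that rank[unfolded rank_hcat_iff] cdot_zero_left by metis
  then have "inj f" using vec.linear_inj_iff_eq_0[OF linear] by blast
  then have "surj f" by (rule vec.linear_inj_imp_surj[OF linear])
  then obtain c where "y = f c" by (rule surjE)
  then show thesis using that by (simp add: f_def)
qed

lemma boundary_kernel_eq_boundary_range:
  fixes A B :: "complex^'n^'n"
  assumes rank: "rank (hcat A B) = CARD('n)" and commute: "A ** adjm B = B ** adjm A"
  shows "boundary_kernel A B = boundary_range A B"
proof
  have commute_vec: "A *v (adjm B *v c) = B *v (adjm A *v c)" for c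
    using commute by (simp add: matrix_vector_mul_assoc)
  then show "boundary_range A B \<subseteq> boundary_kernel A B"
    by (auto simp: boundary_kernel_def boundary_range_def vec.neg)
  show "boundary_kernel A B \<subseteq> boundary_range A B"
  proof
    fix x assume x: "x \<in> boundary_kernel A B"
    obtain c where c: "adjm A *v c + \<i> *s (adjm B *v c) = snd x - \<i> *s fst x"
      using adjoint_pencil_surj[OF rank commute, of \<i>] by auto
    define w where "w = fst x + adjm B *v c"
    have snd_x: "snd x = adjm A *v c + \<i> *s w"
      using c by (simp add: w_def vec.scale_right_distrib algebra_simps)
    have "A *v w + B *v (\<i> *s w) = 0"
      using x by (simp add: boundary_kernel_def snd_x) (simp add: w_def vec.add commute_vec algebra_simps)
    moreover obtain d where d: "adjm A *v d + (- \<i>) *s (adjm B *v d) = w"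
      using adjoint_pencil_surj[OF rank commute, of "- \<i>"] by auto
    moreover have "cdot (adjm A *v d + (- \<i>) *s (adjm B *v d)) w = cdot d (A *v w + B *v (\<i> *s w))"
      by (simp add: cdot_simps cdot_adjm vec.scale)
    ultimately have "cdot w w = 0" by (simp add: cdot_zero_right)
    then have "w = 0" by (simp add: cdot_self)
    then have "x = (- (adjm B *v c), adjm A *v c)"
      using snd_x by (simp add: w_def prod_eq_iff add_eq_0_iff)
    then show "x \<in> boundary_range A B" by (auto simp: boundary_range_def)
  qed
qed

corollary symplectic_complement_boundary_kernel:
  fixes A B :: "complex^'n^'n"
  assumes "rank (hcat A B) = CARD('n)" "A ** adjm B = B ** adjm A"
  shows "symplectic_complement (boundary_kernel A B) = boundary_kernel A B"
  using symplectic_complement_boundary_range[of A B] boundary_kernel_eq_boundary_range[OF assms] by simp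

lemma scaleR_eq_smult: "a *\<^sub>R x = complex_of_real a *s x" for x :: "complex^'n"
  unfolding vec_eq_iff vector_scaleR_component vector_smult_component by (simp add: scaleR_conv_of_real)

lemma complex_orthogonal_exists:
  fixes V :: "(complex^'n) set"
  assumes V: "vec.subspace V" "V \<noteq> UNIV"
  obtains u where "u \<noteq> 0" "\<And>x. x \<in> V \<Longrightarrow> cdot x u = 0"
proof -
  have "subspace V"
    unfolding subspace_def scaleR_eq_smult using V(1) by (auto simp: vec.subspace_def)
  then have "dim V < DIM(complex^'n)"
    using V(2) by (metis dim_eq_full dim_subset_UNIV le_neq_implies_less span_eq_iff)
  then obtain u where u: "u \<noteq> 0" "\<And>y. y \<in> span V \<Longrightarrow> orthogonal u y"
    using orthogonal_to_subspace_exists by blast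
  have Re_eq_0: "Re (cdot x u) = 0" if "x \<in> V" for x
    using u(2)[OF span_base[OF that]] inner_eq_Re_cdot[of x u] by (simp add: orthogonal_def inner_commute)
  have "cdot x u = 0" if "x \<in> V" for x
    using Re_eq_0[OF that] Re_eq_0[of "\<i> *s x"] that V(1)
    by (simp add: cdot_smult_left complex_eq_iff vec.subspace_scale)
  with u(1) that show thesis by blast
qed

text \<open>Injective on isotropic subspaces.\<close>
definition cayley :: "(complex^'n) \<times> (complex^'n) \<Rightarrow> complex^'n" where
  "cayley x = fst x + \<i> *s snd x"

context
  fixes L :: "((complex^'n) \<times> (complex^'n)) set"
  assumes lagrangian: "symplectic_complement L = L"
begin

lemma lagrangian_iff: "x \<in> L \<longleftrightarrow> (\<forall>w\<in>L. symplectic_form w x = 0)"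
  using lagrangian by (auto simp: symplectic_complement_def)

lemma lagrangian_add:
  assumes "x \<in> L" "y \<in> L"
  shows "x + y \<in> L"
proof -
  have "symplectic_form w (x + y) = symplectic_form w x + symplectic_form w y" for w
    by (simp add: symplectic_form_def cdot_simps)
  then show ?thesis using assms by (metis lagrangian_iff add_0)
qed

lemma lagrangian_smult:
  assumes "x \<in> L"
  shows "(c *s fst x, c *s snd x) \<in> L"
proof -
  have "symplectic_form w (c *s fst x, c *s snd x) = cnj c * symplectic_form w x" for w
    by (simp add: symplectic_form_def cdot_simps right_diff_distrib)
  then show ?thesis using assms by (metis lagrangian_iff mult_zero_right)
qed

lemma lagrangian_zero: "0 \<in> L"
  by (subst lagrangian_iff) (simp add: symplectic_form_def cdot_simps)

lemma lagrangian_diff: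
  assumes "x \<in> L" "y \<in> L"
  shows "x - y \<in> L"
proof -
  have "x - y = x + (- 1 *s fst y, - 1 *s snd y)" by (simp add: prod_eq_iff vec_eq_iff)
  then show ?thesis using lagrangian_add lagrangian_smult assms by metis
qed

lemma cayley_inj_on_lagrangian:
  assumes "x \<in> L" "y \<in> L" "cayley x = cayley y"
  shows "x = y"
proof -
  let ?d = "x - y"
  have "symplectic_form ?d ?d = 0" using lagrangian_iff lagrangian_diff[OF assms(1,2)] by blast
  moreover have "cayley ?d = 0" using assms(3) by (simp add: cayley_def vec.scale_right_diff_distrib algebra_simps)
  moreover have "cdot (cayley ?d) (cayley ?d) = cdot (fst ?d) (fst ?d) + cdot (snd ?d) (snd ?d) - \<i> * symplectic_form ?d ?d"
    unfolding cayley_def symplectic_form_def cdot_simps by (simp add: algebra_simps)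
  ultimately have "cdot (fst ?d) (fst ?d) + cdot (snd ?d) (snd ?d) = 0" by (simp add: cdot_zero_left)
  from cdot_self_add_eq_0[OF this] show ?thesis by (simp add: prod_eq_iff)
qed

lemma cayley_add: "cayley (x + y) = cayley x + cayley y"
  and cayley_smult: "cayley (c *s fst x, c *s snd x) = c *s cayley x"
  by (simp_all add: cayley_def vec_eq_iff algebra_simps)

lemma cayley_lagrangian: "cayley ` L = UNIV"
proof (rule ccontr)
  assume not_surj: "cayley ` L \<noteq> UNIV"
  have "cayley 0 = 0" by (simp add: cayley_def)
  then have "vec.subspace (cayley ` L)"
    using lagrangian_zero by (auto simp: vec.subspace_def intro: rev_image_eqI
        simp flip: cayley_add cayley_smult intro!: imageI lagrangian_add lagrangian_smult)
  then obtain u where u: "u \<noteq> 0" "\<And>y. y \<in> cayley ` L \<Longrightarrow> cdot y u = 0"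
    using complex_orthogonal_exists[OF _ not_surj] by blast
  have "symplectic_form x (u, - \<i> *s u) = \<i> * cdot (cayley x) u" for x
    unfolding symplectic_form_def cayley_def fst_conv snd_conv cdot_simps by (simp add: algebra_simps)
  then have "(u, - \<i> *s u) \<in> L" using u(2) by (subst lagrangian_iff) simp
  then have "symplectic_form (u, - \<i> *s u) (u, - \<i> *s u) = 0" using lagrangian_iff by blast
  then show False using u(1) by (simp add: symplectic_form_def cdot_simps cdot_self)
qed

lemma cayley_inverse_matrices:
  obtains X Z :: "complex^'n^'n" where "\<And>c. (X *v c, Z *v c) \<in> L" "\<And>c. cayley (X *v c, Z *v c) = c"
proof -
  have "\<exists>x\<in>L. cayley x = c" for c using cayley_lagrangian by (metis UNIV_I imageE)
  then obtain g where g: "\<And>c. g c \<in> L" "\<And>c. cayley (g c) = c" by metis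
  have g_add: "g (c + d) = g c + g d" for c d
    by (rule cayley_inj_on_lagrangian[OF g(1) lagrangian_add[OF g(1) g(1)]]) (simp add: cayley_add g(2))
  have g_smult: "g (a *s c) = (a *s fst (g c), a *s snd (g c))" for a c
    by (rule cayley_inj_on_lagrangian[OF g(1) lagrangian_smult[OF g(1)]]) (simp add: cayley_smult g(2))
  have "Vector_Spaces.linear (*s) (*s) (\<lambda>c. fst (g c))" "Vector_Spaces.linear (*s) (*s) (\<lambda>c. snd (g c))"
    by unfold_locales (simp_all add: g_add g_smult)
  then have "(matrix (\<lambda>c. fst (g c)) *v c, matrix (\<lambda>c. snd (g c)) *v c) = g c" for c
    by (simp add: matrix_works)
  with g that show thesis by metis
qed

theorem lagrangian_eq_boundary_kernel:
  obtains A B :: "complex^'n^'n" where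
    "rank (hcat A B) = CARD('n)" "A ** adjm B = B ** adjm A" "L = boundary_kernel A B"
proof -
  obtain X Z :: "complex^'n^'n" where XZ: "\<And>c. (X *v c, Z *v c) \<in> L" "\<And>c. cayley (X *v c, Z *v c) = c"
    using cayley_inverse_matrices by blast
  define A B where "A = adjm Z" and "B = - adjm X"
  have adjm: "adjm A = Z" "adjm B = - X" by (simp_all add: A_def B_def adjm_minus)
  have range_eq: "boundary_range A B = range (\<lambda>c. (X *v c, Z *v c))"
    by (simp add: boundary_range_def adjm matrix_vector_mult_minus_left)
  have L_range: "L = boundary_range A B"
    unfolding range_eq
  proof
    show "L \<subseteq> range (\<lambda>c. (X *v c, Z *v c))"
    proof
      fix x assume "x \<in> L"
      then have "x = (X *v cayley x, Z *v cayley x)"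
        by (rule cayley_inj_on_lagrangian[OF _ XZ(1)]) (simp add: XZ(2))
      then show "x \<in> range (\<lambda>c. (X *v c, Z *v c))" by (rule range_eqI)
    qed
  qed (use XZ(1) in blast)
  have L_kernel: "L = boundary_kernel A B"
    using symplectic_complement_boundary_range[of A B] lagrangian unfolding L_range[symmetric] by metis
  have "c = 0" if "adjm A *v c = 0 \<and> adjm B *v c = 0" for c
    using that XZ(2)[of c] by (simp add: adjm matrix_vector_mult_minus_left cayley_def)
  then have "rank (hcat A B) = CARD('n)" unfolding rank_hcat_iff by blast
  moreover have "A *v (adjm B *v c) = B *v (adjm A *v c)" for c
  proof -
    have "(- (adjm B *v c), adjm A *v c) \<in> boundary_kernel A B"
      unfolding L_kernel[symmetric] L_range by (simp add: boundary_range_def)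
    then show ?thesis by (simp add: boundary_kernel_def vec.neg)
  qed
  then have "A ** adjm B = B ** adjm A" by (simp add: matrix_eq matrix_vector_mul_assoc)
  ultimately show thesis using L_kernel that by blast
qed

end

section \<open>Square integrable functions and Green's formula\<close>

definition square_integrable :: "real set \<Rightarrow> (real \<Rightarrow> 'a::real_normed_vector) \<Rightarrow> bool" where
  "square_integrable A f \<longleftrightarrow> set_borel_measurable lborel A f \<and> set_integrable lborel A (\<lambda>x. (norm (f x))\<^sup>2)"

lemma set_borel_measurable_bounded_linear:
  fixes T :: "'a::real_normed_vector \<Rightarrow> 'b::real_normed_vector"
  assumes "bounded_linear T" "set_borel_measurable M A f"
  shows "set_borel_measurable M A (\<lambda>x. T (f x))"
proof -
  have "(\<lambda>x. T (indicator A x *\<^sub>R f x)) \<in> borel_measurable M"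
    using assms by (intro borel_measurable_continuous_on[where f = T] linear_continuous_on)
      (simp_all add: set_borel_measurable_def)
  then show ?thesis by (simp add: set_borel_measurable_def linear_simps assms(1))
qed

lemma set_borel_measurable_add:
  fixes f g :: "'a \<Rightarrow> 'b::{real_normed_vector, second_countable_topology}"
  assumes "set_borel_measurable M A f" "set_borel_measurable M A g"
  shows "set_borel_measurable M A (\<lambda>x. f x + g x)"
  using borel_measurable_add[OF assms[unfolded set_borel_measurable_def]]
  by (simp add: set_borel_measurable_def scaleR_add_right)

lemma set_borel_measurable_norm_power2:
  assumes "set_borel_measurable M A f"
  shows "set_borel_measurable M A (\<lambda>x. (norm (f x))\<^sup>2)"
proof -
  have "(\<lambda>x. (norm (indicator A x *\<^sub>R f x))\<^sup>2) \<in> borel_measurable M"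
    using assms unfolding set_borel_measurable_def by measurable
  moreover have "(norm (indicator A x *\<^sub>R f x))\<^sup>2 = indicator A x *\<^sub>R (norm (f x))\<^sup>2" for x
    by (simp add: indicator_def)
  ultimately show ?thesis by (simp add: set_borel_measurable_def)
qed

lemma square_integrable_bound:
  assumes f: "set_borel_measurable lborel A f" and g: "set_integrable lborel A g"
    and bound: "\<And>x. x \<in> A \<Longrightarrow> (norm (f x))\<^sup>2 \<le> g x"
  shows "square_integrable A f"
  unfolding square_integrable_def
proof (intro conjI f set_integrable_bound[OF g set_borel_measurable_norm_power2[OF f]])
  have "norm ((norm (f x))\<^sup>2) \<le> norm (g x)" if "x \<in> A" for x
    using bound[OF that] by simp
  then show "AE x in lborel. x \<in> A \<longrightarrow> norm ((norm (f x))\<^sup>2) \<le> norm (g x)" by simp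
qed

lemma square_integrable_bounded_linear:
  assumes T: "bounded_linear T" and f: "square_integrable A f"
  shows "square_integrable A (\<lambda>x. T (f x))"
proof -
  obtain K where K: "\<And>u. norm (T u) \<le> norm u * K"
    using bounded_linear.bounded[OF T] by blast
  show ?thesis
  proof (rule square_integrable_bound)
    show "set_borel_measurable lborel A (\<lambda>x. T (f x))"
      using f by (intro set_borel_measurable_bounded_linear[OF T]) (simp add: square_integrable_def)
    show "set_integrable lborel A (\<lambda>x. K\<^sup>2 * (norm (f x))\<^sup>2)"
      using f by (intro set_integrable_mult_right) (simp add: square_integrable_def)
    show "(norm (T (f x)))\<^sup>2 \<le> K\<^sup>2 * (norm (f x))\<^sup>2" for x
      using power_mono[OF K[of "f x"], of 2] by (simp add: power_mult_distrib mult.commute)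
  qed
qed

lemma square_integrable_add:
  fixes f g :: "real \<Rightarrow> 'a::{real_normed_vector, second_countable_topology}"
  assumes "square_integrable A f" "square_integrable A g"
  shows "square_integrable A (\<lambda>x. f x + g x)"
proof (rule square_integrable_bound)
  show "set_borel_measurable lborel A (\<lambda>x. f x + g x)"
    using assms by (intro set_borel_measurable_add) (simp_all add: square_integrable_def)
  show "set_integrable lborel A (\<lambda>x. 2 * (norm (f x))\<^sup>2 + 2 * (norm (g x))\<^sup>2)"
    using assms by (intro set_integral_add set_integrable_mult_right) (simp_all add: square_integrable_def)
  fix x
  have "(norm (f x + g x))\<^sup>2 \<le> (norm (f x) + norm (g x))\<^sup>2"
    by (intro power_mono norm_triangle_ineq) simp
  also have "\<dots> \<le> 2 * (norm (f x))\<^sup>2 + 2 * (norm (g x))\<^sup>2"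
    using sum_squares_bound[of "norm (f x)" "norm (g x)"] by (simp add: power2_sum)
  finally show "(norm (f x + g x))\<^sup>2 \<le> 2 * (norm (f x))\<^sup>2 + 2 * (norm (g x))\<^sup>2" .
qed

lemma square_integrable_bilinear:
  fixes prod :: "'a::{real_normed_vector, second_countable_topology} \<Rightarrow> 'b::{real_normed_vector, second_countable_topology}
    \<Rightarrow> 'c::{banach, second_countable_topology}"
  assumes bilinear: "bounded_bilinear prod" and f: "square_integrable A f" and g: "square_integrable A g"
  shows "set_integrable lborel A (\<lambda>x. prod (f x) (g x))"
proof -
  obtain K where K: "0 < K" "\<And>u w. norm (prod u w) \<le> norm u * norm w * K"
    using bounded_bilinear.pos_bounded[OF bilinear] by blast
  show ?thesis
  proof (rule set_integrable_bound)
    show "set_integrable lborel A (\<lambda>x. K * ((norm (f x))\<^sup>2 + (norm (g x))\<^sup>2))"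
      using f g by (intro set_integrable_mult_right set_integral_add) (simp_all add: square_integrable_def)
    show "set_borel_measurable lborel A (\<lambda>x. prod (f x) (g x))"
      using f g by (intro set_borel_measurable_bilinear[OF bilinear]) (simp_all add: square_integrable_def)
    have "norm (prod (f x) (g x)) \<le> norm (K * ((norm (f x))\<^sup>2 + (norm (g x))\<^sup>2))" for x
    proof -
      have "norm (f x) * norm (g x) \<le> (norm (f x))\<^sup>2 + (norm (g x))\<^sup>2"
        using sum_squares_bound[of "norm (f x)" "norm (g x)"] mult_nonneg_nonneg[OF norm_ge_zero norm_ge_zero, of "f x" "g x"]
        by linarith
      then have "norm (f x) * norm (g x) * K \<le> ((norm (f x))\<^sup>2 + (norm (g x))\<^sup>2) * K"
        using K(1) by (intro mult_right_mono) auto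
      from order_trans[OF K(2) this] K(1) show ?thesis by (simp add: mult.commute)
    qed
    then show "AE x in lborel. x \<in> A \<longrightarrow> norm (prod (f x) (g x)) \<le> norm (K * ((norm (f x))\<^sup>2 + (norm (g x))\<^sup>2))" by simp
  qed
qed

lemma continuous_on_imp_square_integrable:
  fixes f :: "real \<Rightarrow> 'a::{banach, second_countable_topology}"
  shows "continuous_on {a..b} f \<Longrightarrow> square_integrable {a..b} f"
  unfolding square_integrable_def
  by (intro conjI continuous_on_Icc_imp_set_borel_measurable borel_integrable_atLeastAtMost' continuous_intros)

lemma square_integrable_imp_set_integrable:
  fixes f :: "real \<Rightarrow> 'a::{banach, second_countable_topology}"
  assumes "square_integrable {a..b} f"
  shows "set_integrable lborel {a..b} f"
  using square_integrable_bilinear[OF bounded_bilinear_scaleR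
      continuous_on_imp_square_integrable[OF continuous_on_const[of _ 1]] assms] by simp

lemma square_integrable_cong_AE:
  assumes f: "square_integrable A f" and g: "set_borel_measurable lborel A g" and "AE x\<in>A in lborel. f x = g x"
  shows "square_integrable A g"
  unfolding square_integrable_def
proof (rule conjI[OF g], rule set_integrable_cong_AE_on)
  show "set_integrable lborel A (\<lambda>x. (norm (f x))\<^sup>2)" using f by (simp add: square_integrable_def)
  show "set_borel_measurable lborel A (\<lambda>x. (norm (g x))\<^sup>2)" by (rule set_borel_measurable_norm_power2[OF g])
  show "AE x\<in>A in lborel. (norm (f x))\<^sup>2 = (norm (g x))\<^sup>2" using assms(3) by eventually_elim simp
qed

lemma set_borel_measurable_Pair_iff:
  fixes f :: "'a \<Rightarrow> 'b::{real_normed_vector, second_countable_topology}"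
    and g :: "'a \<Rightarrow> 'c::{real_normed_vector, second_countable_topology}"
  shows "set_borel_measurable M A (\<lambda>x. (f x, g x)) \<longleftrightarrow> set_borel_measurable M A f \<and> set_borel_measurable M A g"
proof
  assume "set_borel_measurable M A (\<lambda>x. (f x, g x))"
  from set_borel_measurable_bounded_linear[OF bounded_linear_fst this]
    set_borel_measurable_bounded_linear[OF bounded_linear_snd this]
  show "set_borel_measurable M A f \<and> set_borel_measurable M A g" by simp
next
  assume "set_borel_measurable M A f \<and> set_borel_measurable M A g"
  then have "(\<lambda>x. (indicator A x *\<^sub>R f x, indicator A x *\<^sub>R g x)) \<in> borel_measurable M"
    unfolding set_borel_measurable_def by (intro borel_measurable_Pair) simp_all
  then show "set_borel_measurable M A (\<lambda>x. (f x, g x))"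
    by (simp add: set_borel_measurable_def)
qed

lemma sqint_iff_square_integrable: "sqint a b f \<longleftrightarrow> square_integrable {a..b} f"
  by (simp add: sqint_def square_integrable_def set_borel_measurable_def)

lemma square_integrable_Pair_iff:
  fixes f :: "real \<Rightarrow> 'a::{real_normed_vector, second_countable_topology}"
    and g :: "real \<Rightarrow> 'b::{real_normed_vector, second_countable_topology}"
  shows "square_integrable A (\<lambda>x. (f x, g x)) \<longleftrightarrow> square_integrable A f \<and> square_integrable A g"
proof
  assume "square_integrable A (\<lambda>x. (f x, g x))"
  from square_integrable_bounded_linear[OF bounded_linear_fst this]
    square_integrable_bounded_linear[OF bounded_linear_snd this]
  show "square_integrable A f \<and> square_integrable A g" by simp
next
  assume fg: "square_integrable A f \<and> square_integrable A g"
  show "square_integrable A (\<lambda>x. (f x, g x))"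
  proof (rule square_integrable_bound)
    show "set_borel_measurable lborel A (\<lambda>x. (f x, g x))"
      using fg by (simp add: square_integrable_def set_borel_measurable_Pair_iff)
    show "set_integrable lborel A (\<lambda>x. (norm (f x))\<^sup>2 + (norm (g x))\<^sup>2)"
      using fg by (intro set_integral_add) (simp_all add: square_integrable_def)
  qed (simp add: norm_prod_def)
qed

lemma L2G_iff: "L2G v vj f \<longleftrightarrow> (\<forall>j. square_integrable {v..vj j} (f j))"
  by (simp add: L2G_def sqint_iff_square_integrable flip: square_integrable_Pair_iff)

lemma square_integrable_cs: "square_integrable A f \<Longrightarrow> square_integrable A (\<lambda>x. cs c (f x))"
  by (rule square_integrable_bounded_linear[OF cs.bounded_linear_right])

lemma square_integrable_diff:
  fixes f g :: "real \<Rightarrow> 'a::{real_normed_vector, second_countable_topology}"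
  shows "square_integrable A f \<Longrightarrow> square_integrable A g \<Longrightarrow> square_integrable A (\<lambda>x. f x - g x)"
  using square_integrable_add[OF _ square_integrable_bounded_linear[OF bounded_linear_minus[OF bounded_linear_ident]], of A f g]
  by simp

lemma L2G_add_cs: "L2G v vj f \<Longrightarrow> L2G v vj g \<Longrightarrow> L2G v vj (\<lambda>j x. f j x + cs c (g j x))"
  by (simp add: L2G_iff square_integrable_add square_integrable_cs)

definition inner_on :: "real set \<Rightarrow> (real \<Rightarrow> complex \<times> complex) \<Rightarrow> (real \<Rightarrow> complex \<times> complex) \<Rightarrow> complex" where
  "inner_on A f g = (LINT x:A|lborel. dotp (f x) (cnj_pair (g x)))"

lemma innerG_eq_sum: "innerG v vj f g = (\<Sum>j\<in>UNIV. inner_on {v..vj j} (f j) (g j))"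
  by (simp add: innerG_def inner_on_def dotp_def)

lemma set_integrable_inner_on:
  "square_integrable A f \<Longrightarrow> square_integrable A g \<Longrightarrow> set_integrable lborel A (\<lambda>x. dotp (f x) (cnj_pair (g x)))"
  by (rule square_integrable_bilinear[OF bounded_bilinear.comp[OF bounded_bilinear_dotp bounded_linear_ident bounded_linear_cnj_pair]])

lemma inner_on_cong:
  assumes "square_integrable A f" "square_integrable A g" "square_integrable A f'" "square_integrable A g'"
    and "AE x\<in>A in lborel. f x = f' x" "AE x\<in>A in lborel. g x = g' x"
  shows "inner_on A f g = inner_on A f' g'"
  unfolding inner_on_def
proof (rule set_integral_cong_AE_on)
  show "AE x\<in>A in lborel. dotp (f x) (cnj_pair (g x)) = dotp (f' x) (cnj_pair (g' x))"
    using assms(5,6) by eventually_elim simp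
qed (intro set_integrable_imp_set_borel_measurable set_integrable_inner_on assms)+

lemma innerG_cong:
  assumes "L2G v vj f" "L2G v vj g" "L2G v vj f'" "L2G v vj g'" "eqG v vj f f'" "eqG v vj g g'"
  shows "innerG v vj f g = innerG v vj f' g'"
  using assms unfolding innerG_eq_sum L2G_iff eqG_def by (intro sum.cong inner_on_cong) simp_all

lemma inner_on_diff_cs_left:
  assumes "square_integrable A f" "square_integrable A g" "square_integrable A h"
  shows "inner_on A (\<lambda>x. f x - cs c (g x)) h = inner_on A f h - c * inner_on A g h"
  using set_integral_diff(2)[OF set_integrable_inner_on[OF assms(1,3)] set_integrable_mult_right[OF set_integrable_inner_on[OF assms(2,3)]], of c]
  by (simp add: inner_on_def dotp.diff_left)

lemma inner_on_commute: "inner_on A g f = cnj (inner_on A f g)"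
proof -
  have "inner_on A g f = (LINT x|lborel. cnj (indicator A x *\<^sub>R dotp (f x) (cnj_pair (g x))))"
    unfolding inner_on_def set_lebesgue_integral_def
    by (intro Bochner_Integration.integral_cong) (simp_all add: dotp_def mult.commute)
  then show ?thesis by (simp only: Bochner_Integration.integral_cnj inner_on_def set_lebesgue_integral_def)
qed

lemma inner_on_diff_cs_right:
  assumes "square_integrable A f" "square_integrable A g" "square_integrable A h"
  shows "inner_on A h (\<lambda>x. f x - cs c (g x)) = inner_on A h f - cnj c * inner_on A h g"
  using inner_on_diff_cs_left[OF assms, of c] by (simp add: inner_on_commute[of A h])

lemma inner_on_self: "inner_on A f f = of_real (LINT x:A|lborel. (norm (f x))\<^sup>2)"
  by (simp add: inner_on_def dotp_cnj_pair_self flip: set_integral_complex_of_real)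

lemma inner_on_self_eq_0:
  assumes f: "square_integrable A f" and "inner_on A f f = 0"
  shows "AE x\<in>A in lborel. f x = 0"
proof -
  have "(LINT x:A|lborel. (norm (f x))\<^sup>2) = 0"
    using assms(2) by (simp add: inner_on_self)
  then have "AE x in lborel. indicator A x *\<^sub>R (norm (f x))\<^sup>2 = 0"
    using f unfolding set_lebesgue_integral_def square_integrable_def set_integrable_def
    by (subst (asm) integral_nonneg_eq_0_iff_AE) auto
  then show ?thesis by eventually_elim (auto simp: indicator_def)
qed

lemma inner_on_self_eq_0_continuous:
  assumes "a < b" "continuous_on {a..b} f" "inner_on {a..b} f f = 0" "x \<in> {a..b}"
  shows "f x = 0"
proof -
  have continuous: "continuous_on {a..b} (\<lambda>x. (norm (f x))\<^sup>2)" by (intro continuous_intros assms(2))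
  then have "integral {a..b} (\<lambda>x. (norm (f x))\<^sup>2) = (LINT x:{a..b}|lborel. (norm (f x))\<^sup>2)"
    by (rule set_borel_integral_eq_integral(2)[symmetric, OF borel_integrable_atLeastAtMost'])
  also have "\<dots> = 0" using assms(3) by (simp add: inner_on_self)
  finally show ?thesis
    using integral_eq_0_iff[OF continuous \<open>a < b\<close>] assms(4) by auto
qed

lemma eqG_refl [simp]: "eqG v vj f f"
  by (simp add: eqG_def)

lemma eqG_sym: "eqG v vj f g \<Longrightarrow> eqG v vj g f"
  by (simp add: eqG_def eq_commute)

lemma eqG_trans:
  assumes "eqG v vj f g" "eqG v vj g h"
  shows "eqG v vj f h"
  unfolding eqG_def
proof
  fix j show "AE x in lborel. x \<in> {v..vj j} \<longrightarrow> f j x = h j x"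
    using assms[unfolded eqG_def, THEN spec, of j] by eventually_elim simp
qed

lemma eqG_add_cs:
  assumes "eqG v vj f f'" "eqG v vj g g'"
  shows "eqG v vj (\<lambda>j x. f j x + cs c (g j x)) (\<lambda>j x. f' j x + cs c (g' j x))"
  unfolding eqG_def
proof
  fix j show "AE x in lborel. x \<in> {v..vj j} \<longrightarrow> f j x + cs c (g j x) = f' j x + cs c (g' j x)"
    using assms[unfolded eqG_def, THEN spec, of j] by eventually_elim simp
qed

context star
begin

lemma edge_integrable_L2G: "L2G v vj k \<Longrightarrow> edge_integrable j (k j)"
  by (simp add: L2G_iff square_integrable_imp_set_integrable)

lemma L2G_if_abs_continuous: "(\<And>j. edge_abs_continuous j (f j)) \<Longrightarrow> L2G v vj f"
  by (simp add: L2G_iff continuous_on_imp_square_integrable abs_continuous_on_imp_continuous_on)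

lemma adjG_antimono: "S \<subseteq> T \<Longrightarrow> adjG v vj T \<subseteq> adjG v vj S"
  unfolding adjG_def by blast

subsection \<open>Boundary values\<close>

definition outer_bc :: "'n \<Rightarrow> complex \<times> complex \<Rightarrow> complex" where
  "outer_bc j u = of_real (cos (\<alpha> j)) * fst u + of_real (sin (\<alpha> j)) * snd u"

definition boundary :: "'n gfun \<Rightarrow> (complex^'n) \<times> (complex^'n)" where
  "boundary f = (sharp1 v f, sharp2 v f)"

abbreviation "b_fun \<equiv> bfun v vj p q \<alpha>"
abbreviation "c_fun \<equiv> cfun v vj p q \<alpha>"
abbreviation "D_max \<equiv> Dmax v vj p q \<alpha>"
abbreviation "S_min \<equiv> Smin v vj p q \<alpha>"

lemma boundary_nth [simp]: "fst (boundary f) $ j = fst (f j v)" "snd (boundary f) $ j = snd (f j v)"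
  by (simp_all add: boundary_def sharp1_def sharp2_def)

lemma outer_bc_linear [simp]: "outer_bc j (u + w) = outer_bc j u + outer_bc j w" "outer_bc j (cs c u) = c * outer_bc j u"
  by (simp_all add: outer_bc_def algebra_simps)

lemma outer_bc_cnj_pair [simp]: "outer_bc j (cnj_pair u) = cnj (outer_bc j u)"
  by (simp add: outer_bc_def)

lemma outer_bc_col: "outer_bc j (col j z 1 (vj j)) = b_fun j z" "outer_bc j (col j z 2 (vj j)) = c_fun j z"
  by (simp_all add: outer_bc_def col_def bfun_def cfun_def mult.commute)

lemma b_fun_cnj: "b_fun j (cnj z) = cnj (b_fun j z)" and c_fun_cnj: "c_fun j (cnj z) = cnj (c_fun j z)"
  by (simp_all add: col_cnj flip: outer_bc_col)

text \<open>The boundary condition confines both vectors to the same line, where the Wronskian vanishes.\<close>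
lemma wronskian_outer_bc_eq_0:
  assumes "outer_bc j u = 0" "outer_bc j w = 0"
  shows "wronskian u w = 0"
proof -
  define n where "n = (complex_of_real (cos (\<alpha> j)), complex_of_real (sin (\<alpha> j)))"
  have unit: "dotp n n = 1"
    by (simp add: n_def dotp_def flip: of_real_mult of_real_add)
  have "u = cs (wronskian n u) (Jmult n)" if "outer_bc j u = 0" for u
    using wronskian_expansion[of n "Jmult n" u] that unit
    by (simp add: wronskian_Jmult) (simp add: dotp_def outer_bc_def n_def mult.commute)
  then have "wronskian u w = wronskian (cs (wronskian n u) (Jmult n)) (cs (wronskian n w) (Jmult n))"
    using assms by metis
  then show ?thesis by simp
qed

lemma b_fun_or_c_fun_nonzero: "b_fun j z \<noteq> 0 \<or> c_fun j z \<noteq> 0"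
  using wronskian_outer_bc_eq_0[of j "col j z 1 (vj j)" "col j z 2 (vj j)"] wronskian_col[of "vj j" j z] edges[of j]
  by (auto simp: outer_bc_col)

lemma Dmax_iff:
  "f \<in> D_max \<longleftrightarrow> (\<forall>j. edge_abs_continuous j (f j)) \<and> L2G v vj (Hop p q f) \<and> (\<forall>j. outer_bc j (f j (vj j)) = 0)"
proof -
  have "edge_abs_continuous j (f j) \<longleftrightarrow> abs_cont v (vj j) (\<lambda>x. fst (f j x)) \<and> abs_cont v (vj j) (\<lambda>x. snd (f j x))" for j
    using bounded_linear.abs_continuous_on[OF bounded_linear_fst, of v "vj j" "f j"]
      bounded_linear.abs_continuous_on[OF bounded_linear_snd, of v "vj j" "f j"]
      abs_continuous_on_Pair[of v "vj j" "\<lambda>x. fst (f j x)" "\<lambda>x. snd (f j x)"]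
    by (auto simp: abs_cont_iff_abs_continuous_on)
  then show ?thesis using L2G_if_abs_continuous[of f] by (auto simp: Dmax_def outer_bc_def)
qed

lemma Dmax_L2G: "f \<in> D_max \<Longrightarrow> L2G v vj f" "f \<in> D_max \<Longrightarrow> L2G v vj (Hop p q f)"
  by (simp_all add: Dmax_def)

lemma edge_green:
  assumes f: "f \<in> D_max" and g: "g \<in> D_max"
  shows "inner_on {v..vj j} (Hop p q f j) (g j) - inner_on {v..vj j} (f j) (Hop p q g j)
    = fst (f j v) * cnj (snd (g j v)) - snd (f j v) * cnj (fst (g j v))"
proof -
  let ?h = "\<lambda>x. cnj_pair (g j x)"
  have abs_continuous: "edge_abs_continuous j (f j)" "edge_abs_continuous j (g j)"
    using f g by (simp_all add: Dmax_iff)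
  have h: "edge_abs_continuous j ?h"
    by (rule bounded_linear.abs_continuous_on[OF bounded_linear_cnj_pair abs_continuous(2)])
  have "solves j 0 (\<lambda>x. cnj_pair (Hop p q g j x)) ?h"
    using solves_cnj_pair[of j 0 "Hop p q g j" "g j"] abs_continuous(2)
    by (simp add: solves_def Hop_eq_dirac[of g])
  then have dirac_h: "AE x\<in>{v..vj j} in lborel. dirac j ?h x = cnj_pair (Hop p q g j x)"
    by (simp add: solves_def)
  note L2 = Dmax_L2G[OF f, unfolded L2G_iff, rule_format] Dmax_L2G[OF g, unfolded L2G_iff, rule_format]
  note integrable = set_integral_diff[OF set_integrable_inner_on[OF L2(1,4)] set_integrable_inner_on[OF L2(2,3)], of j]
  have "inner_on {v..vj j} (f j) (Hop p q g j) - inner_on {v..vj j} (Hop p q f j) (g j)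
      = (LINT x:{v..vj j}|lborel. dotp (f j x) (cnj_pair (Hop p q g j x)) - dotp (Hop p q f j x) (?h x))"
    by (simp add: inner_on_def integrable(2))
  also have "\<dots> = (LINT x:{v..vj j}|lborel. dotp (f j x) (dirac j ?h x) - dotp (dirac j (f j) x) (?h x))"
  proof (rule set_integral_cong_AE_on)
    show "set_borel_measurable lborel {v..vj j} (\<lambda>x. dotp (f j x) (dirac j ?h x) - dotp (dirac j (f j) x) (?h x))"
      by (intro set_integrable_imp_set_borel_measurable set_integral_diff set_integrable_dotp edge_integrable_dirac
          abs_continuous_on_imp_continuous_on abs_continuous h)
    show "AE x\<in>{v..vj j} in lborel. dotp (f j x) (cnj_pair (Hop p q g j x)) - dotp (Hop p q f j x) (?h x)
        = dotp (f j x) (dirac j ?h x) - dotp (dirac j (f j) x) (?h x)"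
      using dirac_h by eventually_elim (simp add: Hop_eq_dirac[of f])
  qed (rule set_integrable_imp_set_borel_measurable[OF integrable(1)])
  also have "\<dots> = wronskian (f j (vj j)) (?h (vj j)) - wronskian (f j v) (?h v)"
    using lagrange_identity[OF abs_continuous(1) h, of "vj j"] edges[of j] by simp
  also have "wronskian (f j (vj j)) (?h (vj j)) = 0"
    using f g by (intro wronskian_outer_bc_eq_0[of j]) (simp_all add: Dmax_iff)
  finally show ?thesis by (simp add: wronskian_eq algebra_simps)
qed

theorem green:
  assumes "f \<in> D_max" "g \<in> D_max"
  shows "innerG v vj (Hop p q f) g - innerG v vj f (Hop p q g) = symplectic_form (boundary f) (boundary g)"
  by (simp add: innerG_eq_sum symplectic_form_def cdot_def edge_green[OF assms] flip: sum_subtractf)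

subsection \<open>Solutions on the graph\<close>

definition graph_solution :: "complex \<Rightarrow> (complex^'n) \<times> (complex^'n) \<Rightarrow> 'n gfun \<Rightarrow> 'n gfun" where
  "graph_solution z \<xi> k j = edge_solution j z (fst \<xi> $ j, snd \<xi> $ j) (k j)"

definition moment :: "2 \<Rightarrow> complex \<Rightarrow> 'n gfun \<Rightarrow> complex^'n" where
  "moment b z k = (\<chi> j. col_moment j z b (k j) (vj j))"

lemma boundary_graph_solution [simp]: "boundary (graph_solution z \<xi> k) = \<xi>"
  by (simp add: prod_eq_iff vec_eq_iff) (simp add: graph_solution_def edge_solution_def)

lemma edge_abs_continuous_graph_solution: "L2G v vj k \<Longrightarrow> edge_abs_continuous j (graph_solution z \<xi> k j)"
  using solves_edge_solution[OF edge_integrable_L2G] by (simp add: graph_solution_def solves_def)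

lemma L2G_graph_solution: "L2G v vj k \<Longrightarrow> L2G v vj (graph_solution z \<xi> k)"
  by (rule L2G_if_abs_continuous) (rule edge_abs_continuous_graph_solution)

lemma eqG_Hop_graph_solution:
  assumes "L2G v vj k"
  shows "eqG v vj (Hop p q (graph_solution z \<xi> k)) (\<lambda>j x. k j x + cs z (graph_solution z \<xi> k j x))"
  using solves_edge_solution[OF edge_integrable_L2G[OF assms]]
  by (simp add: eqG_def solves_def graph_solution_def Hop_eq_dirac[of "graph_solution z \<xi> k"])

lemma L2G_Hop_graph_solution:
  assumes k: "L2G v vj k"
  shows "L2G v vj (Hop p q (graph_solution z \<xi> k))"
  unfolding L2G_iff
proof
  fix j
  show "square_integrable {v..vj j} (Hop p q (graph_solution z \<xi> k) j)"
  proof (rule square_integrable_cong_AE)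
    show "square_integrable {v..vj j} (\<lambda>x. k j x + cs z (graph_solution z \<xi> k j x))"
      using k L2G_graph_solution[OF k] by (simp add: L2G_iff square_integrable_add square_integrable_cs)
    show "set_borel_measurable lborel {v..vj j} (Hop p q (graph_solution z \<xi> k) j)"
      unfolding Hop_eq_dirac[of "graph_solution z \<xi> k"]
      by (intro set_integrable_imp_set_borel_measurable edge_integrable_dirac edge_abs_continuous_graph_solution k)
    show "AE x\<in>{v..vj j} in lborel. k j x + cs z (graph_solution z \<xi> k j x) = Hop p q (graph_solution z \<xi> k) j x"
      using eqG_Hop_graph_solution[OF k] unfolding eqG_def by (simp add: eq_commute)
  qed
qed

lemma outer_bc_graph_solution:
  "outer_bc j (graph_solution z \<xi> k j (vj j))
    = (fst \<xi> $ j - moment 2 z k $ j) * b_fun j z + (snd \<xi> $ j + moment 1 z k $ j) * c_fun j z"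
  by (simp add: graph_solution_def edge_solution_def moment_def outer_bc_col)

lemma graph_solution_in_Dmax_iff:
  assumes "L2G v vj k"
  shows "graph_solution z \<xi> k \<in> D_max \<longleftrightarrow>
    (\<forall>j. (fst \<xi> $ j - moment 2 z k $ j) * b_fun j z + (snd \<xi> $ j + moment 1 z k $ j) * c_fun j z = 0)"
  using edge_abs_continuous_graph_solution[OF assms] L2G_Hop_graph_solution[OF assms]
  by (simp add: Dmax_iff outer_bc_graph_solution)

lemma Dmax_eq_graph_solution:
  assumes f: "f \<in> D_max" and k: "L2G v vj k"
    and eq: "eqG v vj (Hop p q f) (\<lambda>j x. k j x + cs z (f j x))" and x: "x \<in> {v..vj j}"
  shows "f j x = graph_solution z (boundary f) k j x"
proof -
  have "solves j z (k j) (f j)"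
    using f eq unfolding solves_def Dmax_iff eqG_def Hop_eq_dirac[of f] by blast
  from variation_of_constants[OF this edge_integrable_L2G[OF k] x] show ?thesis
    by (simp add: graph_solution_def)
qed

section \<open>Adjoints of boundary value relations\<close>

definition represents :: "'n gfun \<Rightarrow> 'n gfun \<times> 'n gfun \<Rightarrow> bool" where
  "represents f0 fh \<longleftrightarrow> f0 \<in> D_max \<and> L2G v vj (fst fh) \<and> L2G v vj (snd fh)
    \<and> eqG v vj (fst fh) f0 \<and> eqG v vj (snd fh) (Hop p q f0)"

definition boundary_relation :: "((complex^'n) \<times> (complex^'n)) set \<Rightarrow> ('n gfun \<times> 'n gfun) set" where
  "boundary_relation L = {fh. \<exists>f0. represents f0 fh \<and> boundary f0 \<in> L}"

lemma opRel_eq_boundary_relation: "opRel v vj p q {f \<in> D_max. boundary f \<in> L} = boundary_relation L"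
  by (rule set_eqI) (simp add: opRel_def boundary_relation_def represents_def case_prod_beta, blast)

lemma boundary_relation_mono: "L \<subseteq> L' \<Longrightarrow> boundary_relation L \<subseteq> boundary_relation L'"
  by (auto simp: boundary_relation_def)

lemma Smin_eq: "S_min = boundary_relation {0}"
proof -
  have "(\<forall>j. fst (f j v) = 0 \<and> snd (f j v) = 0) \<longleftrightarrow> boundary f \<in> {0}" for f
    by (auto simp: prod_eq_iff vec_eq_iff)
  then show ?thesis unfolding Smin_def opRel_eq_boundary_relation[symmetric] by (simp only:)
qed

lemma represents_Hop: "f \<in> D_max \<Longrightarrow> represents f (f, Hop p q f)"
  by (simp add: represents_def Dmax_L2G)

lemma green_represents:
  assumes "represents f0 (f, h)" "represents g0 (g, k)"
  shows "innerG v vj h g - innerG v vj f k = symplectic_form (boundary f0) (boundary g0)"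
proof -
  have D_max: "f0 \<in> D_max" "g0 \<in> D_max" using assms by (simp_all add: represents_def)
  have "innerG v vj h g = innerG v vj (Hop p q f0) g0" "innerG v vj f k = innerG v vj f0 (Hop p q g0)"
    using assms Dmax_L2G[OF D_max(1)] Dmax_L2G[OF D_max(2)]
    by (auto simp: represents_def intro!: innerG_cong)
  with green[OF D_max] show ?thesis by simp
qed

text \<open>The coefficients are chosen so that the condition at the outer vertex holds.\<close>
definition outer_solution :: "'n \<Rightarrow> real \<Rightarrow> complex \<times> complex" where
  "outer_solution j x = cs (- c_fun j 0) (col j 0 1 x) + cs (b_fun j 0) (col j 0 2 x)"

lemma cnj_pair_outer_solution: "cnj_pair (outer_solution j x) = outer_solution j x"
  using b_fun_cnj[of j 0] c_fun_cnj[of j 0] col_cnj[of j 0]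
  by (simp add: outer_solution_def cnj_pair_linear)

lemma edge_abs_continuous_outer_solution: "edge_abs_continuous j (outer_solution j)"
  unfolding outer_solution_def[abs_def]
  by (intro abs_continuous_on_add bounded_linear.abs_continuous_on[OF cs.bounded_linear_right] edge_abs_continuous_col)

lemma square_integrable_outer_solution: "square_integrable {v..vj j} (outer_solution j)"
  by (intro continuous_on_imp_square_integrable abs_continuous_on_imp_continuous_on edge_abs_continuous_outer_solution)

lemma inner_on_outer_solution_nonzero: "inner_on {v..vj j} (outer_solution j) (outer_solution j) \<noteq> 0"
proof
  assume "inner_on {v..vj j} (outer_solution j) (outer_solution j) = 0"
  from inner_on_self_eq_0_continuous[OF edges abs_continuous_on_imp_continuous_on[OF edge_abs_continuous_outer_solution] this, of v]
  have "outer_solution j v = 0" using edges[of j] by simp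
  then show False using b_fun_or_c_fun_nonzero[of j 0] by (simp add: outer_solution_def prod_eq_iff)
qed

lemma inner_on_outer_solution:
  assumes "L2G v vj k"
  shows "inner_on {v..vj j} (k j) (outer_solution j) = b_fun j 0 * moment 2 0 k $ j - c_fun j 0 * moment 1 0 k $ j"
proof -
  have "inner_on {v..vj j} (k j) (outer_solution j)
      = (LINT x:{v..vj j}|lborel. b_fun j 0 * dotp (col j 0 2 x) (k j x) - c_fun j 0 * dotp (col j 0 1 x) (k j x))"
    by (simp add: inner_on_def cnj_pair_outer_solution)
       (simp add: outer_solution_def dotp_commute[of "k j _"] dotp.diff_left)
  also have "\<dots> = (LINT x:{v..vj j}|lborel. b_fun j 0 * dotp (col j 0 2 x) (k j x))
      - (LINT x:{v..vj j}|lborel. c_fun j 0 * dotp (col j 0 1 x) (k j x))"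
    by (intro set_integral_diff(2) set_integrable_mult_right set_integrable_dotp continuous_on_col
        edge_integrable_L2G assms)
  finally show ?thesis by (simp add: moment_def col_moment_def)
qed

lemma graph_solution_0_in_Dmax_iff:
  assumes "L2G v vj k"
  shows "graph_solution 0 \<xi> k \<in> D_max \<longleftrightarrow>
    (\<forall>j. inner_on {v..vj j} (k j) (outer_solution j) = fst \<xi> $ j * b_fun j 0 + snd \<xi> $ j * c_fun j 0)"
  by (auto simp: graph_solution_in_Dmax_iff[OF assms] inner_on_outer_solution[OF assms] algebra_simps)

lemma boundary_surj: obtains f where "f \<in> D_max" "boundary f = \<xi>"
proof -
  define t where "t j = (fst \<xi> $ j * b_fun j 0 + snd \<xi> $ j * c_fun j 0)
      / inner_on {v..vj j} (outer_solution j) (outer_solution j)" for j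
  define k where "k j x = cs (t j) (outer_solution j x)" for j x
  have k: "L2G v vj k"
    by (simp add: L2G_iff k_def[abs_def] square_integrable_cs square_integrable_outer_solution)
  have "inner_on {v..vj j} (k j) (outer_solution j) = fst \<xi> $ j * b_fun j 0 + snd \<xi> $ j * c_fun j 0" for j
    using inner_on_outer_solution_nonzero[of j] by (simp add: k_def[abs_def] inner_on_def t_def)
  then have "graph_solution 0 \<xi> k \<in> D_max"
    by (simp add: graph_solution_0_in_Dmax_iff[OF k])
  then show thesis by (rule that) simp
qed

lemma graph_solution_0_in_Smin:
  assumes k: "L2G v vj k" and "\<And>j. inner_on {v..vj j} (k j) (outer_solution j) = 0"
  shows "represents (graph_solution 0 0 k) (graph_solution 0 0 k, k)" "(graph_solution 0 0 k, k) \<in> S_min"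
proof -
  have "graph_solution 0 0 k \<in> D_max"
    by (simp add: graph_solution_0_in_Dmax_iff[OF k] assms(2))
  then show "represents (graph_solution 0 0 k) (graph_solution 0 0 k, k)"
    using eqG_Hop_graph_solution[OF k, of 0 0] k by (simp add: represents_def Dmax_L2G eqG_sym)
  then show "(graph_solution 0 0 k, k) \<in> S_min"
    unfolding Smin_eq boundary_relation_def by fastforce
qed

lemma multiple_of_outer_solution:
  assumes d: "L2G v vj d"
    and orthogonal: "\<And>k. L2G v vj k \<Longrightarrow> (\<And>j. inner_on {v..vj j} (k j) (outer_solution j) = 0) \<Longrightarrow> innerG v vj k d = 0"
  obtains \<kappa> where "eqG v vj d (\<lambda>j x. cs (\<kappa> j) (outer_solution j x))"
proof -
  let ?I = "\<lambda>j. inner_on {v..vj j}" and ?s = outer_solution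
  note L2 = d[unfolded L2G_iff, rule_format] square_integrable_outer_solution
  define \<kappa> where "\<kappa> j = ?I j (d j) (?s j) / ?I j (?s j) (?s j)" for j
  define k where "k j x = d j x - cs (\<kappa> j) (?s j x)" for j x
  have L2_k: "square_integrable {v..vj j} (k j)" for j
    unfolding k_def[abs_def] by (intro square_integrable_diff square_integrable_cs L2)
  have k_orthogonal: "?I j (k j) (?s j) = 0" for j
    unfolding k_def[abs_def] inner_on_diff_cs_left[OF L2 L2(2)]
    using inner_on_outer_solution_nonzero[of j] by (simp add: \<kappa>_def)
  have inner_k: "?I j (k j) (d j) = ?I j (k j) (k j)" for j
    using inner_on_diff_cs_right[OF L2 L2_k, of j "\<kappa> j"] k_orthogonal by (simp flip: k_def)
  have "(\<Sum>j\<in>UNIV. LINT x:{v..vj j}|lborel. (norm (k j x))\<^sup>2) = 0"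
    using orthogonal[of k] L2_k k_orthogonal
    by (simp add: L2G_iff innerG_eq_sum inner_k inner_on_self flip: of_real_sum)
  then have "(LINT x:{v..vj j}|lborel. (norm (k j x))\<^sup>2) = 0" for j
    by (subst (asm) sum_nonneg_eq_0_iff) (auto intro: LINT_Icc_nonneg)
  then have "AE x\<in>{v..vj j} in lborel. k j x = 0" for j
    by (intro inner_on_self_eq_0[OF L2_k]) (simp add: inner_on_self)
  then have "eqG v vj d (\<lambda>j x. cs (\<kappa> j) (outer_solution j x))"
    by (simp add: eqG_def k_def)
  then show thesis by (rule that)
qed

lemma adjG_Smin_represented:
  assumes adjoint: "(g, h) \<in> adjG v vj S_min"
  obtains g0 where "represents g0 (g, h)"
proof -
  have L2: "L2G v vj g" "L2G v vj h" using adjoint by (auto simp: adjG_def)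
  define \<xi> where "\<xi> = (moment 2 0 h, - moment 1 0 h)"
  define w where "w = graph_solution 0 \<xi> h"
  have w: "w \<in> D_max" "eqG v vj (Hop p q w) h"
    using eqG_Hop_graph_solution[OF L2(2), of 0 \<xi>] by (simp_all add: w_def graph_solution_in_Dmax_iff[OF L2(2)] \<xi>_def)
  have w_represents: "represents w (w, h)"
    using w L2 by (simp add: represents_def Dmax_L2G eqG_sym)
  define d where "d j x = g j x - w j x" for j x
  have "L2G v vj d"
    using L2(1) Dmax_L2G(1)[OF w(1)] by (simp add: d_def[abs_def] L2G_iff square_integrable_diff)
  moreover have "innerG v vj k d = 0"
    if k: "L2G v vj k" and orthogonal: "\<And>j. inner_on {v..vj j} (k j) (outer_solution j) = 0" for k
  proof -
    have "innerG v vj k g = innerG v vj (graph_solution 0 0 k) h"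
      using adjoint graph_solution_0_in_Smin(2)[OF k orthogonal] by (auto simp: adjG_def)
    also have "\<dots> = innerG v vj k w"
      using green_represents[OF graph_solution_0_in_Smin(1)[OF k orthogonal] w_represents]
      by (simp add: symplectic_form_def cdot_simps)
    finally show ?thesis
      using k L2(1) Dmax_L2G(1)[OF w(1)]
      by (simp add: innerG_eq_sum d_def[abs_def] L2G_iff inner_on_diff_cs_right[where c = 1, simplified] sum_subtractf)
  qed
  ultimately obtain \<kappa> where \<kappa>: "eqG v vj d (\<lambda>j x. cs (\<kappa> j) (outer_solution j x))"
    by (rule multiple_of_outer_solution)
  define \<eta> where "\<eta> = (\<chi> j. - (\<kappa> j * c_fun j 0), \<chi> j. \<kappa> j * b_fun j 0)"
  define g0 where "g0 = graph_solution 0 (\<xi> + \<eta>) h"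
  have g0_eq: "g0 j x = w j x + cs (\<kappa> j) (outer_solution j x)" for j x
    by (simp add: g0_def w_def graph_solution_def edge_solution_def outer_solution_def \<eta>_def prod_eq_iff algebra_simps)
  show thesis
  proof (rule that)
    have "g0 \<in> D_max" by (simp add: g0_def graph_solution_in_Dmax_iff[OF L2(2)] \<xi>_def \<eta>_def)
    moreover have "eqG v vj g g0" using \<kappa> by (simp add: eqG_def d_def g0_eq algebra_simps)
    moreover have "eqG v vj h (Hop p q g0)"
      using eqG_Hop_graph_solution[OF L2(2), of 0 "\<xi> + \<eta>"] by (simp add: g0_def eqG_sym)
    ultimately show "represents g0 (g, h)" using L2 by (simp add: represents_def)
  qed
qed

definition boundary_values :: "('n gfun \<times> 'n gfun) set \<Rightarrow> ((complex^'n) \<times> (complex^'n)) set" where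
  "boundary_values T = {boundary f0 | f0 t. t \<in> T \<and> represents f0 t}"

lemma represents_boundary_unique:
  assumes "represents f0 t" "represents f1 t"
  shows "boundary f0 = boundary f1"
proof (rule symplectic_form_nondegenerate)
  fix x
  obtain g where g: "g \<in> D_max" "boundary g = x" by (rule boundary_surj)
  obtain f h where "t = (f, h)" by fastforce
  then show "symplectic_form x (boundary f0) = symplectic_form x (boundary f1)"
    using green_represents[OF represents_Hop[OF g(1)]] assms g(2) by metis
qed

lemma boundary_values_boundary_relation: "boundary_values (boundary_relation L) = L"
proof (intro set_eqI iffI)
  fix x assume "x \<in> boundary_values (boundary_relation L)"
  then obtain f0 f1 t where "x = boundary f0" "represents f0 t" "represents f1 t" "boundary f1 \<in> L"
    unfolding boundary_values_def boundary_relation_def by blast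
  then show "x \<in> L" using represents_boundary_unique by metis
next
  fix x assume "x \<in> L"
  moreover obtain f where "f \<in> D_max" "boundary f = x" by (rule boundary_surj)
  ultimately have "represents f (f, Hop p q f)" "(f, Hop p q f) \<in> boundary_relation L" "x = boundary f"
    using represents_Hop[of f] by (auto simp: boundary_relation_def)
  then show "x \<in> boundary_values (boundary_relation L)"
    unfolding boundary_values_def by blast
qed

theorem adjG_eq_boundary_relation:
  assumes extension: "S_min \<subseteq> T" and represented: "\<And>t. t \<in> T \<Longrightarrow> \<exists>f0. represents f0 t"
  shows "adjG v vj T = boundary_relation (symplectic_complement (boundary_values T))"
proof -
  have "gk \<in> adjG v vj T \<longleftrightarrow> boundary g0 \<in> symplectic_complement (boundary_values T)" if g0: "represents g0 gk" for g0 gk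
  proof -
    obtain g k where gk: "gk = (g, k)" by fastforce
    have "innerG v vj h g = innerG v vj f k
        \<longleftrightarrow> (\<forall>f0. represents f0 (f, h) \<longrightarrow> symplectic_form (boundary f0) (boundary g0) = 0)" if "(f, h) \<in> T" for f h
      using represented[OF that] green_represents[OF _ g0[unfolded gk], of _ f h] by (metis eq_iff_diff_eq_0)
    then have "gk \<in> adjG v vj T
        \<longleftrightarrow> (\<forall>t\<in>T. \<forall>f0. represents f0 t \<longrightarrow> symplectic_form (boundary f0) (boundary g0) = 0)"
      using g0 by (auto simp: gk adjG_def represents_def)
    then show ?thesis
      unfolding symplectic_complement_def boundary_values_def by blast
  qed
  moreover have "\<exists>g0. represents g0 gk" if "gk \<in> adjG v vj T" for gk
    using that adjG_antimono[OF extension] adjG_Smin_represented by (cases gk) blast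
  ultimately show ?thesis
    unfolding boundary_relation_def by blast
qed

theorem self_adjoint_ext_Smin_iff:
  "self_adjoint_ext v vj S_min T \<longleftrightarrow> (\<exists>L. symplectic_complement L = L \<and> T = boundary_relation L)"
proof
  assume "\<exists>L. symplectic_complement L = L \<and> T = boundary_relation L"
  then obtain L where L: "symplectic_complement L = L" "T = boundary_relation L" by blast
  have "0 \<in> L"
    using lagrangian_zero[OF L(1)] .
  then have "S_min \<subseteq> T"
    by (simp add: L(2) Smin_eq boundary_relation_mono)
  moreover have "adjG v vj T = T"
    using adjG_eq_boundary_relation[OF \<open>S_min \<subseteq> T\<close>]
    by (simp add: L boundary_values_boundary_relation) (auto simp: boundary_relation_def)
  ultimately show "self_adjoint_ext v vj S_min T" by (simp add: self_adjoint_ext_def)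
next
  assume "self_adjoint_ext v vj S_min T"
  then have extension: "S_min \<subseteq> T" and self_adjoint: "adjG v vj T = T"
    by (simp_all add: self_adjoint_ext_def)
  have "\<exists>f0. represents f0 t" if "t \<in> T" for t
    using that adjG_antimono[OF extension] self_adjoint adjG_Smin_represented by (cases t) blast
  from adjG_eq_boundary_relation[OF extension this]
  have T: "T = boundary_relation (symplectic_complement (boundary_values T))"
    unfolding self_adjoint by blast
  then have "boundary_values T = symplectic_complement (boundary_values T)"
    using boundary_values_boundary_relation by metis
  with T show "\<exists>L. symplectic_complement L = L \<and> T = boundary_relation L" by metis
qed

lemma TAB_eq_boundary_relation: "TAB v vj p q \<alpha> A B = boundary_relation (boundary_kernel A B)"
  unfolding opRel_eq_boundary_relation[symmetric] TAB_def by (simp add: boundary_kernel_def boundary_def)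

theorem self_adjoint_ext_iff_TAB:
  "self_adjoint_ext v vj S_min T \<longleftrightarrow>
     (\<exists>A B :: complex^'n^'n. rank (hcat A B) = CARD('n) \<and> A ** adjm B = B ** adjm A \<and> T = TAB v vj p q \<alpha> A B)"
proof
  assume "self_adjoint_ext v vj S_min T"
  then obtain L where L: "symplectic_complement L = L" "T = boundary_relation L"
    by (auto simp: self_adjoint_ext_Smin_iff)
  show "\<exists>A B :: complex^'n^'n. rank (hcat A B) = CARD('n) \<and> A ** adjm B = B ** adjm A \<and> T = TAB v vj p q \<alpha> A B"
    using lagrangian_eq_boundary_kernel[OF L(1)] unfolding L(2) TAB_eq_boundary_relation by metis
next
  assume "\<exists>A B :: complex^'n^'n. rank (hcat A B) = CARD('n) \<and> A ** adjm B = B ** adjm A \<and> T = TAB v vj p q \<alpha> A B"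
  then show "self_adjoint_ext v vj S_min T"
    unfolding self_adjoint_ext_Smin_iff TAB_eq_boundary_relation
    using symplectic_complement_boundary_kernel by blast
qed

end

section \<open>The resolvent\<close>

lemma matrix_inv_left: "invertible N \<Longrightarrow> matrix_inv N ** N = mat 1"
  and matrix_inv_right: "invertible N \<Longrightarrow> N ** matrix_inv N = mat 1" for N :: "'a::semiring_1^'n^'n"
  unfolding invertible_def matrix_inv_def by (rule someI2_ex, assumption, blast)+

lemma matrix_vector_mult_eq_iff:
  fixes N :: "'a::comm_ring_1^'n^'n"
  assumes "invertible N"
  shows "N *v x = y \<longleftrightarrow> x = matrix_inv N *v y"
  using matrix_inv_left[OF assms] matrix_inv_right[OF assms] by (metis matrix_vector_mul_assoc matrix_vector_mul_lid)

lemma invertible_if_trivial_kernel: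
  fixes N :: "'a::field^'n^'n"
  assumes "\<And>x. N *v x = 0 \<Longrightarrow> x = 0"
  shows "invertible N"
  using assms by (simp add: invertible_left_inverse matrix_left_invertible_ker)

context star
begin

abbreviation "m_fun \<equiv> mfun v vj p q \<alpha>"
abbreviation "M \<equiv> Mmat v vj p q \<alpha>"

abbreviation zero_gfun :: "'n gfun" where
  "zero_gfun \<equiv> \<lambda>_ _. 0"

definition resolvent_pair :: "complex \<Rightarrow> 'n gfun \<Rightarrow> 'n gfun \<Rightarrow> 'n gfun \<times> 'n gfun" where
  "resolvent_pair z f g = (f, \<lambda>j x. addp (g j x) (cs z (f j x)))"

lemma M_nth [simp]: "(M z *v x) $ j = m_fun j z * x $ j"
  by (simp add: matrix_vector_mult_def Mmat_def if_distrib[of "\<lambda>c. c * _"] cong: if_cong)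

lemma m_fun_cnj: "m_fun j (cnj z) = cnj (m_fun j z)"
  by (simp add: mfun_def b_fun_cnj c_fun_cnj)

lemma L2G_zero [simp]: "L2G v vj zero_gfun"
  by (simp add: L2G_iff continuous_on_imp_square_integrable)

lemma moment_zero [simp]: "moment b z zero_gfun = 0"
  by (simp add: moment_def vec_eq_iff)

lemma normG_power2: "(normG v vj f)\<^sup>2 = (\<Sum>j\<in>UNIV. LINT x:{v..vj j}|lborel. (norm (f j x))\<^sup>2)"
  and innerG_self: "innerG v vj f f = of_real ((normG v vj f)\<^sup>2)"
  and normG_nonneg: "0 \<le> normG v vj f"
proof -
  have inner: "innerG v vj f f = of_real (\<Sum>j\<in>UNIV. LINT x:{v..vj j}|lborel. (norm (f j x))\<^sup>2)"
    by (simp add: innerG_eq_sum inner_on_self)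
  have "0 \<le> (\<Sum>j\<in>UNIV. LINT x:{v..vj j}|lborel. (norm (f j x))\<^sup>2)"
    by (intro sum_nonneg LINT_Icc_nonneg) simp
  then show norm: "(normG v vj f)\<^sup>2 = (\<Sum>j\<in>UNIV. LINT x:{v..vj j}|lborel. (norm (f j x))\<^sup>2)" and "0 \<le> normG v vj f"
    unfolding normG_def inner by simp_all
  show "innerG v vj f f = of_real ((normG v vj f)\<^sup>2)" unfolding inner norm ..
qed

lemma boundary_eq_0_if_normG_eq_0:
  assumes abs_continuous: "\<And>j. edge_abs_continuous j (f j)" and "normG v vj f = 0"
  shows "boundary f = 0"
proof -
  have "(\<Sum>j\<in>UNIV. LINT x:{v..vj j}|lborel. (norm (f j x))\<^sup>2) = 0"
    using assms(2) by (simp flip: normG_power2)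
  then have "(LINT x:{v..vj j}|lborel. (norm (f j x))\<^sup>2) = 0" for j
    by (subst (asm) sum_nonneg_eq_0_iff) (auto intro: LINT_Icc_nonneg)
  then have "f j v = 0" for j
    using edges[of j]
    by (intro inner_on_self_eq_0_continuous[OF edges abs_continuous_on_imp_continuous_on[OF abs_continuous]])
       (simp_all add: inner_on_self)
  then show ?thesis by (simp add: prod_eq_iff vec_eq_iff)
qed

lemma resolvent_pair_in_boundary_relation_iff:
  assumes g: "L2G v vj g"
  shows "resolvent_pair z f g \<in> boundary_relation L \<longleftrightarrow>
    L2G v vj f \<and> (\<exists>\<xi>\<in>L. graph_solution z \<xi> g \<in> D_max \<and> eqG v vj f (graph_solution z \<xi> g))"
proof (intro iffI conjI; (elim conjE bexE)?)
  assume "resolvent_pair z f g \<in> boundary_relation L"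
  then obtain f0 where f0: "f0 \<in> D_max" "boundary f0 \<in> L" "L2G v vj f" "eqG v vj f f0"
    "eqG v vj (\<lambda>j x. g j x + cs z (f j x)) (Hop p q f0)"
    by (auto simp: boundary_relation_def represents_def resolvent_pair_def)
  show "L2G v vj f" by (rule f0)
  have "eqG v vj (Hop p q f0) (\<lambda>j x. g j x + cs z (f0 j x))"
    by (rule eqG_trans[OF eqG_sym[OF f0(5)] eqG_add_cs[OF eqG_refl f0(4)]])
  note eq = Dmax_eq_graph_solution[OF f0(1) g this]
  have "outer_bc j (graph_solution z (boundary f0) g j (vj j)) = 0" for j
  proof -
    have "f0 j (vj j) = graph_solution z (boundary f0) g j (vj j)" using edges[of j] by (intro eq) simp
    then show ?thesis using f0(1) unfolding Dmax_iff by metis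
  qed
  then have "graph_solution z (boundary f0) g \<in> D_max"
    by (simp add: graph_solution_in_Dmax_iff[OF g] outer_bc_graph_solution)
  moreover have "eqG v vj f (graph_solution z (boundary f0) g)"
    by (rule eqG_trans[OF f0(4)]) (simp add: eqG_def eq)
  ultimately show "\<exists>\<xi>\<in>L. graph_solution z \<xi> g \<in> D_max \<and> eqG v vj f (graph_solution z \<xi> g)"
    using f0(2) by blast
next
  fix \<xi> assume f: "L2G v vj f" "eqG v vj f (graph_solution z \<xi> g)" and \<xi>: "\<xi> \<in> L" "graph_solution z \<xi> g \<in> D_max"
  have "eqG v vj (\<lambda>j x. g j x + cs z (f j x)) (Hop p q (graph_solution z \<xi> g))"
    by (rule eqG_trans[OF eqG_add_cs[OF eqG_refl f(2)] eqG_sym[OF eqG_Hop_graph_solution[OF g]]])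
  then have "represents (graph_solution z \<xi> g) (resolvent_pair z f g)"
    using f \<xi>(2) g by (simp add: represents_def resolvent_pair_def L2G_add_cs)
  then show "resolvent_pair z f g \<in> boundary_relation L"
    using \<xi>(1) by (auto simp: boundary_relation_def)
qed

lemma energy_identity:
  assumes "graph_solution z \<xi> zero_gfun \<in> D_max"
  shows "(z - cnj z) * of_real ((normG v vj (graph_solution z \<xi> zero_gfun))\<^sup>2) = symplectic_form \<xi> \<xi>"
proof -
  let ?f = "graph_solution z \<xi> zero_gfun"
  note L2 = Dmax_L2G[OF assms]
  have zf: "L2G v vj (\<lambda>j x. cs z (?f j x))" using L2(1) by (simp add: L2G_iff square_integrable_cs)
  have Hop_f: "eqG v vj (Hop p q ?f) (\<lambda>j x. cs z (?f j x))"
    using eqG_Hop_graph_solution[OF L2G_zero, of z \<xi>] by simp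
  have "innerG v vj (Hop p q ?f) ?f = innerG v vj (\<lambda>j x. cs z (?f j x)) ?f"
    "innerG v vj ?f (Hop p q ?f) = innerG v vj ?f (\<lambda>j x. cs z (?f j x))"
    using L2 zf Hop_f by (auto intro!: innerG_cong)
  moreover have "innerG v vj (\<lambda>j x. cs z (?f j x)) ?f = z * innerG v vj ?f ?f"
    "innerG v vj ?f (\<lambda>j x. cs z (?f j x)) = cnj z * innerG v vj ?f ?f"
    by (simp_all add: innerG_eq_sum inner_on_def sum_distrib_left)
  ultimately show ?thesis
    using green[OF assms assms] by (simp add: innerG_self algebra_simps)
qed

lemma eigenvector_eq_0_if_isotropic:
  assumes "Im z \<noteq> 0" "symplectic_form \<xi> \<xi> = 0" "graph_solution z \<xi> zero_gfun \<in> D_max"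
  shows "\<xi> = 0"
proof -
  have "z - cnj z \<noteq> 0" using assms(1) by (simp add: complex_eq_iff)
  then have "normG v vj (graph_solution z \<xi> zero_gfun) = 0"
    using energy_identity[OF assms(3)] assms(2) by simp
  from boundary_eq_0_if_normG_eq_0[OF edge_abs_continuous_graph_solution[OF L2G_zero] this] show ?thesis by simp
qed

lemma eigenvector_eq_0_if_in_resolvent:
  assumes resolvent: "in_resolvent v vj (boundary_relation L) z"
    and \<xi>: "\<xi> \<in> L" "graph_solution z \<xi> zero_gfun \<in> D_max"
  shows "\<xi> = 0"
proof -
  let ?f = "graph_solution z \<xi> zero_gfun"
  obtain C where C: "\<And>f g. resolvent_pair z f g \<in> boundary_relation L \<Longrightarrow> normG v vj f \<le> C * normG v vj g"
    using resolvent unfolding in_resolvent_def resolvent_pair_def by blast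
  have "resolvent_pair z ?f zero_gfun \<in> boundary_relation L"
    using \<xi> by (auto simp: resolvent_pair_in_boundary_relation_iff[OF L2G_zero] L2G_graph_solution)
  moreover have "normG v vj zero_gfun = 0"
    by (simp add: normG_def innerG_eq_sum inner_on_def dotp.zero_left set_lebesgue_integral_def)
  ultimately have "normG v vj ?f = 0"
    using C[of ?f zero_gfun] normG_nonneg[of ?f] by simp
  from boundary_eq_0_if_normG_eq_0[OF edge_abs_continuous_graph_solution[OF L2G_zero] this] show ?thesis by simp
qed

lemma graph_solution_in_Dmax_iff_M:
  assumes g: "L2G v vj g" and c_fun: "\<And>j. c_fun j z \<noteq> 0"
  shows "graph_solution z \<xi> g \<in> D_max \<longleftrightarrow> snd \<xi> = M z *v (moment 2 z g - fst \<xi>) - moment 1 z g"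
proof -
  have "(fst \<xi> $ j - moment 2 z g $ j) * b_fun j z + (snd \<xi> $ j + moment 1 z g $ j) * c_fun j z
      = c_fun j z * (snd \<xi> $ j - (M z *v (moment 2 z g - fst \<xi>) - moment 1 z g) $ j)" for j
    using c_fun[of j] by (simp add: mfun_def field_simps)
  then show ?thesis
    using c_fun by (simp only: graph_solution_in_Dmax_iff[OF g]) (simp add: vec_eq_iff)
qed

lemma axis_eigenvector:
  assumes "c_fun j z = 0"
  shows "(0, axis j 1) \<in> boundary_kernel (mat 1) 0" "graph_solution z (0, axis j 1) zero_gfun \<in> D_max"
  using assms by (auto simp: boundary_kernel_def graph_solution_in_Dmax_iff axis_def)

lemma kernel_eigenvector:
  assumes "\<And>j. c_fun j z \<noteq> 0" "(B ** M z - A) *v x = 0"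
  shows "(x, - (M z *v x)) \<in> boundary_kernel A B" "graph_solution z (x, - (M z *v x)) zero_gfun \<in> D_max"
  using assms by (simp_all add: boundary_kernel_def graph_solution_in_Dmax_iff_M matrix_vector_mult_diff_rdistrib
      vec.neg vec.diff matrix_vector_mul_assoc)

lemma c_fun_nonzero_if_in_resolvent:
  assumes "in_resolvent v vj (TAB v vj p q \<alpha> (mat 1) 0) z"
  shows "c_fun j z \<noteq> 0"
  using eigenvector_eq_0_if_in_resolvent[OF assms[unfolded TAB_eq_boundary_relation], OF axis_eigenvector, of j]
  by (auto simp: prod_eq_iff)

lemma invertible_if_in_resolvent:
  assumes "\<And>j. c_fun j z \<noteq> 0" "in_resolvent v vj (TAB v vj p q \<alpha> A B) z"
  shows "invertible (B ** M z - A)"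
  using eigenvector_eq_0_if_in_resolvent[OF assms(2)[unfolded TAB_eq_boundary_relation], OF kernel_eigenvector[OF assms(1)]]
  by (intro invertible_if_trivial_kernel) (auto simp: prod_eq_iff)

lemma c_fun_nonzero_if_nonreal:
  assumes "Im z \<noteq> 0"
  shows "c_fun j z \<noteq> 0"
  using eigenvector_eq_0_if_isotropic[OF assms, of "(0, axis j 1)", OF _ axis_eigenvector(2)]
  by (auto simp: prod_eq_iff symplectic_form_def cdot_simps)

lemma invertible_if_nonreal:
  fixes A B :: "complex^'n^'n"
  assumes "rank (hcat A B) = CARD('n)" "A ** adjm B = B ** adjm A" "Im z \<noteq> 0"
  shows "invertible (B ** M z - A)"
proof (rule invertible_if_trivial_kernel)
  fix x assume "(B ** M z - A) *v x = 0"
  note eigenvector = kernel_eigenvector[OF c_fun_nonzero_if_nonreal[OF assms(3)] this]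
  have "symplectic_form (x, - (M z *v x)) (x, - (M z *v x)) = 0"
    using eigenvector(1) symplectic_complement_boundary_kernel[OF assms(1,2)] unfolding symplectic_complement_def by blast
  from eigenvector_eq_0_if_isotropic[OF assms(3) this eigenvector(2)] show "x = 0" by (simp add: prod_eq_iff)
qed

definition resolvent_trace :: "complex^'n^'n \<Rightarrow> complex^'n^'n \<Rightarrow> complex \<Rightarrow> 'n gfun \<Rightarrow> complex^'n" where
  "resolvent_trace A B z g = matrix_inv (B ** M z - A) *v (B *v (M z *v moment 2 z g - moment 1 z g))"

definition resolvent_boundary :: "complex^'n^'n \<Rightarrow> complex^'n^'n \<Rightarrow> complex \<Rightarrow> 'n gfun \<Rightarrow> (complex^'n) \<times> (complex^'n)" where
  "resolvent_boundary A B z g =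
    (resolvent_trace A B z g, M z *v (moment 2 z g - resolvent_trace A B z g) - moment 1 z g)"

lemma resolvent_boundary_unique:
  assumes g: "L2G v vj g" and c_fun: "\<And>j. c_fun j z \<noteq> 0" and invertible: "invertible (B ** M z - A)"
  shows "\<xi> \<in> boundary_kernel A B \<and> graph_solution z \<xi> g \<in> D_max \<longleftrightarrow> \<xi> = resolvent_boundary A B z g"
proof -
  let ?y = "B *v (M z *v moment 2 z g - moment 1 z g)"
  have "A *v x + B *v (M z *v (moment 2 z g - x) - moment 1 z g) = ?y - (B ** M z - A) *v x" for x
    by (simp add: vec.diff matrix_vector_mult_diff_rdistrib matrix_vector_mul_assoc)
  then have "A *v x + B *v (M z *v (moment 2 z g - x) - moment 1 z g) = 0 \<longleftrightarrow> x = resolvent_trace A B z g" for x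
    using matrix_vector_mult_eq_iff[OF invertible, of x ?y] by (auto simp: resolvent_trace_def)
  then show ?thesis
    by (cases \<xi>) (auto simp: boundary_kernel_def graph_solution_in_Dmax_iff_M[OF g c_fun] resolvent_boundary_def)
qed

theorem resolv_eq_graph_solution:
  assumes g: "L2G v vj g" and c_fun: "\<And>j. c_fun j z \<noteq> 0" and invertible: "invertible (B ** M z - A)"
  shows "eqG v vj (resolv (TAB v vj p q \<alpha> A B) z g) (graph_solution z (resolvent_boundary A B z g) g)"
proof -
  let ?T = "boundary_relation (boundary_kernel A B)" and ?\<xi> = "resolvent_boundary A B z g"
  note unique = resolvent_boundary_unique[OF assms]
  have "?\<xi> \<in> boundary_kernel A B" "graph_solution z ?\<xi> g \<in> D_max" using unique by blast+
  then have "resolvent_pair z (graph_solution z ?\<xi> g) g \<in> ?T"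
    using L2G_graph_solution[OF g] by (auto simp: resolvent_pair_in_boundary_relation_iff[OF g])
  then have "resolvent_pair z (resolv (TAB v vj p q \<alpha> A B) z g) g \<in> ?T"
    unfolding resolv_def TAB_eq_boundary_relation resolvent_pair_def
    by (rule someI[of "\<lambda>f. (f, \<lambda>j x. addp (g j x) (cs z (f j x))) \<in> ?T"])
  then obtain \<xi> where "\<xi> \<in> boundary_kernel A B" "graph_solution z \<xi> g \<in> D_max"
    "eqG v vj (resolv (TAB v vj p q \<alpha> A B) z g) (graph_solution z \<xi> g)"
    by (auto simp: resolvent_pair_in_boundary_relation_iff[OF g])
  then show ?thesis using unique[of \<xi>] by simp
qed

section \<open>Krein's formula\<close>

lemma graph_solution_diff:
  "graph_solution z \<xi> g j x - graph_solution z \<eta> zero_gfun j x = graph_solution z (\<xi> - \<eta>) g j x"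
  by (simp add: graph_solution_def edge_solution_def cs.diff_left cs.add_left algebra_simps)

lemma GammaZ_eq_graph_solution: "GammaZ v vj p q \<alpha> z c = graph_solution z (- c, M z *v c) zero_gfun"
  by (simp add: GammaZ_def graph_solution_def edge_solution_def fun_eq_iff prod_eq_iff col_def algebra_simps)

lemma inner_on_cs_left: "inner_on A (\<lambda>x. cs c (f x)) g = c * inner_on A f g"
  by (simp add: inner_on_def)

lemma inner_on_col_cnj: "inner_on {v..vj j} (col j (cnj z) b) (g j) = cnj (moment b z g $ j)"
proof -
  have "inner_on {v..vj j} (col j (cnj z) b) (g j)
      = (LINT x|lborel. cnj (indicator {v..vj j} x *\<^sub>R dotp (col j z b x) (g j x)))"
    unfolding inner_on_def set_lebesgue_integral_def
    by (intro Bochner_Integration.integral_cong) (simp_all add: dotp_def col_cnj)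
  then show ?thesis
    by (simp only: Bochner_Integration.integral_cnj moment_def col_moment_def set_lebesgue_integral_def vec_lambda_beta)
qed

lemma innerG_GammaZ:
  assumes g: "L2G v vj g"
  shows "innerG v vj (GammaZ v vj p q \<alpha> (cnj z) d) g = cdot d (M z *v moment 2 z g - moment 1 z g)"
  unfolding innerG_eq_sum cdot_def
proof (rule sum.cong[OF refl])
  fix j
  note L2 = continuous_on_imp_square_integrable[OF continuous_on_col, of j "cnj z"] g[unfolded L2G_iff, THEN spec, of j]
  have "GammaZ v vj p q \<alpha> (cnj z) d j
      = (\<lambda>x. cs (d $ j * cnj (m_fun j z)) (col j (cnj z) 2 x) - cs (d $ j) (col j (cnj z) 1 x))"
    by (simp add: GammaZ_def fun_eq_iff prod_eq_iff col_def m_fun_cnj algebra_simps)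
  then have "inner_on {v..vj j} (GammaZ v vj p q \<alpha> (cnj z) d j) (g j)
      = d $ j * cnj (m_fun j z) * cnj (moment 2 z g $ j) - d $ j * cnj (moment 1 z g $ j)"
    by (simp add: inner_on_diff_cs_left[OF square_integrable_cs[OF L2(1)] L2] inner_on_cs_left inner_on_col_cnj)
  then show "inner_on {v..vj j} (GammaZ v vj p q \<alpha> (cnj z) d j) (g j)
      = d $ j * cnj ((M z *v moment 2 z g - moment 1 z g) $ j)"
    by (simp add: algebra_simps)
qed

lemma Gamma_adj_eq:
  assumes "L2G v vj g"
  shows "Gamma_adj v vj p q \<alpha> (cnj z) g = M z *v moment 2 z g - moment 1 z g"
  unfolding Gamma_adj_def innerG_GammaZ[OF assms] cdot_def[symmetric]
  by (rule the_equality) (auto intro: cdot_nondegenerate)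

theorem krein_formula:
  assumes resolvent0: "in_resolvent v vj (TAB v vj p q \<alpha> (mat 1) 0) z"
    and resolvent: "in_resolvent v vj (TAB v vj p q \<alpha> A B) z" and g: "L2G v vj g"
  shows "eqG v vj (resolv (TAB v vj p q \<alpha> A B) z g)
     (\<lambda>j x. subp (resolv (TAB v vj p q \<alpha> (mat 1) 0) z g j x)
        (GammaZ v vj p q \<alpha> z ((matrix_inv (B ** M z - A) ** B) *v Gamma_adj v vj p q \<alpha> (cnj z) g) j x))"
proof -
  let ?R0 = "graph_solution z (resolvent_boundary (mat 1) 0 z g) g" and ?c = "resolvent_trace A B z g"
  have c_fun: "c_fun j z \<noteq> 0" for j by (rule c_fun_nonzero_if_in_resolvent[OF resolvent0])
  have invertible: "invertible (B ** M z - A)" by (rule invertible_if_in_resolvent[OF c_fun resolvent])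
  have invertible0: "invertible (0 ** M z - mat 1 :: complex^'n^'n)"
    by (rule invertible_if_in_resolvent[OF c_fun resolvent0])
  have trace: "(matrix_inv (B ** M z - A) ** B) *v Gamma_adj v vj p q \<alpha> (cnj z) g = ?c"
    by (simp add: Gamma_adj_eq[OF g] resolvent_trace_def matrix_vector_mul_assoc)
  have "resolvent_boundary A B z g = resolvent_boundary (mat 1) 0 z g - (- ?c, M z *v ?c)"
    by (simp add: resolvent_boundary_def resolvent_trace_def[of "mat 1" 0] vec.diff)
  then have "graph_solution z (resolvent_boundary A B z g) g = (\<lambda>j x. ?R0 j x - GammaZ v vj p q \<alpha> z ?c j x)"
    by (simp add: GammaZ_eq_graph_solution graph_solution_diff)
  moreover have "eqG v vj (\<lambda>j x. ?R0 j x - GammaZ v vj p q \<alpha> z ?c j x)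
      (\<lambda>j x. resolv (TAB v vj p q \<alpha> (mat 1) 0) z g j x - GammaZ v vj p q \<alpha> z ?c j x)"
    using resolv_eq_graph_solution[OF g c_fun invertible0] by (auto simp: eqG_def elim!: eventually_mono)
  ultimately show ?thesis
    using eqG_trans resolv_eq_graph_solution[OF g c_fun invertible] by (simp add: trace)
qed

end

section \<open>Dependence on the spectral parameter\<close>

lemma has_field_derivative_if_quadratic_remainder:
  fixes F :: "complex \<Rightarrow> complex"
  assumes "\<forall>\<^sub>F z in nhds z0. cmod (F z - F z0 - (z - z0) * D) \<le> C * (cmod (z - z0))\<^sup>2"
  shows "(F has_field_derivative D) (at z0)"
proof -
  have "\<forall>\<^sub>F z in at z0. norm ((F z - F z0) / (z - z0) - D) \<le> C * norm (z - z0)"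
    using eventually_nhds_conv_at[THEN iffD1, OF assms, THEN conjunct1] eventually_neq_at_within[of z0]
  proof eventually_elim
    case (elim z)
    then have "norm ((F z - F z0) / (z - z0) - D) = cmod (F z - F z0 - (z - z0) * D) / cmod (z - z0)"
      by (simp add: field_simps flip: norm_divide)
    with elim show ?case by (simp add: divide_le_eq power2_eq_square mult.assoc)
  qed
  moreover have "((\<lambda>z. C * norm (z - z0)) \<longlongrightarrow> C * norm (z0 - z0)) (at z0)"
    by (intro tendsto_intros)
  ultimately have "((\<lambda>z. (F z - F z0) / (z - z0) - D) \<longlongrightarrow> 0) (at z0)"
    using Lim_null_comparison[of "\<lambda>z. (F z - F z0) / (z - z0) - D" "\<lambda>z. C * norm (z - z0)" "at z0"] by simp
  then show ?thesis
    by (simp add: has_field_derivative_iff LIM_zero_iff)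
qed

lemma norm_fst_le_norm: "norm (fst u) \<le> norm u" and norm_snd_le_norm: "norm (snd u) \<le> norm u"
  using norm_fst_le[of "fst u" "snd u"] norm_snd_le[of "snd u" "fst u"] by simp_all

lemma norm_LINT_Icc_le:
  fixes \<phi> :: "real \<Rightarrow> 'a::{banach, second_countable_topology}"
  assumes \<phi>: "set_integrable lborel {a..x} \<phi>" and x: "x \<in> {a..b}" and bound: "\<And>t. t \<in> {a..x} \<Longrightarrow> norm (\<phi> t) \<le> C"
  shows "norm (LINT t:{a..x}|lborel. \<phi> t) \<le> (b - a) * C"
proof -
  have "norm (LINT t:{a..x}|lborel. \<phi> t) \<le> (LINT t:{a..x}|lborel. norm (\<phi> t))"
    by (rule set_integral_norm_bound[OF \<phi>])
  also have "\<dots> \<le> (LINT t:{a..x}|lborel. C)"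
    using bound by (intro set_integral_mono set_integrable_norm \<phi>) simp_all
  also have "\<dots> = (x - a) * C" using x by (simp add: set_lebesgue_integral_def)
  also have "\<dots> \<le> (b - a) * C"
    using x order_trans[OF norm_ge_zero bound[of a]] by (intro mult_right_mono) auto
  finally show ?thesis .
qed

context star
begin

lemma edge_integrable_continuous: "continuous_on {v..vj j} k \<Longrightarrow> edge_integrable j k"
  by (rule borel_integrable_atLeastAtMost')

lemma col_moment_diff:
  fixes k k' :: "real \<Rightarrow> complex \<times> complex"
  assumes "edge_integrable j k" "edge_integrable j k'" "x \<in> {v..vj j}"
  shows "col_moment j z b (\<lambda>t. k t - k' t) x = col_moment j z b k x - col_moment j z b k' x"
proof -
  have "set_integrable lborel {v..x} (\<lambda>t. dotp (col j z b t) (h t))" if "edge_integrable j h" for h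
    using assms(3) by (intro set_integrable_Icc_subset[OF set_integrable_dotp_col[OF that]]) auto
  from set_integral_diff(2)[OF this[OF assms(1)] this[OF assms(2)]] show ?thesis
    by (simp add: col_moment_def dotp.diff_right)
qed

lemma col_moment_cs: "col_moment j z b (\<lambda>t. cs c (k t)) x = c * col_moment j z b k x"
  by (simp add: col_moment_def)

lemma edge_solution_diff:
  fixes k k' :: "real \<Rightarrow> complex \<times> complex"
  assumes "edge_integrable j k" "edge_integrable j k'" "x \<in> {v..vj j}"
  shows "edge_solution j z 0 (\<lambda>t. k t - k' t) x = edge_solution j z 0 k x - edge_solution j z 0 k' x"
  by (simp add: edge_solution_def col_moment_diff[OF assms] cs.diff_left cs.add_left algebra_simps)

lemma col_bounded: obtains K where "0 < K" "\<And>b x. x \<in> {v..vj j} \<Longrightarrow> norm (col j z b x) \<le> K"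
proof -
  obtain C1 C2 where C: "\<And>x. x \<in> {v..vj j} \<Longrightarrow> norm (col j z 1 x) \<le> C1" "\<And>x. x \<in> {v..vj j} \<Longrightarrow> norm (col j z 2 x) \<le> C2"
    using continuous_on_Icc_norm_bounded[OF continuous_on_col] by metis
  show thesis
  proof (rule that[of "max 1 (max C1 C2)"])
    show "norm (col j z b x) \<le> max 1 (max C1 C2)" if "x \<in> {v..vj j}" for b x
      using C[OF that] exhaust_2[of b] by auto
  qed simp
qed

definition edge_solution_bound :: "'n \<Rightarrow> complex \<Rightarrow> real \<Rightarrow> bool" where
  "edge_solution_bound j z C \<longleftrightarrow> (\<forall>k S x. continuous_on {v..vj j} k \<longrightarrow> (\<forall>t\<in>{v..vj j}. norm (k t) \<le> S) \<longrightarrow> x \<in> {v..vj j}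
    \<longrightarrow> norm (edge_solution j z 0 k x) \<le> C * S)"

lemma edge_solution_boundD:
  assumes "edge_solution_bound j z C" "continuous_on {v..vj j} k" "\<And>t. t \<in> {v..vj j} \<Longrightarrow> norm (k t) \<le> S" "x \<in> {v..vj j}"
  shows "norm (edge_solution j z 0 k x) \<le> C * S"
  using assms by (auto simp: edge_solution_bound_def)

lemma edge_solution_bound_exists: obtains C where "0 < C" "edge_solution_bound j z C"
proof -
  obtain K where K: "0 < K" "\<And>b x. x \<in> {v..vj j} \<Longrightarrow> norm (col j z b x) \<le> K" using col_bounded by blast
  show thesis
  proof (rule that[of "2 * ((vj j - v) * K * K)"])
    show "0 < 2 * ((vj j - v) * K * K)" using K(1) edges[of j] by simp
    show "edge_solution_bound j z (2 * ((vj j - v) * K * K))"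
      unfolding edge_solution_bound_def
    proof (intro allI impI)
      fix k :: "real \<Rightarrow> complex \<times> complex" and S x
      assume k: "continuous_on {v..vj j} k" "\<forall>t\<in>{v..vj j}. norm (k t) \<le> S" and x: "x \<in> {v..vj j}"
      have moment: "cmod (col_moment j z b k x) \<le> (vj j - v) * (K * S)" for b
        unfolding col_moment_def
      proof (rule norm_LINT_Icc_le[OF _ x])
        show "set_integrable lborel {v..x} (\<lambda>t. dotp (col j z b t) (k t))"
          using x by (intro set_integrable_Icc_subset[OF set_integrable_dotp_col[OF edge_integrable_continuous[OF k(1)]]]) auto
        show "cmod (dotp (col j z b t) (k t)) \<le> K * S" if "t \<in> {v..x}" for t
          using that x K(1) by (intro order_trans[OF norm_dotp_le] mult_mono K(2) k(2)[rule_format]) auto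
      qed
      have "norm (edge_solution j z 0 k x)
          \<le> cmod (col_moment j z 2 k x) * norm (col j z 1 x) + cmod (col_moment j z 1 k x) * norm (col j z 2 x)"
        using norm_triangle_ineq[of "cs (- col_moment j z 2 k x) (col j z 1 x)" "cs (col_moment j z 1 k x) (col j z 2 x)"]
        by (simp add: edge_solution_def norm_cs)
      also have "\<dots> \<le> (vj j - v) * (K * S) * K + (vj j - v) * (K * S) * K"
        using order_trans[OF norm_ge_zero moment] by (intro add_mono mult_mono moment K(2)[OF x]) auto
      finally show "norm (edge_solution j z 0 k x) \<le> 2 * ((vj j - v) * K * K) * S" by (simp add: algebra_simps)
    qed
  qed
qed

text \<open>A solution for \<^term>\<open>z\<close> solves the system for \<^term>\<open>z0\<close> with the inhomogeneity
  \<^term>\<open>z - z0\<close> times itself.\<close>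
lemma col_eq_add_edge_solution:
  assumes x: "x \<in> {v..vj j}"
  shows "col j z b x = col j z0 b x + cs (z - z0) (edge_solution j z0 0 (col j z b) x)"
proof -
  let ?k = "\<lambda>t. cs (z - z0) (col j z b t)"
  have "cs z u = cs (z - z0) u + cs z0 u" for u by (simp add: cs.diff_left)
  then have "solves j z0 ?k (col j z b)"
    using solves_col[of j z b] by (simp add: solves_def)
  moreover have "edge_integrable j ?k"
    by (intro edge_integrable_continuous cs.continuous_on continuous_on_const continuous_on_col)
  ultimately have "col j z b x = edge_solution j z0 (col j z b v) ?k x"
    using x by (rule variation_of_constants)
  then show ?thesis
    using exhaust_2[of b] by (auto simp: edge_solution_def col_moment_cs prod_eq_iff algebra_simps)
qed

lemma col_norm_le:
  assumes C: "edge_solution_bound j z0 C"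
    and K: "\<And>x. x \<in> {v..vj j} \<Longrightarrow> norm (col j z0 b x) \<le> K"
    and near: "cmod (z - z0) * C \<le> 1/2" and x: "x \<in> {v..vj j}"
  shows "norm (col j z b x) \<le> 2 * K"
proof -
  obtain y where y: "y \<in> {v..vj j}" "\<And>t. t \<in> {v..vj j} \<Longrightarrow> norm (col j z b t) \<le> norm (col j z b y)"
    using continuous_attains_sup[OF _ _ continuous_on_norm[OF continuous_on_col[of j z b]]] edges[of j] by auto
  have "norm (col j z b y) \<le> norm (col j z0 b y) + cmod (z - z0) * norm (edge_solution j z0 0 (col j z b) y)"
    by (subst col_eq_add_edge_solution[OF y(1), of z b z0]) (metis norm_cs norm_triangle_ineq)
  also have "\<dots> \<le> K + cmod (z - z0) * (C * norm (col j z b y))"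
    by (intro add_mono K y mult_left_mono edge_solution_boundD[OF C continuous_on_col]) auto
  also have "\<dots> \<le> K + 1/2 * norm (col j z b y)"
    using mult_right_mono[OF near norm_ge_zero] by (simp add: mult.assoc)
  finally show ?thesis using y(2)[OF x] by simp
qed

lemma col_remainder_norm_le:
  assumes C: "edge_solution_bound j z0 C"
    and K: "\<And>x. x \<in> {v..vj j} \<Longrightarrow> norm (col j z0 b x) \<le> K"
    and near: "cmod (z - z0) * C \<le> 1/2" and x: "x \<in> {v..vj j}"
  shows "norm (col j z b x - col j z0 b x - cs (z - z0) (edge_solution j z0 0 (col j z0 b) x))
    \<le> C * (C * (2 * K)) * (cmod (z - z0))\<^sup>2"
proof -
  have diff: "norm (col j z b t - col j z0 b t) \<le> cmod (z - z0) * (C * (2 * K))" if t: "t \<in> {v..vj j}" for t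
  proof -
    have "norm (edge_solution j z0 0 (col j z b) t) \<le> C * (2 * K)"
      by (rule edge_solution_boundD[OF C continuous_on_col col_norm_le[OF C K near] t])
    then show ?thesis
      by (subst col_eq_add_edge_solution[OF t, of z b z0]) (simp add: norm_cs mult_left_mono)
  qed
  have "col j z b x - col j z0 b x - cs (z - z0) (edge_solution j z0 0 (col j z0 b) x)
      = cs (z - z0) (edge_solution j z0 0 (\<lambda>t. col j z b t - col j z0 b t) x)"
    by (subst col_eq_add_edge_solution[OF x, of z b z0])
       (simp add: edge_solution_diff[OF edge_integrable_continuous edge_integrable_continuous x]
         continuous_on_col cs.diff_right)
  also have "norm \<dots> \<le> cmod (z - z0) * (C * (cmod (z - z0) * (C * (2 * K))))"
    unfolding norm_cs
    by (intro mult_left_mono norm_ge_zero edge_solution_boundD[OF C _ diff x] continuous_on_diff continuous_on_col)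
  finally show ?thesis by (simp add: power2_eq_square ac_simps)
qed

lemma eventually_small_multiple:
  fixes z0 :: complex
  assumes "0 < C"
  shows "\<forall>\<^sub>F z in nhds z0. cmod (z - z0) * C \<le> 1/2"
proof -
  have "\<forall>\<^sub>F z in nhds z0. dist z z0 \<le> 1 / (2 * C)"
    using assms by (auto simp: eventually_nhds_metric_le intro!: exI[of _ "1 / (2 * C)"])
  then show ?thesis
    by eventually_elim (use assms in \<open>simp add: dist_norm field_simps\<close>)
qed

lemma col_locally_bounded:
  obtains K where "0 < K" "\<forall>\<^sub>F z in nhds z0. \<forall>b. \<forall>x\<in>{v..vj j}. norm (col j z b x) \<le> K"
proof -
  obtain C where C: "0 < C" "edge_solution_bound j z0 C" by (rule edge_solution_bound_exists)
  obtain K where K: "0 < K" "\<And>b x. x \<in> {v..vj j} \<Longrightarrow> norm (col j z0 b x) \<le> K" using col_bounded by blast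
  show thesis
  proof (rule that)
    show "\<forall>\<^sub>F z in nhds z0. \<forall>b. \<forall>x\<in>{v..vj j}. norm (col j z b x) \<le> 2 * K"
      using eventually_small_multiple[OF C(1)]
    proof eventually_elim
      case (elim z)
      show ?case using col_norm_le[OF C(2) K(2) elim] by blast
    qed
  qed (use K(1) in simp)
qed

theorem col_expansion:
  obtains K where "\<forall>\<^sub>F z in nhds z0. \<forall>x\<in>{v..vj j}.
    norm (col j z b x - col j z0 b x - cs (z - z0) (edge_solution j z0 0 (col j z0 b) x)) \<le> K * (cmod (z - z0))\<^sup>2"
proof -
  obtain C where C: "0 < C" "edge_solution_bound j z0 C" by (rule edge_solution_bound_exists)
  obtain K where K: "0 < K" "\<And>b x. x \<in> {v..vj j} \<Longrightarrow> norm (col j z0 b x) \<le> K" using col_bounded by blast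
  show thesis
  proof (rule that)
    show "\<forall>\<^sub>F z in nhds z0. \<forall>x\<in>{v..vj j}.
        norm (col j z b x - col j z0 b x - cs (z - z0) (edge_solution j z0 0 (col j z0 b) x))
        \<le> C * (C * (2 * K)) * (cmod (z - z0))\<^sup>2"
      using eventually_small_multiple[OF C(1)]
    proof eventually_elim
      case (elim z)
      show ?case using col_remainder_norm_le[OF C(2) K(2) elim] by blast
    qed
  qed
qed

lemma col_moment_remainder_norm_le:
  assumes k: "edge_integrable j k" and x: "x \<in> {v..vj j}" and d: "continuous_on {v..vj j} d"
    and remainder: "\<And>t. t \<in> {v..vj j} \<Longrightarrow> norm (col j z b t - col j z0 b t - cs (z - z0) (d t)) \<le> C"
  shows "cmod (col_moment j z b k x - col_moment j z0 b k x - (z - z0) * (LINT t:{v..x}|lborel. dotp (d t) (k t)))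
    \<le> C * (LINT t:{v..x}|lborel. norm (k t))"
proof -
  let ?r = "\<lambda>t. col j z b t - col j z0 b t - cs (z - z0) (d t)"
  have xle: "x \<le> vj j" using x by simp
  have integrable: "set_integrable lborel {v..x} (\<lambda>t. dotp (u t) (k t))" if "continuous_on {v..vj j} u" for u
    by (rule set_integrable_Icc_subset[OF set_integrable_dotp(1)[OF that k] order.refl xle])
  have r: "set_integrable lborel {v..x} (\<lambda>t. dotp (?r t) (k t))"
    by (intro integrable continuous_on_diff cs.continuous_on continuous_on_const continuous_on_col d)
  have moment: "col_moment j z b k x - col_moment j z0 b k x - (z - z0) * (LINT t:{v..x}|lborel. dotp (d t) (k t))
      = (LINT t:{v..x}|lborel. dotp (?r t) (k t))"
    using integrable[OF continuous_on_col] integrable[OF d]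
    by (simp add: col_moment_def dotp.diff_left set_integral_diff set_integrable_mult_right)
  have "cmod (LINT t:{v..x}|lborel. dotp (?r t) (k t)) \<le> (LINT t:{v..x}|lborel. cmod (dotp (?r t) (k t)))"
    by (rule set_integral_norm_bound[OF r])
  also have "\<dots> \<le> (LINT t:{v..x}|lborel. C * norm (k t))"
  proof (rule set_integral_mono)
    show "set_integrable lborel {v..x} (\<lambda>t. cmod (dotp (?r t) (k t)))"
      by (rule set_integrable_norm[OF r])
    show "set_integrable lborel {v..x} (\<lambda>t. C * norm (k t))"
      by (rule set_integrable_mult_right[OF set_integrable_norm[OF set_integrable_Icc_subset[OF k order.refl xle]]])
    show "cmod (dotp (?r t) (k t)) \<le> C * norm (k t)" if "t \<in> {v..x}" for t
      by (rule order_trans[OF norm_dotp_le mult_right_mono[OF remainder norm_ge_zero]]) (use that xle in simp)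
  qed
  also have "\<dots> = C * (LINT t:{v..x}|lborel. norm (k t))" by simp
  finally show ?thesis unfolding moment .
qed

lemma col_moment_holomorphic:
  assumes k: "edge_integrable j k" and x: "x \<in> {v..vj j}"
  shows "(\<lambda>z. col_moment j z b k x) holomorphic_on UNIV"
proof -
  have "\<exists>D. ((\<lambda>z. col_moment j z b k x) has_field_derivative D) (at z0)" for z0
  proof -
    let ?d = "edge_solution j z0 0 (col j z0 b)"
    have "abs_continuous_on v (vj j) ?d"
      using solves_edge_solution[OF edge_integrable_continuous[OF continuous_on_col]] by (simp add: solves_def)
    then have d: "continuous_on {v..vj j} ?d" by (rule abs_continuous_on_imp_continuous_on)
    obtain K where "\<forall>\<^sub>F z in nhds z0. \<forall>x\<in>{v..vj j}.
        norm (col j z b x - col j z0 b x - cs (z - z0) (?d x)) \<le> K * (cmod (z - z0))\<^sup>2"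
      by (rule col_expansion)
    then have "\<forall>\<^sub>F z in nhds z0. cmod (col_moment j z b k x - col_moment j z0 b k x - (z - z0) * (LINT t:{v..x}|lborel. dotp (?d t) (k t)))
        \<le> (K * (LINT t:{v..x}|lborel. norm (k t))) * (cmod (z - z0))\<^sup>2"
    proof eventually_elim
      case (elim z)
      from col_moment_remainder_norm_le[OF k x d bspec[OF elim]] show ?case by (simp add: ac_simps)
    qed
    from has_field_derivative_if_quadratic_remainder[OF this] show ?thesis ..
  qed
  then show ?thesis by (simp add: holomorphic_on_open)
qed

lemma col_holomorphic:
  assumes x: "x \<in> {v..vj j}"
  shows "(\<lambda>z. fst (col j z b x)) holomorphic_on UNIV" "(\<lambda>z. snd (col j z b x)) holomorphic_on UNIV"
proof -
  have "((\<lambda>z. fst (col j z b x)) has_field_derivative fst (edge_solution j z0 0 (col j z0 b) x)) (at z0)"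
      "((\<lambda>z. snd (col j z b x)) has_field_derivative snd (edge_solution j z0 0 (col j z0 b) x)) (at z0)" for z0
  proof -
    let ?D = "edge_solution j z0 0 (col j z0 b) x"
    obtain K where "\<forall>\<^sub>F z in nhds z0. \<forall>x\<in>{v..vj j}.
        norm (col j z b x - col j z0 b x - cs (z - z0) (edge_solution j z0 0 (col j z0 b) x)) \<le> K * (cmod (z - z0))\<^sup>2"
      by (rule col_expansion)
    then have remainder: "\<forall>\<^sub>F z in nhds z0. norm (col j z b x - col j z0 b x - cs (z - z0) ?D) \<le> K * (cmod (z - z0))\<^sup>2"
      by eventually_elim (use x in blast)
    then have "\<forall>\<^sub>F z in nhds z0. cmod (fst (col j z b x) - fst (col j z0 b x) - (z - z0) * fst ?D) \<le> K * (cmod (z - z0))\<^sup>2"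
    proof eventually_elim
      case (elim z)
      from order_trans[OF norm_fst_le_norm elim] show ?case by simp
    qed
    then show "((\<lambda>z. fst (col j z b x)) has_field_derivative fst ?D) (at z0)"
      by (rule has_field_derivative_if_quadratic_remainder)
    have "\<forall>\<^sub>F z in nhds z0. cmod (snd (col j z b x) - snd (col j z0 b x) - (z - z0) * snd ?D) \<le> K * (cmod (z - z0))\<^sup>2"
      using remainder
    proof eventually_elim
      case (elim z)
      from order_trans[OF norm_snd_le_norm elim] show ?case by simp
    qed
    then show "((\<lambda>z. snd (col j z b x)) has_field_derivative snd ?D) (at z0)"
      by (rule has_field_derivative_if_quadratic_remainder)
  qed
  then show "(\<lambda>z. fst (col j z b x)) holomorphic_on UNIV" "(\<lambda>z. snd (col j z b x)) holomorphic_on UNIV"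
    unfolding holomorphic_on_open[OF open_UNIV] by blast+
qed

lemma b_fun_holomorphic: "b_fun j holomorphic_on UNIV" and c_fun_holomorphic: "c_fun j holomorphic_on UNIV"
proof -
  have "vj j \<in> {v..vj j}" using edges[of j] by simp
  note col = col_holomorphic[OF this]
  show "b_fun j holomorphic_on UNIV" "c_fun j holomorphic_on UNIV"
    unfolding outer_bc_col[symmetric, abs_def] outer_bc_def by (intro holomorphic_intros col)+
qed

end

section \<open>Entire families of operators\<close>

subsection \<open>Entire families with a dominating weight\<close>

definition entire_dominated :: "'s set \<Rightarrow> ('s \<Rightarrow> real) \<Rightarrow> (complex \<Rightarrow> 's \<Rightarrow> complex) \<Rightarrow> bool" where
  "entire_dominated S w \<Phi> \<longleftrightarrow> (\<forall>s\<in>S. (\<lambda>z. \<Phi> z s) holomorphic_on UNIV)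
     \<and> (\<forall>z0. \<exists>K. \<forall>\<^sub>F z in nhds z0. \<forall>s\<in>S. cmod (\<Phi> z s) \<le> K * w s)"

lemma entire_dominatedI:
  assumes "\<And>s. s \<in> S \<Longrightarrow> (\<lambda>z. \<Phi> z s) holomorphic_on UNIV"
    and "\<And>z0. \<exists>K. \<forall>\<^sub>F z in nhds z0. \<forall>s\<in>S. cmod (\<Phi> z s) \<le> K * w s"
  shows "entire_dominated S w \<Phi>"
  using assms by (simp add: entire_dominated_def)

lemma entire_dominated_holomorphic: "entire_dominated S w \<Phi> \<Longrightarrow> s \<in> S \<Longrightarrow> (\<lambda>z. \<Phi> z s) holomorphic_on UNIV"
  by (simp add: entire_dominated_def)

lemma entire_dominated_bound:
  assumes "entire_dominated S w \<Phi>"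
  obtains K where "\<forall>\<^sub>F z in nhds z0. \<forall>s\<in>S. cmod (\<Phi> z s) \<le> K * w s"
  using assms by (auto simp: entire_dominated_def)

lemma entire_dominated_reindex:
  assumes \<Phi>: "entire_dominated S w \<Phi>" and h: "\<And>t. t \<in> T \<Longrightarrow> h t \<in> S"
  shows "entire_dominated T (\<lambda>t. w (h t)) (\<lambda>z t. \<Phi> z (h t))"
proof (rule entire_dominatedI)
  show "(\<lambda>z. \<Phi> z (h t)) holomorphic_on UNIV" if "t \<in> T" for t
    by (rule entire_dominated_holomorphic[OF \<Phi> h[OF that]])
  fix z0
  obtain K where "\<forall>\<^sub>F z in nhds z0. \<forall>s\<in>S. cmod (\<Phi> z s) \<le> K * w s"
    by (rule entire_dominated_bound[OF \<Phi>])
  then have "\<forall>\<^sub>F z in nhds z0. \<forall>t\<in>T. cmod (\<Phi> z (h t)) \<le> K * w (h t)"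
    by eventually_elim (use h in blast)
  then show "\<exists>K. \<forall>\<^sub>F z in nhds z0. \<forall>t\<in>T. cmod (\<Phi> z (h t)) \<le> K * w (h t)" ..
qed

lemma entire_dominated_const: "entire_dominated S (\<lambda>_. 1) (\<lambda>_ _. c)"
  by (rule entire_dominatedI) (auto intro: exI[of _ "cmod c"])

lemma entire_dominated_add:
  assumes \<Phi>: "entire_dominated S w \<Phi>" and \<Psi>: "entire_dominated S w \<Psi>"
  shows "entire_dominated S w (\<lambda>z s. \<Phi> z s + \<Psi> z s)"
proof (rule entire_dominatedI)
  show "(\<lambda>z. \<Phi> z s + \<Psi> z s) holomorphic_on UNIV" if "s \<in> S" for s
    by (intro holomorphic_on_add entire_dominated_holomorphic[OF \<Phi> that] entire_dominated_holomorphic[OF \<Psi> that])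
  fix z0
  obtain K where "\<forall>\<^sub>F z in nhds z0. \<forall>s\<in>S. cmod (\<Phi> z s) \<le> K * w s"
    by (rule entire_dominated_bound[OF \<Phi>])
  moreover obtain L where "\<forall>\<^sub>F z in nhds z0. \<forall>s\<in>S. cmod (\<Psi> z s) \<le> L * w s"
    by (rule entire_dominated_bound[OF \<Psi>])
  ultimately have "\<forall>\<^sub>F z in nhds z0. \<forall>s\<in>S. cmod (\<Phi> z s + \<Psi> z s) \<le> (K + L) * w s"
    by eventually_elim (auto simp: distrib_right intro!: norm_triangle_le add_mono)
  then show "\<exists>K. \<forall>\<^sub>F z in nhds z0. \<forall>s\<in>S. cmod (\<Phi> z s + \<Psi> z s) \<le> K * w s" ..
qed

lemma entire_dominated_mult:
  assumes \<Phi>: "entire_dominated S u \<Phi>" and \<Psi>: "entire_dominated S w \<Psi>"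
  shows "entire_dominated S (\<lambda>s. u s * w s) (\<lambda>z s. \<Phi> z s * \<Psi> z s)"
proof (rule entire_dominatedI)
  show "(\<lambda>z. \<Phi> z s * \<Psi> z s) holomorphic_on UNIV" if "s \<in> S" for s
    by (intro holomorphic_on_mult entire_dominated_holomorphic[OF \<Phi> that] entire_dominated_holomorphic[OF \<Psi> that])
  fix z0
  obtain K where "\<forall>\<^sub>F z in nhds z0. \<forall>s\<in>S. cmod (\<Phi> z s) \<le> K * u s"
    by (rule entire_dominated_bound[OF \<Phi>])
  moreover obtain L where "\<forall>\<^sub>F z in nhds z0. \<forall>s\<in>S. cmod (\<Psi> z s) \<le> L * w s"
    by (rule entire_dominated_bound[OF \<Psi>])
  ultimately have "\<forall>\<^sub>F z in nhds z0. \<forall>s\<in>S. cmod (\<Phi> z s * \<Psi> z s) \<le> (K * L) * (u s * w s)"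
  proof eventually_elim
    case (elim z)
    show ?case
    proof
      fix s assume "s \<in> S"
      with elim have "cmod (\<Phi> z s) \<le> K * u s" "cmod (\<Psi> z s) \<le> L * w s" by blast+
      from mult_mono'[OF this norm_ge_zero norm_ge_zero]
      show "cmod (\<Phi> z s * \<Psi> z s) \<le> (K * L) * (u s * w s)" by (simp add: norm_mult ac_simps)
    qed
  qed
  then show "\<exists>K. \<forall>\<^sub>F z in nhds z0. \<forall>s\<in>S. cmod (\<Phi> z s * \<Psi> z s) \<le> K * (u s * w s)" ..
qed

lemma entire_dominated_deriv:
  assumes \<Phi>: "entire_dominated S w \<Phi>"
  shows "entire_dominated S w (\<lambda>z s. deriv (\<lambda>z. \<Phi> z s) z)"
proof (rule entire_dominatedI)
  show "deriv (\<lambda>z. \<Phi> z s) holomorphic_on UNIV" if "s \<in> S" for s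
    by (intro holomorphic_deriv entire_dominated_holomorphic[OF \<Phi> that] open_UNIV)
  fix z0
  obtain K where "\<forall>\<^sub>F z in nhds z0. \<forall>s\<in>S. cmod (\<Phi> z s) \<le> K * w s"
    by (rule entire_dominated_bound[OF \<Phi>])
  then obtain r where r: "0 < r" "\<And>z s. dist z z0 \<le> r \<Longrightarrow> s \<in> S \<Longrightarrow> cmod (\<Phi> z s) \<le> K * w s"
    by (auto simp: eventually_nhds_metric_le)
  have "cmod (deriv (\<lambda>z. \<Phi> z s) z) \<le> 2 * K / r * w s" if z: "dist z z0 \<le> r / 2" and s: "s \<in> S" for z s
  proof -
    have "cmod ((deriv ^^ 1) (\<lambda>z. \<Phi> z s) z) \<le> fact 1 * (K * w s) / (r / 2) ^ 1"
    proof (rule Cauchy_inequality)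
      show "cmod (\<Phi> y s) \<le> K * w s" if "cmod (z - y) = r / 2" for y
        using that z dist_triangle[of y z0 z] by (intro r(2) s) (simp add: dist_norm norm_minus_commute)
    qed (use r(1) entire_dominated_holomorphic[OF \<Phi> s] in
        \<open>auto intro: holomorphic_on_subset intro!: holomorphic_on_imp_continuous_on\<close>)
    then show ?thesis by (simp add: ac_simps)
  qed
  then show "\<exists>K. \<forall>\<^sub>F z in nhds z0. \<forall>s\<in>S. cmod (deriv (\<lambda>z. \<Phi> z s) z) \<le> K * w s"
    using r(1) by (intro exI[of _ "2 * K / r"]) (auto simp: eventually_nhds_metric_le intro!: exI[of _ "r / 2"])
qed

lemma norm_Taylor_remainder_le:
  assumes f: "f holomorphic_on UNIV" and bound: "\<And>z. dist z z0 \<le> r \<Longrightarrow> cmod (deriv (deriv f) z) \<le> B"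
    and z: "dist z z0 \<le> r"
  shows "cmod (f z - f z0 - (z - z0) * deriv f z0) \<le> B * (cmod (z - z0))\<^sup>2"
proof -
  have "cmod ((deriv ^^ 0) f z - (\<Sum>i\<le>1. (deriv ^^ i) f z0 * (z - z0) ^ i / fact i)) \<le> B * cmod (z - z0) ^ Suc 1 / fact 1"
  proof (rule complex_Taylor[where f = "\<lambda>i. (deriv ^^ i) f"])
    show "((deriv ^^ i) f has_field_derivative (deriv ^^ Suc i) f x) (at x within cball z0 r)" for i x
    proof -
      have "(deriv ^^ i) f holomorphic_on UNIV" by (rule holomorphic_higher_deriv[OF f open_UNIV])
      from holomorphic_derivI[OF this open_UNIV UNIV_I] show ?thesis
        by (simp add: has_field_derivative_at_within)
    qed
    show "cmod ((deriv ^^ Suc 1) f x) \<le> B" if "x \<in> cball z0 r" for x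
      using bound[of x] that by (simp add: dist_commute)
  qed (use z in \<open>auto simp: dist_commute intro: order_trans[OF zero_le_dist]\<close>)
  then show ?thesis by (simp add: power2_eq_square algebra_simps)
qed

lemma entire_dominated_expansion:
  assumes \<Phi>: "entire_dominated S w \<Phi>"
  obtains K where "\<forall>\<^sub>F z in nhds z0. \<forall>s\<in>S.
    cmod (\<Phi> z s - \<Phi> z0 s - (z - z0) * deriv (\<lambda>z. \<Phi> z s) z0) \<le> K * w s * (cmod (z - z0))\<^sup>2"
proof -
  obtain K where "\<forall>\<^sub>F z in nhds z0. \<forall>s\<in>S. cmod (deriv (deriv (\<lambda>z. \<Phi> z s)) z) \<le> K * w s"
    by (rule entire_dominated_bound[OF entire_dominated_deriv[OF entire_dominated_deriv[OF \<Phi>]]])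
  then obtain r where r: "0 < r" "\<And>z s. dist z z0 \<le> r \<Longrightarrow> s \<in> S \<Longrightarrow> cmod (deriv (deriv (\<lambda>z. \<Phi> z s)) z) \<le> K * w s"
    by (auto simp: eventually_nhds_metric_le)
  have "cmod (\<Phi> z s - \<Phi> z0 s - (z - z0) * deriv (\<lambda>z. \<Phi> z s) z0) \<le> K * w s * (cmod (z - z0))\<^sup>2"
    if "dist z z0 \<le> r" "s \<in> S" for z s
    by (rule norm_Taylor_remainder_le[OF entire_dominated_holomorphic[OF \<Phi> that(2)] r(2)[OF _ that(2)] that(1)])
  then show thesis
    using r(1) by (intro that[of K]) (auto simp: eventually_nhds_metric_le)
qed

lemma entire_dominated_difference_quotient:
  assumes "entire_dominated S w \<Phi>"
  obtains K where "\<forall>\<^sub>F z in at z0. \<forall>s\<in>S.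
    cmod ((\<Phi> z s - \<Phi> z0 s) / (z - z0) - deriv (\<lambda>z. \<Phi> z s) z0) \<le> K * w s * cmod (z - z0)"
proof -
  obtain K where "\<forall>\<^sub>F z in nhds z0. \<forall>s\<in>S.
      cmod (\<Phi> z s - \<Phi> z0 s - (z - z0) * deriv (\<lambda>z. \<Phi> z s) z0) \<le> K * w s * (cmod (z - z0))\<^sup>2"
    by (rule entire_dominated_expansion[OF assms])
  then have "\<forall>\<^sub>F z in at z0. \<forall>s\<in>S.
      cmod (\<Phi> z s - \<Phi> z0 s - (z - z0) * deriv (\<lambda>z. \<Phi> z s) z0) \<le> K * w s * (cmod (z - z0))\<^sup>2"
    by (simp add: eventually_nhds_conv_at)
  then have "\<forall>\<^sub>F z in at z0. \<forall>s\<in>S.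
      cmod ((\<Phi> z s - \<Phi> z0 s) / (z - z0) - deriv (\<lambda>z. \<Phi> z s) z0) \<le> K * w s * cmod (z - z0)"
    using eventually_neq_at_within[of z0]
  proof eventually_elim
    case (elim z)
    show ?case
    proof
      fix s assume s: "s \<in> S"
      have "(\<Phi> z s - \<Phi> z0 s) / (z - z0) - deriv (\<lambda>z. \<Phi> z s) z0
          = (\<Phi> z s - \<Phi> z0 s - (z - z0) * deriv (\<lambda>z. \<Phi> z s) z0) / (z - z0)"
        using elim(2) by (simp add: diff_divide_distrib)
      then show "cmod ((\<Phi> z s - \<Phi> z0 s) / (z - z0) - deriv (\<lambda>z. \<Phi> z s) z0) \<le> K * w s * cmod (z - z0)"
        using elim s by (simp add: norm_divide divide_le_eq power2_eq_square mult.assoc)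
    qed
  qed
  then show thesis by (rule that)
qed

lemma uniform_limit_difference_quotient:
  assumes "entire_dominated S (\<lambda>_. C) \<Phi>"
  shows "uniform_limit S (\<lambda>z s. (\<Phi> z s - \<Phi> z0 s) / (z - z0)) (\<lambda>s. deriv (\<lambda>z. \<Phi> z s) z0) (at z0)"
proof (rule uniform_limitI)
  fix e :: real assume "0 < e"
  obtain K where K: "\<forall>\<^sub>F z in at z0. \<forall>s\<in>S.
      cmod ((\<Phi> z s - \<Phi> z0 s) / (z - z0) - deriv (\<lambda>z. \<Phi> z s) z0) \<le> K * C * cmod (z - z0)"
    by (rule entire_dominated_difference_quotient[OF assms])
  have "((\<lambda>z. K * C * cmod (z - z0)) \<longlongrightarrow> K * C * cmod (z0 - z0)) (at z0)"
    by (intro tendsto_intros)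
  then have "\<forall>\<^sub>F z in at z0. K * C * cmod (z - z0) < e"
    by (rule order_tendstoD(2)) (use \<open>0 < e\<close> in simp)
  with K show "\<forall>\<^sub>F z in at z0. \<forall>s\<in>S. dist ((\<Phi> z s - \<Phi> z0 s) / (z - z0)) (deriv (\<lambda>z. \<Phi> z s) z0) < e"
    by eventually_elim (auto simp: dist_norm intro: le_less_trans)
qed

lemma LINT_norm_power2_le:
  fixes f :: "real \<Rightarrow> 'a::{banach, second_countable_topology}"
  assumes "a < b" and f: "square_integrable {a..b} f"
  shows "(LINT t:{a..b}|lborel. norm (f t))\<^sup>2 \<le> (b - a) * (LINT t:{a..b}|lborel. (norm (f t))\<^sup>2)"
proof -
  define I where "I = (LINT t:{a..b}|lborel. norm (f t))"
  define m where "m = I / (b - a)"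
  have I: "I = (b - a) * m" using assms(1) by (simp add: m_def)
  have norm: "set_integrable lborel {a..b} (\<lambda>t. norm (f t))"
    by (rule set_integrable_norm[OF square_integrable_imp_set_integrable[OF f]])
  have norm2: "set_integrable lborel {a..b} (\<lambda>t. (norm (f t))\<^sup>2)"
    using f by (simp add: square_integrable_def)
  have "0 \<le> (LINT t:{a..b}|lborel. (norm (f t) - m)\<^sup>2)"
    by (rule LINT_Icc_nonneg) simp
  also have "\<dots> = (LINT t:{a..b}|lborel. ((norm (f t))\<^sup>2 - 2 * m * norm (f t)) + m\<^sup>2)"
    by (simp add: power2_diff algebra_simps)
  also have "\<dots> = (LINT t:{a..b}|lborel. (norm (f t))\<^sup>2) - 2 * m * I + (b - a) * m\<^sup>2"
    using assms(1) norm norm2 set_integrable_mult_right[OF norm, of "2 * m"]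
    by (simp add: set_integral_add set_integral_diff I_def) (simp add: set_lebesgue_integral_def)
  also have "\<dots> = (LINT t:{a..b}|lborel. (norm (f t))\<^sup>2) - (b - a) * m\<^sup>2"
    by (simp add: I power2_eq_square)
  finally have "(b - a) * ((b - a) * m\<^sup>2) \<le> (b - a) * (LINT t:{a..b}|lborel. (norm (f t))\<^sup>2)"
    using assms(1) by (intro mult_left_mono) auto
  then show ?thesis unfolding I_def[symmetric] I by (simp add: power2_eq_square ac_simps)
qed

lemma LINT_Icc_mono_upper:
  fixes f :: "real \<Rightarrow> real"
  assumes "set_integrable lborel {a..b} f" "x \<in> {a..b}" "\<And>t. t \<in> {a..b} \<Longrightarrow> 0 \<le> f t"
  shows "(LINT t:{a..x}|lborel. f t) \<le> (LINT t:{a..b}|lborel. f t)"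
  using LINT_Icc_combine[OF assms(1), of x] LINT_Icc_nonneg[of x b f] assms(2,3) by simp

lemma eventually_bound_finite:
  fixes G :: "'i::finite \<Rightarrow> 'z \<Rightarrow> 's \<Rightarrow> real"
  assumes bound: "\<And>i. \<exists>K. \<forall>\<^sub>F z in N. \<forall>s\<in>S i. G i z s \<le> K * w z s" and nonneg: "\<And>z s. 0 \<le> w z s"
  shows "\<exists>K. \<forall>\<^sub>F z in N. \<forall>i. \<forall>s\<in>S i. G i z s \<le> K * w z s"
proof -
  obtain K where K: "\<And>i. \<forall>\<^sub>F z in N. \<forall>s\<in>S i. G i z s \<le> K i * w z s"
    using bound by metis
  have Max: "K i * w z s \<le> Max (range K) * w z s" for i z s
    by (intro mult_right_mono nonneg Max_ge) auto
  have "\<forall>\<^sub>F z in N. \<forall>s\<in>S i. G i z s \<le> Max (range K) * w z s" for i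
    by (rule eventually_mono[OF K]) (blast intro: order_trans[OF _ Max])
  then have "\<forall>\<^sub>F z in N. \<forall>i. \<forall>s\<in>S i. G i z s \<le> Max (range K) * w z s"
    by (rule eventually_all_finite)
  then show ?thesis ..
qed

context star
begin

subsection \<open>Entire families of linear maps into functions on an edge\<close>

definition entire_multiplier :: "'n \<Rightarrow> (complex \<Rightarrow> real \<Rightarrow> complex) \<Rightarrow> bool" where
  "entire_multiplier j \<psi> \<longleftrightarrow> entire_dominated {v..vj j} (\<lambda>_. 1) \<psi> \<and> (\<forall>z. continuous_on {v..vj j} (\<psi> z))"

definition entire_family :: "'n \<Rightarrow> (complex \<Rightarrow> 'n gfun \<Rightarrow> real \<Rightarrow> complex) \<Rightarrow> bool" where
  "entire_family j \<Phi> \<longleftrightarrow>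
     entire_dominated ({f. L2G v vj f} \<times> {v..vj j}) (\<lambda>(f, x). normG v vj f) (\<lambda>z (f, x). \<Phi> z f x)
   \<and> (\<forall>z f. L2G v vj f \<longrightarrow> continuous_on {v..vj j} (\<Phi> z f))
   \<and> (\<forall>z f g a b. L2G v vj f \<longrightarrow> L2G v vj g \<longrightarrow>
        (\<forall>x\<in>{v..vj j}. \<Phi> z (\<lambda>i t. cs a (f i t) + cs b (g i t)) x = a * \<Phi> z f x + b * \<Phi> z g x))"

lemma entire_familyI:
  assumes "\<And>f x. L2G v vj f \<Longrightarrow> x \<in> {v..vj j} \<Longrightarrow> (\<lambda>z. \<Phi> z f x) holomorphic_on UNIV"
    and "\<And>z0. \<exists>K. \<forall>\<^sub>F z in nhds z0. \<forall>f x. L2G v vj f \<longrightarrow> x \<in> {v..vj j} \<longrightarrow> cmod (\<Phi> z f x) \<le> K * normG v vj f"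
    and "\<And>z f. L2G v vj f \<Longrightarrow> continuous_on {v..vj j} (\<Phi> z f)"
    and "\<And>z f g a b x. L2G v vj f \<Longrightarrow> L2G v vj g \<Longrightarrow> x \<in> {v..vj j} \<Longrightarrow>
        \<Phi> z (\<lambda>i t. cs a (f i t) + cs b (g i t)) x = a * \<Phi> z f x + b * \<Phi> z g x"
  shows "entire_family j \<Phi>"
  using assms unfolding entire_family_def entire_dominated_def by (fastforce elim: eventually_mono)

lemma entire_familyD:
  assumes "entire_family j \<Phi>"
  shows "entire_dominated ({f. L2G v vj f} \<times> {v..vj j}) (\<lambda>(f, x). normG v vj f) (\<lambda>z (f, x). \<Phi> z f x)"
    and "L2G v vj f \<Longrightarrow> x \<in> {v..vj j} \<Longrightarrow> (\<lambda>z. \<Phi> z f x) holomorphic_on UNIV"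
    and "L2G v vj f \<Longrightarrow> continuous_on {v..vj j} (\<Phi> z f)"
    and "L2G v vj f \<Longrightarrow> L2G v vj g \<Longrightarrow> x \<in> {v..vj j} \<Longrightarrow>
        \<Phi> z (\<lambda>i t. cs a (f i t) + cs b (g i t)) x = a * \<Phi> z f x + b * \<Phi> z g x"
  using assms by (auto simp: entire_family_def entire_dominated_def)

lemma entire_family_mult:
  assumes \<psi>: "entire_multiplier j \<psi>" and \<Phi>: "entire_family j \<Phi>"
  shows "entire_family j (\<lambda>z f x. \<psi> z x * \<Phi> z f x)"
  unfolding entire_family_def
proof (intro conjI allI impI ballI)
  let ?S = "{f. L2G v vj f} \<times> {v..vj j}"
  have "entire_dominated ?S (\<lambda>_. 1) (\<lambda>z s. \<psi> z (snd s))"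
    by (rule entire_dominated_reindex[of "{v..vj j}" "\<lambda>_. 1" \<psi>]) (use \<psi> in \<open>auto simp: entire_multiplier_def\<close>)
  from entire_dominated_mult[OF this entire_familyD(1)[OF \<Phi>]]
  show "entire_dominated ?S (\<lambda>(f, x). normG v vj f) (\<lambda>z (f, x). \<psi> z x * \<Phi> z f x)"
    by (simp add: case_prod_unfold)
  show "continuous_on {v..vj j} (\<lambda>x. \<psi> z x * \<Phi> z f x)" if "L2G v vj f" for z f
    using \<psi> by (intro continuous_on_mult entire_familyD(3)[OF \<Phi> that]) (simp add: entire_multiplier_def)
  show "\<psi> z x * \<Phi> z (\<lambda>i t. cs a (f i t) + cs b (g i t)) x = a * (\<psi> z x * \<Phi> z f x) + b * (\<psi> z x * \<Phi> z g x)"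
    if "L2G v vj f" "L2G v vj g" "x \<in> {v..vj j}" for z f g a b x
    using entire_familyD(4)[OF \<Phi> that] by (simp add: algebra_simps)
qed

lemma entire_family_cmult: "entire_family j \<Phi> \<Longrightarrow> entire_family j (\<lambda>z f x. c * \<Phi> z f x)"
  by (rule entire_family_mult) (simp_all add: entire_multiplier_def entire_dominated_const)

lemma entire_family_add:
  assumes \<Phi>: "entire_family j \<Phi>" and \<Psi>: "entire_family j \<Psi>"
  shows "entire_family j (\<lambda>z f x. \<Phi> z f x + \<Psi> z f x)"
  unfolding entire_family_def
proof (intro conjI allI impI ballI)
  let ?S = "{f. L2G v vj f} \<times> {v..vj j}"
  from entire_dominated_add[OF entire_familyD(1)[OF \<Phi>] entire_familyD(1)[OF \<Psi>]]
  show "entire_dominated ?S (\<lambda>(f, x). normG v vj f) (\<lambda>z (f, x). \<Phi> z f x + \<Psi> z f x)"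
    by (simp add: case_prod_unfold)
  show "continuous_on {v..vj j} (\<lambda>x. \<Phi> z f x + \<Psi> z f x)" if "L2G v vj f" for z f
    by (intro continuous_on_add entire_familyD(3)[OF \<Phi> that] entire_familyD(3)[OF \<Psi> that])
  show "\<Phi> z (\<lambda>i t. cs a (f i t) + cs b (g i t)) x + \<Psi> z (\<lambda>i t. cs a (f i t) + cs b (g i t)) x
      = a * (\<Phi> z f x + \<Psi> z f x) + b * (\<Phi> z g x + \<Psi> z g x)"
    if "L2G v vj f" "L2G v vj g" "x \<in> {v..vj j}" for z f g a b x
    using entire_familyD(4)[OF \<Phi> that] entire_familyD(4)[OF \<Psi> that] by (simp add: algebra_simps)
qed

lemma entire_family_sum:
  assumes "finite A" "A \<noteq> {}" "\<And>i. i \<in> A \<Longrightarrow> entire_family j (\<Phi> i)"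
  shows "entire_family j (\<lambda>z f x. \<Sum>i\<in>A. \<Phi> i z f x)"
  using assms by (induction rule: finite_ne_induct) (simp_all add: entire_family_add)

lemma entire_family_deriv:
  assumes \<Phi>: "entire_family j \<Phi>"
  shows "entire_family j (\<lambda>z f x. deriv (\<lambda>z. \<Phi> z f x) z)"
  unfolding entire_family_def
proof (intro conjI allI impI ballI)
  let ?S = "{f. L2G v vj f} \<times> {v..vj j}"
  from entire_dominated_deriv[OF entire_familyD(1)[OF \<Phi>]]
  show "entire_dominated ?S (\<lambda>(f, x). normG v vj f) (\<lambda>z (f, x). deriv (\<lambda>z. \<Phi> z f x) z)"
    by (simp add: case_prod_unfold)
  show "continuous_on {v..vj j} (\<lambda>x. deriv (\<lambda>z. \<Phi> z f x) z0)" if f: "L2G v vj f" for z0 f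
  proof (rule uniform_limit_theorem[of _ "\<lambda>z x. (\<Phi> z f x - \<Phi> z0 f x) / (z - z0)" "at z0"])
    show "\<forall>\<^sub>F z in at z0. continuous_on {v..vj j} (\<lambda>x. (\<Phi> z f x - \<Phi> z0 f x) / (z - z0))"
      using eventually_neq_at_within[of z0]
      by eventually_elim (auto intro!: continuous_intros entire_familyD(3)[OF \<Phi> f])
    show "uniform_limit {v..vj j} (\<lambda>z x. (\<Phi> z f x - \<Phi> z0 f x) / (z - z0)) (\<lambda>x. deriv (\<lambda>z. \<Phi> z f x) z0) (at z0)"
      using entire_dominated_reindex[OF entire_familyD(1)[OF \<Phi>], of "{v..vj j}" "Pair f"] f
      by (intro uniform_limit_difference_quotient[of _ "normG v vj f"]) simp
  qed simp
  show "deriv (\<lambda>z. \<Phi> z (\<lambda>i t. cs a (f i t) + cs b (g i t)) x) z = a * deriv (\<lambda>z. \<Phi> z f x) z + b * deriv (\<lambda>z. \<Phi> z g x) z"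
    if f: "L2G v vj f" and g: "L2G v vj g" and x: "x \<in> {v..vj j}" for z f g a b x
  proof -
    have "((\<lambda>z. \<Phi> z h x) has_field_derivative deriv (\<lambda>z. \<Phi> z h x) z) (at z)" if "L2G v vj h" for h
      by (rule holomorphic_derivI[OF entire_familyD(2)[OF \<Phi> that x] open_UNIV UNIV_I])
    from DERIV_add[OF DERIV_cmult[OF this[OF f]] DERIV_cmult[OF this[OF g]], of a b, THEN DERIV_imp_deriv]
    show ?thesis by (simp add: entire_familyD(4)[OF \<Phi> f g x])
  qed
qed

subsection \<open>Solutions as entire families\<close>

lemma LINT_norm_le_normG:
  assumes f: "L2G v vj f"
  shows "(LINT t:{v..vj i}|lborel. norm (f i t)) \<le> sqrt (vj i - v) * normG v vj f"
proof (rule power2_le_imp_le)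
  have "(LINT t:{v..vj i}|lborel. norm (f i t))\<^sup>2 \<le> (vj i - v) * (LINT t:{v..vj i}|lborel. (norm (f i t))\<^sup>2)"
    using f by (intro LINT_norm_power2_le edges) (simp add: L2G_iff)
  also have "\<dots> \<le> (vj i - v) * (normG v vj f)\<^sup>2"
    unfolding normG_power2 using edges[of i]
    by (intro mult_left_mono member_le_sum LINT_Icc_nonneg) auto
  finally show "(LINT t:{v..vj i}|lborel. norm (f i t))\<^sup>2 \<le> (sqrt (vj i - v) * normG v vj f)\<^sup>2"
    using edges[of i] by (simp add: power_mult_distrib)
qed (use normG_nonneg edges[of i] in simp)

lemma entire_multiplier_col: "entire_multiplier j (\<lambda>z x. fst (col j z b x))" "entire_multiplier j (\<lambda>z x. snd (col j z b x))"
proof -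
  have "entire_dominated {v..vj j} (\<lambda>_. 1) (\<lambda>z x. s (col j z b x))"
    if holomorphic: "\<And>x. x \<in> {v..vj j} \<Longrightarrow> (\<lambda>z. s (col j z b x)) holomorphic_on UNIV" and contraction: "\<And>u. cmod (s u) \<le> norm u"
    for s :: "complex \<times> complex \<Rightarrow> complex"
  proof (rule entire_dominatedI[OF holomorphic])
    fix z0
    obtain K where "\<forall>\<^sub>F z in nhds z0. \<forall>b. \<forall>x\<in>{v..vj j}. norm (col j z b x) \<le> K"
      by (rule col_locally_bounded)
    then have "\<forall>\<^sub>F z in nhds z0. \<forall>x\<in>{v..vj j}. cmod (s (col j z b x)) \<le> K * 1"
      by eventually_elim (auto intro: order_trans[OF contraction])
    then show "\<exists>K. \<forall>\<^sub>F z in nhds z0. \<forall>x\<in>{v..vj j}. cmod (s (col j z b x)) \<le> K * 1" ..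
  qed
  from this[OF col_holomorphic(1) norm_fst_le_norm] this[OF col_holomorphic(2) norm_snd_le_norm]
  show "entire_multiplier j (\<lambda>z x. fst (col j z b x))" "entire_multiplier j (\<lambda>z x. snd (col j z b x))"
    by (simp_all add: entire_multiplier_def continuous_on_fst continuous_on_snd continuous_on_col)
qed

lemma col_moment_linear:
  assumes f: "edge_integrable j f" and g: "edge_integrable j g" and x: "x \<in> {v..vj j}"
  shows "col_moment j z b (\<lambda>t. cs c (f t) + cs d (g t)) x = c * col_moment j z b f x + d * col_moment j z b g x"
proof -
  have "set_integrable lborel {v..x} (\<lambda>t. e * dotp (col j z b t) (h t))" if "edge_integrable j h" for e h
    using x by (intro set_integrable_mult_right set_integrable_Icc_subset[OF set_integrable_dotp_col[OF that]]) auto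
  from set_integral_add(2)[OF this[OF f] this[OF g]] show ?thesis
    by (simp add: col_moment_def dotp.add_right)
qed

lemma norm_col_moment_le:
  assumes K: "\<And>x. x \<in> {v..vj i} \<Longrightarrow> norm (col i z b x) \<le> K" "0 \<le> K" and f: "L2G v vj f" and x: "x \<in> {v..vj i}"
  shows "cmod (col_moment i z b (f i) x) \<le> K * sqrt (vj i - v) * normG v vj f"
proof -
  note integrable = edge_integrable_L2G[OF f]
  have dotp: "set_integrable lborel {v..x} (\<lambda>t. dotp (col i z b t) (f i t))"
    by (rule set_integrable_Icc_subset[OF set_integrable_dotp_col[OF integrable]]) (use x in auto)
  have norm: "set_integrable lborel {v..vj i} (\<lambda>t. K * norm (f i t))"
    by (rule set_integrable_mult_right[OF set_integrable_norm[OF integrable]])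
  have "cmod (col_moment i z b (f i) x) \<le> (LINT t:{v..x}|lborel. cmod (dotp (col i z b t) (f i t)))"
    unfolding col_moment_def by (rule set_integral_norm_bound[OF dotp])
  also have "\<dots> \<le> (LINT t:{v..x}|lborel. K * norm (f i t))"
  proof (rule set_integral_mono)
    show "set_integrable lborel {v..x} (\<lambda>t. cmod (dotp (col i z b t) (f i t)))"
      by (rule set_integrable_norm[OF dotp])
    show "set_integrable lborel {v..x} (\<lambda>t. K * norm (f i t))"
      by (rule set_integrable_Icc_subset[OF norm]) (use x in auto)
    show "cmod (dotp (col i z b t) (f i t)) \<le> K * norm (f i t)" if "t \<in> {v..x}" for t
      by (rule order_trans[OF norm_dotp_le mult_right_mono[OF K(1) norm_ge_zero]]) (use x that in auto)
  qed
  also have "\<dots> \<le> (LINT t:{v..vj i}|lborel. K * norm (f i t))"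
    by (rule LINT_Icc_mono_upper[OF norm x]) (use K(2) in simp)
  also have "\<dots> \<le> K * (sqrt (vj i - v) * normG v vj f)"
    using mult_left_mono[OF LINT_norm_le_normG[OF f] K(2)] by simp
  finally show ?thesis by (simp add: mult.assoc)
qed

lemma entire_family_col_moment:
  assumes y: "\<And>x. x \<in> {v..vj j} \<Longrightarrow> y x \<in> {v..vj i}" "continuous_on {v..vj j} y"
  shows "entire_family j (\<lambda>z f x. col_moment i z b (f i) (y x))"
proof (rule entire_familyI)
  note integrable = edge_integrable_L2G
  show "(\<lambda>z. col_moment i z b (f i) (y x)) holomorphic_on UNIV" if "L2G v vj f" "x \<in> {v..vj j}" for f x
    by (rule col_moment_holomorphic[OF integrable[OF that(1)] y(1)[OF that(2)]])
  show "continuous_on {v..vj j} (\<lambda>x. col_moment i z b (f i) (y x))" if "L2G v vj f" for z f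
    using y by (intro continuous_on_compose2[OF abs_continuous_on_imp_continuous_on[OF
          abs_continuous_on_col_moment[OF integrable[OF that]]]]) auto
  show "col_moment i z b (\<lambda>t. cs c (f i t) + cs d (g i t)) (y x)
      = c * col_moment i z b (f i) (y x) + d * col_moment i z b (g i) (y x)"
    if "L2G v vj f" "L2G v vj g" "x \<in> {v..vj j}" for z f g c d x
    by (rule col_moment_linear[OF integrable[OF that(1)] integrable[OF that(2)] y(1)[OF that(3)]])
  fix z0
  obtain K where "0 < K" and K: "\<forall>\<^sub>F z in nhds z0. \<forall>b. \<forall>x\<in>{v..vj i}. norm (col i z b x) \<le> K"
    by (rule col_locally_bounded)
  from K have "\<forall>\<^sub>F z in nhds z0. \<forall>f x. L2G v vj f \<longrightarrow> x \<in> {v..vj j} \<longrightarrow>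
      cmod (col_moment i z b (f i) (y x)) \<le> K * sqrt (vj i - v) * normG v vj f"
    by eventually_elim (use \<open>0 < K\<close> y(1) in \<open>auto intro: norm_col_moment_le\<close>)
  then show "\<exists>K. \<forall>\<^sub>F z in nhds z0. \<forall>f x. L2G v vj f \<longrightarrow> x \<in> {v..vj j} \<longrightarrow>
      cmod (col_moment i z b (f i) (y x)) \<le> K * normG v vj f" ..
qed

lemma entire_family_moment: "entire_family j (\<lambda>z f x. moment b z f $ i)"
  using entire_family_col_moment[of j "\<lambda>_. vj i" i b] edges[of i] by (simp add: moment_def)

lemma entire_family_edge_solution:
  assumes "entire_family j (\<lambda>z f x. \<xi> z f)" "entire_family j (\<lambda>z f x. \<eta> z f)"
  shows "entire_family j (\<lambda>z f x. fst (edge_solution j z (\<xi> z f, \<eta> z f) (f j) x))"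
    and "entire_family j (\<lambda>z f x. snd (edge_solution j z (\<xi> z f, \<eta> z f) (f j) x))"
proof -
  have moment: "entire_family j (\<lambda>z f x. col_moment j z b (f j) x)" for b
    by (rule entire_family_col_moment) (simp_all add: continuous_on_id)
  have coefficients: "entire_family j (\<lambda>z f x. \<xi> z f - col_moment j z 2 (f j) x)"
      "entire_family j (\<lambda>z f x. \<eta> z f + col_moment j z 1 (f j) x)"
    using entire_family_add[OF assms(1) entire_family_cmult[OF moment[of 2], of "- 1"]] entire_family_add[OF assms(2) moment]
    by simp_all
  show "entire_family j (\<lambda>z f x. fst (edge_solution j z (\<xi> z f, \<eta> z f) (f j) x))"
    using entire_family_add[OF entire_family_mult[OF entire_multiplier_col(1) coefficients(1)]
        entire_family_mult[OF entire_multiplier_col(1) coefficients(2)]]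
    by (simp add: edge_solution_def mult.commute)
  show "entire_family j (\<lambda>z f x. snd (edge_solution j z (\<xi> z f, \<eta> z f) (f j) x))"
    using entire_family_add[OF entire_family_mult[OF entire_multiplier_col(2) coefficients(1)]
        entire_family_mult[OF entire_multiplier_col(2) coefficients(2)]]
    by (simp add: edge_solution_def mult.commute)
qed

subsection \<open>Entire families of bounded operators\<close>

definition entire_components :: "(complex \<Rightarrow> 'n gfun \<Rightarrow> 'n gfun) \<Rightarrow> bool" where
  "entire_components F \<longleftrightarrow> (\<forall>j. entire_family j (\<lambda>z f x. fst (F z f j x)) \<and> entire_family j (\<lambda>z f x. snd (F z f j x)))"

definition gfun_deriv :: "(complex \<Rightarrow> 'n gfun \<Rightarrow> 'n gfun) \<Rightarrow> complex \<Rightarrow> 'n gfun \<Rightarrow> 'n gfun" where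
  "gfun_deriv F z f j x = (deriv (\<lambda>z. fst (F z f j x)) z, deriv (\<lambda>z. snd (F z f j x)) z)"

lemma entire_components_gfun_deriv: "entire_components F \<Longrightarrow> entire_components (gfun_deriv F)"
  by (simp add: entire_components_def gfun_deriv_def entire_family_deriv)

lemma normG_le:
  assumes h: "L2G v vj h" and bound: "\<And>j x. x \<in> {v..vj j} \<Longrightarrow> norm (h j x) \<le> C"
  shows "normG v vj h \<le> sqrt (\<Sum>j\<in>UNIV. vj j - v) * C"
proof (rule power2_le_imp_le)
  have "(LINT x:{v..vj j}|lborel. (norm (h j x))\<^sup>2) \<le> (vj j - v) * C\<^sup>2" for j
  proof -
    have "(LINT x:{v..vj j}|lborel. (norm (h j x))\<^sup>2) \<le> (LINT x:{v..vj j}|lborel. C\<^sup>2)"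
      using h by (intro set_integral_mono) (simp_all add: L2G_iff square_integrable_def bound power_mono)
    then show ?thesis using edges[of j] by (simp add: set_lebesgue_integral_def)
  qed
  then show "(normG v vj h)\<^sup>2 \<le> (sqrt (\<Sum>j\<in>UNIV. vj j - v) * C)\<^sup>2"
    using edges by (simp add: normG_power2 power_mult_distrib sum_nonneg less_imp_le sum_distrib_right sum_mono)
  have "0 \<le> C" using order_trans[OF norm_ge_zero bound[of v]] edges by (simp add: less_imp_le)
  then show "0 \<le> sqrt (\<Sum>j\<in>UNIV. vj j - v) * C"
    using edges by (simp add: sum_nonneg less_imp_le)
qed

lemma norm_le_cmod_add: "norm u \<le> cmod (fst u) + cmod (snd u)"
  using norm_Pair_le[of "fst u" "snd u"] by simp

lemma entire_components_bound:
  assumes "entire_components F"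
  obtains K where "\<forall>\<^sub>F z in nhds z0. \<forall>j f x. L2G v vj f \<longrightarrow> x \<in> {v..vj j} \<longrightarrow> norm (F z f j x) \<le> K * normG v vj f"
proof -
  let ?S = "\<lambda>j. {f. L2G v vj f} \<times> {v..vj j}"
  have "\<exists>K. \<forall>\<^sub>F z in nhds z0. \<forall>s\<in>?S j. norm (F z (fst s) j (snd s)) \<le> K * normG v vj (fst s)" for j
  proof -
    have family: "entire_family j (\<lambda>z f x. fst (F z f j x))" "entire_family j (\<lambda>z f x. snd (F z f j x))"
      using assms by (simp_all add: entire_components_def)
    obtain K where "\<forall>\<^sub>F z in nhds z0. \<forall>s\<in>?S j. cmod (fst (F z (fst s) j (snd s))) \<le> K * normG v vj (fst s)"
      using entire_dominated_bound[OF entire_familyD(1)[OF family(1)]] by (auto simp: case_prod_unfold)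
    moreover obtain L where "\<forall>\<^sub>F z in nhds z0. \<forall>s\<in>?S j. cmod (snd (F z (fst s) j (snd s))) \<le> L * normG v vj (fst s)"
      using entire_dominated_bound[OF entire_familyD(1)[OF family(2)]] by (auto simp: case_prod_unfold)
    ultimately have "\<forall>\<^sub>F z in nhds z0. \<forall>s\<in>?S j. norm (F z (fst s) j (snd s)) \<le> (K + L) * normG v vj (fst s)"
      by eventually_elim (auto simp: distrib_right intro!: order_trans[OF norm_le_cmod_add] add_mono)
    then show ?thesis ..
  qed
  then obtain K where "\<forall>\<^sub>F z in nhds z0. \<forall>j. \<forall>s\<in>?S j. norm (F z (fst s) j (snd s)) \<le> K * normG v vj (fst s)"
    using eventually_bound_finite[of ?S "\<lambda>j z s. norm (F z (fst s) j (snd s))" "\<lambda>_ s. normG v vj (fst s)" "nhds z0"]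
    by (auto simp: normG_nonneg)
  then show thesis by (intro that[of K]) (auto elim!: eventually_mono)
qed

lemma entire_components_difference_quotient:
  assumes "entire_components F"
  obtains K where "\<forall>\<^sub>F z in at z0. \<forall>j f x. L2G v vj f \<longrightarrow> x \<in> {v..vj j} \<longrightarrow>
    norm (cs (1 / (z - z0)) (F z f j x - F z0 f j x) - gfun_deriv F z0 f j x) \<le> K * (normG v vj f * cmod (z - z0))"
proof -
  let ?S = "\<lambda>j. {f. L2G v vj f} \<times> {v..vj j}"
  let ?R = "\<lambda>j z s. cs (1 / (z - z0)) (F z (fst s) j (snd s) - F z0 (fst s) j (snd s)) - gfun_deriv F z0 (fst s) j (snd s)"
  have "\<exists>K. \<forall>\<^sub>F z in at z0. \<forall>s\<in>?S j. norm (?R j z s) \<le> K * (normG v vj (fst s) * cmod (z - z0))" for j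
  proof -
    have family: "entire_family j (\<lambda>z f x. fst (F z f j x))" "entire_family j (\<lambda>z f x. snd (F z f j x))"
      using assms by (simp_all add: entire_components_def)
    obtain K where "\<forall>\<^sub>F z in at z0. \<forall>s\<in>?S j. cmod (fst (?R j z s)) \<le> K * normG v vj (fst s) * cmod (z - z0)"
      using entire_dominated_difference_quotient[OF entire_familyD(1)[OF family(1)]]
      by (auto simp: case_prod_unfold gfun_deriv_def)
    moreover obtain L where "\<forall>\<^sub>F z in at z0. \<forall>s\<in>?S j. cmod (snd (?R j z s)) \<le> L * normG v vj (fst s) * cmod (z - z0)"
      using entire_dominated_difference_quotient[OF entire_familyD(1)[OF family(2)]]
      by (auto simp: case_prod_unfold gfun_deriv_def)
    ultimately have "\<forall>\<^sub>F z in at z0. \<forall>s\<in>?S j. norm (?R j z s) \<le> (K + L) * (normG v vj (fst s) * cmod (z - z0))"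
    proof eventually_elim
      case (elim z)
      show ?case
      proof
        fix s assume "s \<in> ?S j"
        with elim have "cmod (fst (?R j z s)) + cmod (snd (?R j z s)) \<le> (K + L) * (normG v vj (fst s) * cmod (z - z0))"
          by (simp only: distrib_right mult.assoc) (blast intro: add_mono)
        then show "norm (?R j z s) \<le> (K + L) * (normG v vj (fst s) * cmod (z - z0))"
          by (rule order_trans[OF norm_le_cmod_add])
      qed
    qed
    then show ?thesis ..
  qed
  moreover have "0 \<le> normG v vj (fst s) * cmod (z - z0)" for z and s :: "'n gfun \<times> real"
    by (simp add: normG_nonneg)
  ultimately obtain K where "\<forall>\<^sub>F z in at z0. \<forall>j. \<forall>s\<in>?S j. norm (?R j z s) \<le> K * (normG v vj (fst s) * cmod (z - z0))"
    using eventually_bound_finite[of ?S "\<lambda>j z s. norm (?R j z s)" "\<lambda>z s. normG v vj (fst s) * cmod (z - z0)" "at z0"] by blast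
  then show thesis by (intro that[of K]) (auto elim!: eventually_mono)
qed

lemma L2G_entire_components:
  assumes "entire_components F" "L2G v vj f"
  shows "L2G v vj (F z f)"
  unfolding L2G_def sqint_iff_square_integrable
proof (intro allI conjI continuous_on_imp_square_integrable)
  show "continuous_on {v..vj j} (\<lambda>x. fst (F z f j x))" "continuous_on {v..vj j} (\<lambda>x. snd (F z f j x))" for j
    using assms unfolding entire_components_def by (blast dest: entire_familyD(3))+
qed

lemma entire_components_linear:
  assumes "entire_components F" "L2G v vj f" "L2G v vj g" "x \<in> {v..vj j}"
  shows "F z (\<lambda>i t. cs a (f i t) + cs b (g i t)) j x = cs a (F z f j x) + cs b (F z g j x)"
proof -
  have family: "entire_family j (\<lambda>z f x. fst (F z f j x))" "entire_family j (\<lambda>z f x. snd (F z f j x))"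
    using assms(1) by (simp_all add: entire_components_def)
  show ?thesis
    using entire_familyD(4)[OF family(1) assms(2-)] entire_familyD(4)[OF family(2) assms(2-)] by (simp add: prod_eq_iff)
qed

lemma eqG_if_eq_on_edges: "(\<And>j x. x \<in> {v..vj j} \<Longrightarrow> f j x = g j x) \<Longrightarrow> eqG v vj f g"
  by (simp add: eqG_def)

lemma entire_components_bound_at:
  assumes "entire_components F"
  shows "\<exists>K. \<forall>j f. L2G v vj f \<longrightarrow> (\<forall>x\<in>{v..vj j}. norm (F z f j x) \<le> K * normG v vj f)"
proof -
  obtain K where "\<forall>\<^sub>F z in nhds z. \<forall>j f x. L2G v vj f \<longrightarrow> x \<in> {v..vj j} \<longrightarrow> norm (F z f j x) \<le> K * normG v vj f"
    by (rule entire_components_bound[OF assms])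
  from eventually_nhds_x_imp_x[OF this] show ?thesis by blast
qed

lemma bdd_lin_op_entire_components:
  assumes F: "entire_components F"
  shows "bdd_lin_op v vj (F z)"
proof -
  have L2: "L2G v vj (F z f)" if "L2G v vj f" for f
    by (rule L2G_entire_components[OF F that])
  have linear: "eqG v vj (F z (\<lambda>j x. cs a (f j x) + cs b (g j x))) (\<lambda>j x. cs a (F z f j x) + cs b (F z g j x))"
    if "L2G v vj f" "L2G v vj g" for f g a b
    by (intro eqG_if_eq_on_edges entire_components_linear[OF F that])
  obtain K where "\<forall>j f. L2G v vj f \<longrightarrow> (\<forall>x\<in>{v..vj j}. norm (F z f j x) \<le> K * normG v vj f)"
    using entire_components_bound_at[OF F] ..
  then have bound: "norm (F z f j x) \<le> K * normG v vj f" if "L2G v vj f" "x \<in> {v..vj j}" for f j x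
    using that by blast
  have "normG v vj (F z f) \<le> (sqrt (\<Sum>j\<in>UNIV. vj j - v) * K) * normG v vj f" if "L2G v vj f" for f
    using normG_le[OF L2[OF that] bound[OF that]] by (simp add: mult.assoc)
  moreover have "eqG v vj (F z f) (F z g)" if f: "L2G v vj f" and g: "L2G v vj g" and eq: "eqG v vj f g" for f g
  proof -
    let ?h = "\<lambda>j x. cs 1 (f j x) + cs (- 1) (g j x)"
    have h: "L2G v vj ?h" using L2G_add_cs[OF f g, of "- 1"] by simp
    have "eqG v vj ?h zero_gfun"
      using eqG_add_cs[OF eq eqG_refl[of v vj g], of "- 1"] by simp
    then have "normG v vj ?h = 0"
      using innerG_cong[OF h h L2G_zero L2G_zero] by (simp add: normG_def innerG_eq_sum inner_on_self)
    then have "F z ?h j x = 0" if "x \<in> {v..vj j}" for j x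
      using bound[OF h that] by simp
    then have "F z f j x = F z g j x" if "x \<in> {v..vj j}" for j x
      using entire_components_linear[OF F f g that, of z 1 "- 1"] that by simp
    then show ?thesis by (rule eqG_if_eq_on_edges)
  qed
  ultimately show ?thesis using L2 linear unfolding bdd_lin_op_def addp_eq_plus by blast
qed

lemma entire_components_differentiable:
  assumes F: "entire_components F" and \<epsilon>: "0 < \<epsilon>"
  shows "\<forall>\<^sub>F z in at z0. \<forall>f. L2G v vj f \<longrightarrow>
    normG v vj (\<lambda>j x. cs (1 / (z - z0)) (F z f j x - F z0 f j x) - gfun_deriv F z0 f j x) \<le> \<epsilon> * normG v vj f"
proof -
  let ?L = "sqrt (\<Sum>j\<in>UNIV. vj j - v)"
  let ?R = "\<lambda>z f j x. cs (1 / (z - z0)) (F z f j x - F z0 f j x) - gfun_deriv F z0 f j x"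
  have R: "L2G v vj (?R z f)" if "L2G v vj f" for z f
    using L2G_entire_components[OF F that] L2G_entire_components[OF entire_components_gfun_deriv[OF F] that]
    by (simp add: L2G_iff square_integrable_diff square_integrable_cs)
  obtain K where K: "\<forall>\<^sub>F z in at z0. \<forall>j f x. L2G v vj f \<longrightarrow> x \<in> {v..vj j} \<longrightarrow>
      norm (?R z f j x) \<le> K * (normG v vj f * cmod (z - z0))"
    by (rule entire_components_difference_quotient[OF F])
  have "((\<lambda>z. ?L * K * cmod (z - z0)) \<longlongrightarrow> ?L * K * cmod (z0 - z0)) (at z0)"
    by (intro tendsto_intros)
  then have "\<forall>\<^sub>F z in at z0. ?L * K * cmod (z - z0) < \<epsilon>"
    by (rule order_tendstoD(2)) (use \<epsilon> in simp)
  with K show ?thesis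
  proof eventually_elim
    case (elim z)
    show ?case
    proof (intro allI impI)
      fix f assume f: "L2G v vj f"
      have "normG v vj (?R z f) \<le> ?L * (K * (normG v vj f * cmod (z - z0)))"
        using elim(1) f by (intro normG_le R) blast+
      also have "\<dots> = (?L * K * cmod (z - z0)) * normG v vj f" by simp
      also have "\<dots> \<le> \<epsilon> * normG v vj f"
        using elim(2) by (intro mult_right_mono normG_nonneg) simp
      finally show "normG v vj (?R z f) \<le> \<epsilon> * normG v vj f" .
    qed
  qed
qed

theorem entire_bdd_opfun_if_entire_components:
  assumes F: "entire_components F"
  shows "entire_bdd_opfun v vj F"
  unfolding entire_bdd_opfun_def addp_eq_plus subp_eq_minus
proof (intro conjI allI)
  show "bdd_lin_op v vj (F z)" for z by (rule bdd_lin_op_entire_components[OF F])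
  fix z0
  show "\<exists>F'. bdd_lin_op v vj F' \<and> (\<forall>\<epsilon>>0. \<exists>\<delta>>0. \<forall>z. z \<noteq> z0 \<and> cmod (z - z0) < \<delta> \<longrightarrow> (\<forall>f. L2G v vj f \<longrightarrow>
      normG v vj (\<lambda>j x. cs (1 / (z - z0)) (F z f j x - F z0 f j x) - F' f j x) \<le> \<epsilon> * normG v vj f))"
    using entire_components_differentiable[OF F, of _ z0]
    by (intro exI[of _ "gfun_deriv F z0"] conjI bdd_lin_op_entire_components entire_components_gfun_deriv F)
       (simp add: eventually_at dist_norm)
qed

end

section \<open>The function W\<close>

lemma adjm_matrix_mult: "adjm (A ** B) = adjm B ** adjm A"
  by (simp add: adjm_def matrix_matrix_mult_def vec_eq_iff mult.commute)

lemma adjm_diff: "adjm (A - B) = adjm A - adjm B"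
  by (simp add: adjm_def vec_eq_iff)

text \<open>The block matrix with rows (A, B) and (C, D) has the right inverse with rows (-D^*, B^*) and (C^*, -A^*),
  which is therefore also a left inverse.\<close>
lemma symplectic_completion:
  fixes A B C D :: "complex^'n^'n"
  assumes ab: "A ** adjm B = B ** adjm A" and cd: "C ** adjm D - D ** adjm C = 0" and bc: "B ** adjm C - A ** adjm D = mat 1"
  shows "adjm B *v (C *v x + D *v y) - adjm D *v (A *v x + B *v y) = x"
    and "adjm C *v (A *v x + B *v y) - adjm A *v (C *v x + D *v y) = y"
proof -
  define T where "T \<xi> = (A *v fst \<xi> + B *v snd \<xi>, C *v fst \<xi> + D *v snd \<xi>)" for \<xi> :: "(complex^'n) \<times> (complex^'n)"
  define S where "S \<xi> = (adjm B *v snd \<xi> - adjm D *v fst \<xi>, adjm C *v fst \<xi> - adjm A *v snd \<xi>)" for \<xi> :: "(complex^'n) \<times> (complex^'n)"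
  have "linear T" "linear S"
    by (auto intro!: linearI simp: T_def S_def vec.add vec.scale scaleR_eq_smult vector_add_ldistrib
        vec.scale_right_diff_distrib)
  have "adjm (B ** adjm C - A ** adjm D) = mat 1"
    unfolding bc by (simp add: adjm_def mat_def vec_eq_iff)
  then have cb: "C ** adjm B - D ** adjm A = mat 1"
    by (simp add: adjm_diff adjm_matrix_mult)
  have "T (S \<xi>) = \<xi>" for \<xi>
  proof -
    have "fst (T (S \<xi>)) = (B ** adjm C - A ** adjm D) *v fst \<xi> + (A ** adjm B - B ** adjm A) *v snd \<xi>"
      by (simp add: T_def S_def vec.diff matrix_vector_mul_assoc matrix_vector_mult_diff_rdistrib)
    moreover have "snd (T (S \<xi>)) = (C ** adjm B - D ** adjm A) *v snd \<xi> - (C ** adjm D - D ** adjm C) *v fst \<xi>"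
      by (simp add: T_def S_def vec.diff matrix_vector_mul_assoc matrix_vector_mult_diff_rdistrib)
    ultimately show ?thesis by (simp add: ab cd bc cb prod_eq_iff)
  qed
  then have "T \<circ> S = id" by (simp add: fun_eq_iff)
  then have "S \<circ> T = id" using linear_inverse_left[OF \<open>linear T\<close> \<open>linear S\<close>] by blast
  then have "S (T (x, y)) = (x, y)" by (metis comp_apply id_apply)
  then show "adjm B *v (C *v x + D *v y) - adjm D *v (A *v x + B *v y) = x"
    "adjm C *v (A *v x + B *v y) - adjm A *v (C *v x + D *v y) = y"
    by (simp_all add: T_def S_def)
qed

lemma symplectic_form_completion:
  fixes A B C D :: "complex^'n^'n"
  assumes "A ** adjm B = B ** adjm A" "C ** adjm D - D ** adjm C = 0" "B ** adjm C - A ** adjm D = mat 1"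
  shows "symplectic_form (A *v fst \<xi> + B *v snd \<xi>, C *v fst \<xi> + D *v snd \<xi>)
    (A *v fst \<eta> + B *v snd \<eta>, C *v fst \<eta> + D *v snd \<eta>) = - symplectic_form \<xi> \<eta>"
proof -
  note inverse = symplectic_completion[OF assms, of "fst \<eta>" "snd \<eta>"]
  let ?y = "A *v fst \<eta> + B *v snd \<eta>" and ?z = "C *v fst \<eta> + D *v snd \<eta>"
  have move: "cdot (P *v u) w = cdot u (adjm P *v w)" for P :: "complex^'n^'n" and u w
    using cdot_adjm[of "adjm P" u w] by simp
  have "symplectic_form (A *v fst \<xi> + B *v snd \<xi>, C *v fst \<xi> + D *v snd \<xi>) (?y, ?z)
      = cdot (snd \<xi>) (adjm B *v ?z - adjm D *v ?y) - cdot (fst \<xi>) (adjm C *v ?y - adjm A *v ?z)"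
    by (simp add: symplectic_form_def cdot_add_left cdot_diff_right move)
  then show ?thesis unfolding inverse by (simp add: symplectic_form_def)
qed

subsection \<open>Meromorphic matrix functions\<close>

definition holomorphic_matrix_on :: "(complex \<Rightarrow> complex^'m^'n) \<Rightarrow> complex set \<Rightarrow> bool" where
  "holomorphic_matrix_on P S \<longleftrightarrow> (\<forall>i k. (\<lambda>z. P z $ i $ k) holomorphic_on S)"

definition meromorphic_matrix_on :: "(complex \<Rightarrow> complex^'m^'n) \<Rightarrow> complex set \<Rightarrow> bool" where
  "meromorphic_matrix_on P S \<longleftrightarrow> (\<forall>i k. (\<lambda>z. P z $ i $ k) meromorphic_on S)"

lemma matrix_inv_eq_det_quotient:
  fixes N :: "'a::field^'n^'n"
  assumes "det N \<noteq> 0"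
  shows "matrix_inv N $ l $ k = det (\<chi> a b. if b = l then axis k 1 $ a else N $ a $ b) / det N"
proof -
  have "N *v (matrix_inv N *v axis k 1) = axis k 1"
    using assms by (simp add: matrix_vector_mul_assoc matrix_inv_right invertible_det_nz)
  then have "matrix_inv N *v axis k 1 = (\<chi> l. det (\<chi> a b. if b = l then axis k 1 $ a else N $ a $ b) / det N)"
    unfolding cramer[OF assms] .
  moreover have "matrix_inv N *v axis k 1 = column k (matrix_inv N)"
    by (simp add: matrix_vector_mult_def column_def axis_def vec_eq_iff if_distrib[of "(*) _"] cong: if_cong)
  ultimately show ?thesis by (simp add: column_def vec_eq_iff)
qed

lemma holomorphic_matrix_affine:
  "holomorphic_matrix_on P S \<Longrightarrow> holomorphic_matrix_on (\<lambda>z. N ** P z - L) S"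
  unfolding holomorphic_matrix_on_def matrix_matrix_mult_def
  by (auto intro!: holomorphic_intros)

lemma holomorphic_matrix_mult:
  "holomorphic_matrix_on P S \<Longrightarrow> holomorphic_matrix_on Q S \<Longrightarrow> holomorphic_matrix_on (\<lambda>z. P z ** Q z) S"
  unfolding holomorphic_matrix_on_def matrix_matrix_mult_def
  by (auto intro!: holomorphic_intros)

lemma holomorphic_on_det: "holomorphic_matrix_on P S \<Longrightarrow> (\<lambda>z. det (P z)) holomorphic_on S" for P :: "complex \<Rightarrow> complex^'n^'n"
  unfolding holomorphic_matrix_on_def det_def by (auto intro!: holomorphic_intros)

lemma holomorphic_matrix_inv:
  fixes P :: "complex \<Rightarrow> complex^'n^'n"
  assumes P: "holomorphic_matrix_on P S" and invertible: "\<And>z. z \<in> S \<Longrightarrow> invertible (P z)"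
  shows "holomorphic_matrix_on (\<lambda>z. matrix_inv (P z)) S"
  unfolding holomorphic_matrix_on_def
proof (intro allI)
  fix l k
  have det: "det (P z) \<noteq> 0" if "z \<in> S" for z using invertible[OF that] by (simp add: invertible_det_nz)
  let ?C = "\<lambda>z. \<chi> a b. if b = l then axis k 1 $ a else P z $ a $ b"
  have "holomorphic_matrix_on ?C S"
    unfolding holomorphic_matrix_on_def
  proof (intro allI)
    show "(\<lambda>z. ?C z $ a $ b) holomorphic_on S" for a b
      using P by (cases "b = l") (simp_all add: holomorphic_matrix_on_def)
  qed
  from holomorphic_on_det[OF this] holomorphic_on_det[OF P]
  have "(\<lambda>z. det (?C z) / det (P z)) holomorphic_on S"
    by (intro holomorphic_on_divide det)
  then show "(\<lambda>z. matrix_inv (P z) $ l $ k) holomorphic_on S"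
    by (rule holomorphic_transform) (simp add: matrix_inv_eq_det_quotient det)
qed

lemma meromorphic_matrix_affine:
  "meromorphic_matrix_on P S \<Longrightarrow> meromorphic_matrix_on (\<lambda>z. N ** P z - L) S"
  unfolding meromorphic_matrix_on_def matrix_matrix_mult_def
  by (auto intro!: meromorphic_intros)

lemma meromorphic_matrix_mult:
  "meromorphic_matrix_on P S \<Longrightarrow> meromorphic_matrix_on Q S \<Longrightarrow> meromorphic_matrix_on (\<lambda>z. P z ** Q z) S"
  unfolding meromorphic_matrix_on_def matrix_matrix_mult_def
  by (auto intro!: meromorphic_intros)

lemma meromorphic_on_det: "meromorphic_matrix_on P S \<Longrightarrow> (\<lambda>z. det (P z)) meromorphic_on S" for P :: "complex \<Rightarrow> complex^'n^'n"
  unfolding meromorphic_matrix_on_def det_def by (auto intro!: meromorphic_intros)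

lemma frequently_Im_nonzero: "\<exists>\<^sub>F z in at z0. Im z \<noteq> 0"
  unfolding frequently_def
proof
  assume "\<forall>\<^sub>F z in at z0. \<not> Im z \<noteq> 0"
  then obtain d where d: "0 < d" "\<And>z. z \<noteq> z0 \<Longrightarrow> dist z z0 < d \<Longrightarrow> Im z = 0"
    unfolding eventually_at by auto
  have "Im (z0 + \<i> * of_real t) = 0" if "0 < t" "t < d" for t
    using that by (intro d(2)) (auto simp: dist_norm norm_mult)
  from this[of "d / 2"] this[of "d / 3"] d(1) show False by simp
qed

lemma meromorphic_eventually_nonzero:
  assumes f: "f meromorphic_on UNIV" and nonzero: "\<And>z. Im z \<noteq> 0 \<Longrightarrow> f z \<noteq> 0"
  shows "\<forall>\<^sub>F z in at z0. f z \<noteq> 0"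
proof (rule ccontr)
  assume "\<not> (\<forall>\<^sub>F z in at z0. f z \<noteq> 0)"
  then have "\<exists>\<^sub>F z in at z0. f z = 0" by (simp add: frequently_def)
  then have "\<forall>\<^sub>F z in at z0. f z = 0"
    using meromorphic_on_subset[OF f subset_UNIV, of "{z0}"]
    by (intro not_essential_frequently_0_imp_eventually_0 meromorphic_on_isolated_singularity meromorphic_on_not_essential)
  then have "\<forall>\<^sub>F z in at z0. \<not> Im z \<noteq> 0" by eventually_elim (use nonzero in blast)
  with frequently_Im_nonzero show False unfolding frequently_def by blast
qed

lemma meromorphic_matrix_inv:
  fixes P :: "complex \<Rightarrow> complex^'n^'n"
  assumes P: "meromorphic_matrix_on P UNIV" and invertible: "\<And>z. Im z \<noteq> 0 \<Longrightarrow> invertible (P z)"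
  shows "meromorphic_matrix_on (\<lambda>z. matrix_inv (P z)) UNIV"
  unfolding meromorphic_matrix_on_def
proof (intro allI)
  fix l k
  let ?C = "\<lambda>z. \<chi> a b. if b = l then axis k 1 $ a else P z $ a $ b"
  have "meromorphic_matrix_on ?C UNIV"
    unfolding meromorphic_matrix_on_def
  proof (intro allI)
    show "(\<lambda>z. ?C z $ a $ b) meromorphic_on UNIV" for a b
      using P by (cases "b = l") (simp_all add: meromorphic_matrix_on_def meromorphic_on_const)
  qed
  from meromorphic_on_det[OF this] meromorphic_on_det[OF P]
  have "(\<lambda>z. det (?C z) / det (P z)) meromorphic_on UNIV"
    by (rule meromorphic_on_divide)
  moreover have "\<forall>\<^sub>F z in at z0. det (?C z) / det (P z) = matrix_inv (P z) $ l $ k" for z0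
  proof -
    have "\<forall>\<^sub>F z in at z0. det (P z) \<noteq> 0"
      using invertible by (intro meromorphic_eventually_nonzero meromorphic_on_det[OF P]) (simp add: invertible_det_nz)
    then show ?thesis by eventually_elim (simp add: matrix_inv_eq_det_quotient)
  qed
  ultimately show "(\<lambda>z. matrix_inv (P z) $ l $ k) meromorphic_on UNIV"
    using meromorphic_on_cong[of UNIV "\<lambda>z. det (?C z) / det (P z)" "\<lambda>z. matrix_inv (P z) $ l $ k" UNIV] by blast
qed

context star
begin

lemma holomorphic_M: "holomorphic_matrix_on M {z. Im z \<noteq> 0}"
proof -
  have "m_fun i holomorphic_on {z. Im z \<noteq> 0}" for i
    unfolding mfun_def[abs_def] using c_fun_nonzero_if_nonreal
    by (intro holomorphic_on_divide holomorphic_on_subset[OF b_fun_holomorphic] holomorphic_on_subset[OF c_fun_holomorphic]) auto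
  then have "(\<lambda>z. M z $ i $ k) holomorphic_on {z. Im z \<noteq> 0}" for i k
    by (cases "i = k") (simp_all add: Mmat_def)
  then show ?thesis by (simp add: holomorphic_matrix_on_def)
qed

lemma meromorphic_M: "meromorphic_matrix_on M UNIV"
proof -
  have "m_fun i meromorphic_on UNIV" for i
    unfolding mfun_def[abs_def]
    using b_fun_holomorphic c_fun_holomorphic
    by (intro meromorphic_on_divide analytic_on_imp_meromorphic_on) (simp_all add: analytic_on_open)
  then have "(\<lambda>z. M z $ i $ k) meromorphic_on UNIV" for i k
    by (cases "i = k") (simp_all add: Mmat_def meromorphic_on_const)
  then show ?thesis by (simp add: meromorphic_matrix_on_def)
qed

definition W_fun :: "complex^'n^'n \<Rightarrow> complex^'n^'n \<Rightarrow> complex^'n^'n \<Rightarrow> complex^'n^'n \<Rightarrow> complex \<Rightarrow> complex^'n^'n" where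
  "W_fun A B C D z = (D ** M z - C) ** matrix_inv (B ** M z - A)"

lemma holomorphic_W_fun:
  assumes "rank (hcat A B) = CARD('n)" "A ** adjm B = B ** adjm A"
  shows "holomorphic_matrix_on (W_fun A B C D) {z. Im z \<noteq> 0}"
  unfolding W_fun_def[abs_def] using invertible_if_nonreal[OF assms]
  by (intro holomorphic_matrix_mult holomorphic_matrix_inv holomorphic_matrix_affine holomorphic_M) simp

lemma meromorphic_W_fun:
  assumes "rank (hcat A B) = CARD('n)" "A ** adjm B = B ** adjm A"
  shows "meromorphic_matrix_on (W_fun A B C D) UNIV"
  unfolding W_fun_def[abs_def] using invertible_if_nonreal[OF assms]
  by (intro meromorphic_matrix_mult meromorphic_matrix_inv meromorphic_matrix_affine meromorphic_M) simp

end

locale symplectic_star = star v vj p q \<alpha>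
  for v :: real and vj :: "'n::finite \<Rightarrow> real" and p q :: "'n \<Rightarrow> real \<Rightarrow> real" and \<alpha> :: "'n \<Rightarrow> real" +
  fixes A B C D :: "complex^'n^'n"
  assumes rank: "rank (hcat A B) = CARD('n)"
    and AB: "A ** adjm B = B ** adjm A"
    and CD: "C ** adjm D - D ** adjm C = 0"
    and BC: "B ** adjm C - A ** adjm D = mat 1"
begin

abbreviation W :: "complex \<Rightarrow> complex^'n^'n" where
  "W \<equiv> W_fun A B C D"

definition W_vector :: "complex \<Rightarrow> complex^'n \<Rightarrow> (complex^'n) \<times> (complex^'n)" where
  "W_vector z x = (- (matrix_inv (B ** M z - A) *v x), M z *v (matrix_inv (B ** M z - A) *v x))"

lemma invertible_pencil: "Im z \<noteq> 0 \<Longrightarrow> invertible (B ** M z - A)"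
  by (rule invertible_if_nonreal[OF rank AB])

lemma W_vector_transform:
  assumes "Im z \<noteq> 0"
  shows "A *v fst (W_vector z x) + B *v snd (W_vector z x) = x"
    and "C *v fst (W_vector z x) + D *v snd (W_vector z x) = W z *v x"
proof -
  define c where "c = matrix_inv (B ** M z - A) *v x"
  have "(B ** M z - A) *v c = x"
    by (simp add: c_def matrix_vector_mul_assoc matrix_inv_right[OF invertible_pencil[OF assms]])
  then show "A *v fst (W_vector z x) + B *v snd (W_vector z x) = x"
    by (simp add: W_vector_def c_def[symmetric] vec.neg matrix_vector_mult_diff_rdistrib flip: matrix_vector_mul_assoc)
  have "W z *v x = (D ** M z - C) *v c"
    by (simp add: W_fun_def c_def matrix_vector_mul_assoc)
  then show "C *v fst (W_vector z x) + D *v snd (W_vector z x) = W z *v x"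
    by (simp add: W_vector_def c_def[symmetric] vec.neg matrix_vector_mult_diff_rdistrib flip: matrix_vector_mul_assoc)
qed

lemma graph_solution_W_vector:
  assumes "Im z \<noteq> 0"
  shows "graph_solution z (W_vector z x) zero_gfun \<in> D_max"
  using graph_solution_in_Dmax_iff_M[OF L2G_zero c_fun_nonzero_if_nonreal[OF assms]] by (simp add: W_vector_def)

lemma cdot_W:
  assumes "Im z \<noteq> 0" "Im w \<noteq> 0"
  shows "cdot (W z *v x) y - cdot x (W w *v y) = symplectic_form (W_vector z x) (W_vector w y)"
  using symplectic_form_completion[OF AB CD BC, of "W_vector z x" "W_vector w y"]
  by (simp add: W_vector_transform assms symplectic_form_def algebra_simps)

lemma W_cnj:
  assumes "Im z \<noteq> 0"
  shows "W (cnj z) = adjm (W z)"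
proof -
  have "cdot (M z *v x) y = cdot x (M (cnj z) *v y)" for x y
    by (simp add: cdot_def m_fun_cnj ac_simps)
  then have "symplectic_form (W_vector z x) (W_vector (cnj z) y) = 0" for x y
    by (simp add: symplectic_form_def W_vector_def cdot_simps)
  then have "cdot x (W (cnj z) *v y) = cdot (W z *v x) y" for x y
    using cdot_W[of z "cnj z" x y] assms by simp
  also have "cdot (W z *v x) y = cdot x (adjm (W z) *v y)" for x y
    using cdot_adjm[of "adjm (W z)" x y] by simp
  finally have "W (cnj z) *v y = adjm (W z) *v y" for y
    by (rule cdot_nondegenerate)
  then show ?thesis by (simp add: matrix_eq)
qed

lemma W_imaginary_part:
  assumes "Im z \<noteq> 0"
  shows "(\<Sum>i\<in>UNIV. \<Sum>k\<in>UNIV. cnj (x $ i) * (W z $ i $ k - cnj (W z $ k $ i)) * x $ k)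
    = (z - cnj z) * of_real ((normG v vj (graph_solution z (W_vector z x) zero_gfun))\<^sup>2)"
proof -
  have "(\<Sum>i\<in>UNIV. \<Sum>k\<in>UNIV. cnj (x $ i) * (W z $ i $ k - cnj (W z $ k $ i)) * x $ k)
      = (\<Sum>i\<in>UNIV. \<Sum>k\<in>UNIV. cnj (x $ i) * W z $ i $ k * x $ k) - (\<Sum>i\<in>UNIV. \<Sum>k\<in>UNIV. cnj (x $ i) * cnj (W z $ k $ i) * x $ k)"
    by (simp add: algebra_simps sum_subtractf)
  also have "(\<Sum>i\<in>UNIV. \<Sum>k\<in>UNIV. cnj (x $ i) * W z $ i $ k * x $ k) = cdot (W z *v x) x"
    by (simp add: cdot_def matrix_vector_mult_def sum_distrib_left ac_simps)
  also have "(\<Sum>i\<in>UNIV. \<Sum>k\<in>UNIV. cnj (x $ i) * cnj (W z $ k $ i) * x $ k) = cdot x (W z *v x)"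
    by (subst sum.swap) (simp add: cdot_def matrix_vector_mult_def sum_distrib_left ac_simps)
  also have "cdot (W z *v x) x - cdot x (W z *v x) = symplectic_form (W_vector z x) (W_vector z x)"
    by (rule cdot_W[OF assms assms])
  also have "\<dots> = (z - cnj z) * of_real ((normG v vj (graph_solution z (W_vector z x) zero_gfun))\<^sup>2)"
    by (rule energy_identity[OF graph_solution_W_vector[OF assms], symmetric])
  finally show ?thesis .
qed

theorem mero_nevanlinna_W: "mero_nevanlinna W"
  unfolding mero_nevanlinna_def Let_def
proof (intro conjI allI impI)
  show "(\<lambda>z. W z $ i $ k) meromorphic_on UNIV" "(\<lambda>z. W z $ i $ k) holomorphic_on {z. Im z \<noteq> 0}" for i k
    using meromorphic_W_fun[OF rank AB] holomorphic_W_fun[OF rank AB]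
    by (simp_all add: meromorphic_matrix_on_def holomorphic_matrix_on_def)
  fix z assume z: "Im z \<noteq> 0"
  show "W (cnj z) = adjm (W z)" by (rule W_cnj[OF z])
  have "z - cnj z = 2 * \<i> * of_real (Im z)" by (simp add: complex_eq_iff)
  then have "(\<Sum>i\<in>UNIV. \<Sum>k\<in>UNIV. cnj (x $ i) * (W z $ i $ k - cnj (W z $ k $ i)) * x $ k) / (2 * \<i> * of_real (Im z))
      = of_real ((normG v vj (graph_solution z (W_vector z x) zero_gfun))\<^sup>2)" for x
    unfolding W_imaginary_part[OF z] using z by simp
  then show "Im ((\<Sum>i\<in>UNIV. \<Sum>k\<in>UNIV. cnj (x $ i) * (W z $ i $ k - cnj (W z $ k $ i)) * x $ k) / (2 * \<i> * of_real (Im z))) = 0"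
    "0 \<le> Re ((\<Sum>i\<in>UNIV. \<Sum>k\<in>UNIV. cnj (x $ i) * (W z $ i $ k - cnj (W z $ k $ i)) * x $ k) / (2 * \<i> * of_real (Im z)))" for x
    by simp_all
qed

subsection \<open>The resolvent in terms of W\<close>

definition boundary_moment :: "complex \<Rightarrow> 'n gfun \<Rightarrow> complex^'n" where
  "boundary_moment z g = B *v moment 1 z g - A *v moment 2 z g"

definition resolvent_remainder :: "complex \<Rightarrow> 'n gfun \<Rightarrow> 'n gfun" where
  "resolvent_remainder z g = graph_solution z
     (moment 2 z g - adjm D *v boundary_moment z g, adjm C *v boundary_moment z g - moment 1 z g) g"

lemma W_vector_eq:
  assumes "Im z \<noteq> 0"
  shows "W_vector z x = (adjm B *v (W z *v x) - adjm D *v x, adjm C *v x - adjm A *v (W z *v x))"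
  using symplectic_completion[OF AB CD BC, of "fst (W_vector z x)" "snd (W_vector z x)"]
  by (simp add: W_vector_transform[OF assms] prod_eq_iff)

lemma resolvent_boundary_eq_W_vector:
  assumes "Im z \<noteq> 0"
  shows "resolvent_boundary A B z g = (moment 2 z g, - moment 1 z g) + W_vector z (boundary_moment z g)"
proof -
  let ?N = "B ** M z - A"
  have "B *v (M z *v moment 2 z g - moment 1 z g) = ?N *v moment 2 z g - boundary_moment z g"
    by (simp add: boundary_moment_def vec.diff matrix_vector_mul_assoc matrix_vector_mult_diff_rdistrib)
  then have "resolvent_trace A B z g = moment 2 z g - matrix_inv ?N *v boundary_moment z g"
    by (simp add: resolvent_trace_def vec.diff matrix_vector_mul_assoc matrix_inv_left[OF invertible_pencil[OF assms]])
  then show ?thesis by (simp add: resolvent_boundary_def W_vector_def)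
qed

lemma Ivec_eq_moment: "Ivec v vj p q z g j = (moment 1 z g $ j, moment 2 z g $ j)"
proof -
  have "cnj (Y j (cnj z) x $ 1 $ b) = fst (col j z b x)" "cnj (Y j (cnj z) x $ 2 $ b) = snd (col j z b x)" for b x
    using col_cnj[of j z b x] by (simp_all add: col_def prod_eq_iff)
  then show ?thesis by (simp add: Ivec_def moment_def col_moment_def dotp_def)
qed

lemma Wterm_eq_graph_solution:
  "Wterm v vj p q A B N z g
    = graph_solution z (adjm B *v (N *v boundary_moment z g), - (adjm A *v (N *v boundary_moment z g))) zero_gfun"
proof -
  have Ivec: "(\<chi> j. fst (Ivec v vj p q z g j)) = moment 1 z g" "(\<chi> j. snd (Ivec v vj p q z g j)) = moment 2 z g"
    by (simp_all add: Ivec_eq_moment)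
  show ?thesis
    unfolding Wterm_def Ivec Let_def boundary_moment_def
    by (intro ext prod_eqI) (simp_all add: graph_solution_def edge_solution_def col_def mult.commute)
qed

theorem resolv_eq_Wterm_add_remainder:
  assumes z: "Im z \<noteq> 0" and g: "L2G v vj g"
  shows "eqG v vj (resolv (TAB v vj p q \<alpha> A B) z g)
    (\<lambda>j x. addp (Wterm v vj p q A B (W z) z g j x) (resolvent_remainder z g j x))"
proof -
  let ?\<eta> = "(adjm B *v (W z *v boundary_moment z g), - (adjm A *v (W z *v boundary_moment z g)))"
  have diff: "resolvent_boundary A B z g - ?\<eta>
      = (moment 2 z g - adjm D *v boundary_moment z g, adjm C *v boundary_moment z g - moment 1 z g)"
    by (simp add: resolvent_boundary_eq_W_vector[OF z] W_vector_eq[OF z])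
  have "graph_solution z (resolvent_boundary A B z g) g
      = (\<lambda>j x. addp (Wterm v vj p q A B (W z) z g j x) (resolvent_remainder z g j x))"
    unfolding Wterm_eq_graph_solution resolvent_remainder_def diff[symmetric] graph_solution_diff[symmetric]
    by simp
  with resolv_eq_graph_solution[OF g c_fun_nonzero_if_nonreal[OF z] invertible_pencil[OF z]]
  show ?thesis by (simp only:)
qed

lemma entire_family_matrix_moment: "entire_family j (\<lambda>z f x. (N *v moment b z f) $ i)"
  unfolding matrix_vector_mult_def
  by (simp, intro entire_family_sum entire_family_cmult entire_family_moment) auto

theorem entire_components_remainder: "entire_components resolvent_remainder"
proof -
  have boundary_moment: "entire_family j (\<lambda>z f x. (N *v boundary_moment z f) $ i)" for j i and N :: "complex^'n^'n"
    using entire_family_add[OF entire_family_matrix_moment[of j "N ** B" 1 i]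
        entire_family_cmult[OF entire_family_matrix_moment[of j "N ** A" 2 i], where c = "- 1"]]
    by (simp add: boundary_moment_def vec.diff matrix_vector_mul_assoc)
  have "entire_family j (\<lambda>z f x. (moment 2 z f - adjm D *v boundary_moment z f) $ j)"
      "entire_family j (\<lambda>z f x. (adjm C *v boundary_moment z f - moment 1 z f) $ j)" for j
    using entire_family_add[OF entire_family_moment entire_family_cmult[OF boundary_moment, where c = "- 1"]]
      entire_family_add[OF boundary_moment entire_family_cmult[OF entire_family_moment, where c = "- 1"]]
    by simp_all
  then show ?thesis
    unfolding entire_components_def resolvent_remainder_def graph_solution_def fst_conv snd_conv
    by (intro allI conjI entire_family_edge_solution)
qed

end

theorem theorem4p4:
  fixes v :: real and vj :: "'n::finite \<Rightarrow> real"
    and p q :: "'n \<Rightarrow> real \<Rightarrow> real" and \<alpha> :: "'n \<Rightarrow> real"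
  assumes edges: "\<And>j. v < vj j"
    and p_L1: "\<And>j. set_integrable lborel {v..vj j} (p j)"
    and q_L1: "\<And>j. set_integrable lborel {v..vj j} (q j)"
    and alpha: "\<And>j. 0 \<le> \<alpha> j \<and> \<alpha> j < pi"
  shows
    \<comment> \<open>(i) description of all self-adjoint extensions\<close>
    "(\<forall>T. self_adjoint_ext v vj (Smin v vj p q \<alpha>) T \<longleftrightarrow>
        (\<exists>A B :: complex^'n^'n. rank (hcat A B) = CARD('n) \<and> A ** adjm B = B ** adjm A
            \<and> T = TAB v vj p q \<alpha> A B))
   \<and> \<comment> \<open>(ii) Krein-type resolvent formula\<close>
     (\<forall>A B :: complex^'n^'n. rank (hcat A B) = CARD('n) \<and> A ** adjm B = B ** adjm A \<longrightarrow>
       (\<forall>z. in_resolvent v vj (TAB v vj p q \<alpha> (mat 1) 0) z \<and> in_resolvent v vj (TAB v vj p q \<alpha> A B) z \<longrightarrow>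
         (\<forall>g. L2G v vj g \<longrightarrow>
            eqG v vj (resolv (TAB v vj p q \<alpha> A B) z g)
              (\<lambda>j x. subp (resolv (TAB v vj p q \<alpha> (mat 1) 0) z g j x)
                 (GammaZ v vj p q \<alpha> z
                    ((matrix_inv (B ** Mmat v vj p q \<alpha> z - A) ** B) *v Gamma_adj v vj p q \<alpha> (cnj z) g) j x)))))
   \<and> \<comment> \<open>(iii) the function W_{A,B} and the resolvent representation\<close>
     (\<forall>A B C D :: complex^'n^'n.
        rank (hcat A B) = CARD('n) \<and> A ** adjm B = B ** adjm A
        \<and> rank (hcat C D) = CARD('n) \<and> C ** adjm D - D ** adjm C = 0
        \<and> B ** adjm C - A ** adjm D = mat 1 \<longrightarrow>
       (let W = (\<lambda>z. (D ** Mmat v vj p q \<alpha> z - C) ** matrix_inv (B ** Mmat v vj p q \<alpha> z - A))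
        in mero_nevanlinna W
           \<and> (\<exists>F. entire_bdd_opfun v vj F \<and>
                (\<forall>z g. Im z \<noteq> 0 \<longrightarrow> L2G v vj g \<longrightarrow>
                   eqG v vj (resolv (TAB v vj p q \<alpha> A B) z g)
                     (\<lambda>j x. addp (Wterm v vj p q A B (W z) z g j x) (F z g j x))))))"
proof -
  interpret star v vj p q \<alpha> using edges p_L1 q_L1 by unfold_locales
  have W: "mero_nevanlinna (W_fun A B C D)
      \<and> (\<exists>F. entire_bdd_opfun v vj F \<and> (\<forall>z g. Im z \<noteq> 0 \<longrightarrow> L2G v vj g \<longrightarrow>
           eqG v vj (resolv (TAB v vj p q \<alpha> A B) z g) (\<lambda>j x. addp (Wterm v vj p q A B (W_fun A B C D z) z g j x) (F z g j x))))"
    if "rank (hcat A B) = CARD('n)" "A ** adjm B = B ** adjm A" "C ** adjm D - D ** adjm C = 0" "B ** adjm C - A ** adjm D = mat 1"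
    for A B C D :: "complex^'n^'n"
  proof -
    interpret symplectic_star v vj p q \<alpha> A B C D using that by unfold_locales
    from mero_nevanlinna_W entire_bdd_opfun_if_entire_components[OF entire_components_remainder] resolv_eq_Wterm_add_remainder
    show ?thesis by blast
  qed
  show ?thesis
    unfolding Let_def W_fun_def[symmetric]
    by (intro conjI)
       (use self_adjoint_ext_iff_TAB in blast, use krein_formula in blast, use W in blast)
qed

end
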